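(* Let $X = S^{i_1}\vee\cdots\vee S^{i_k}$ be a wedge of spheres with all $i_r\ge 1$, and let $Y$ be a based space satisfying the standing assumptions in the context. For every $n\geq 1$ there is an isomorphism $$G_n\big(\mathrm{map}(X,Y;0)\big)\cong G_n(Y)\oplus\bigoplus_{r=1,\dots,k} G_{n+i_r}(Y).$$
   Context: Standing assumptions: $X$ and $Y$ are based spaces that are connected, locally compact, Hausdorff and well-pointed (no further finiteness or connectivity is assumed on $Y$). Mapping spaces consist of unbased maps and carry the compact-open topology. $\mathrm{map}(X,Y;0)$ denotes the path component of the null (constant) map in the space of unbased maps $X\to Y$, based at the constant map at the basepoint of $Y$. For a based space $Z$, $\mathrm{aut}_1 Z$ denotes the path component of the identity map $1_Z$ in the space of unbased self-maps of $Z$, based at $1_Z$, and $\omega\colon \mathrm{aut}_1 Z\to Z$ is evaluation at the basepoint of $Z$. The $n$th Gottlieb group $G_n(Z)$ ($n\ge1$) is the image of $\omega_\#\colon\pi_n(\mathrm{aut}_1 Z)\to\pi_n(Z)$; it is abelian.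
   Formalization: "Connected" for Y is taken to mean path-connected; for a Y that is merely topologically connected (e.g. a circle with a whisker oscillating onto a limit interval, X = S^1, n = 1) the stated isomorphism fails. *)

theory Defs
  imports "HOL-Analysis.Analysis" "HOL-Homology.Homology"
begin

section \<open>Wedges of spheres\<close>

definition quotient_topology :: "'a topology \<Rightarrow> ('a \<Rightarrow> 'b) \<Rightarrow> 'b topology" where
  "quotient_topology X q =
     topology (\<lambda>U. U \<subseteq> q ` topspace X \<and> openin X {x \<in> topspace X. q x \<in> U})"

lemma openin_quotient_topology:
  "openin (quotient_topology X q) U \<longleftrightarrow>
     U \<subseteq> q ` topspace X \<and> openin X {x \<in> topspace X. q x \<in> U}"
proof -
  have "istopology (\<lambda>U. U \<subseteq> q ` topspace X \<and> openin X {x \<in> topspace X. q x \<in> U})"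
    unfolding istopology_def
  proof (rule conjI; clarify)
    fix S T
    assume S: "S \<subseteq> q ` topspace X" "openin X {x \<in> topspace X. q x \<in> S}"
      and T: "openin X {x \<in> topspace X. q x \<in> T}"
    have "{x \<in> topspace X. q x \<in> S \<inter> T} =
          {x \<in> topspace X. q x \<in> S} \<inter> {x \<in> topspace X. q x \<in> T}"
      by blast
    then show "S \<inter> T \<subseteq> q ` topspace X \<and> openin X {x \<in> topspace X. q x \<in> S \<inter> T}"
      using S openin_Int [OF S(2) T] by auto
  next
    fix \<U>
    assume U: "\<forall>S\<in>\<U>. S \<subseteq> q ` topspace X \<and> openin X {x \<in> topspace X. q x \<in> S}"
    have "{x \<in> topspace X. q x \<in> \<Union>\<U>} = (\<Union>S\<in>\<U>. {x \<in> topspace X. q x \<in> S})"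
      by blast
    then show "\<Union>\<U> \<subseteq> q ` topspace X \<and> openin X {x \<in> topspace X. q x \<in> \<Union>\<U>}"
      using U by (simp add: Sup_le_iff openin_clauses(3))
  qed
  then show ?thesis
    by (simp add: quotient_topology_def)
qed

lemma topspace_quotient_topology [simp]: "topspace (quotient_topology X q) = q ` topspace X"
proof -
  have "{x \<in> topspace X. q x \<in> q ` topspace X} = topspace X"
    by auto
  then have "openin (quotient_topology X q) (q ` topspace X)"
    by (simp add: openin_quotient_topology)
  then show ?thesis
    using openin_topspace [of "quotient_topology X q"] openin_subset
    unfolding openin_quotient_topology [of X q "topspace (quotient_topology X q)"]
    by (intro subset_antisym) blast+
qed

lemma quotient_map_quotient_topology: "quotient_map X (quotient_topology X q) q"
  by (auto simp: quotient_map_def openin_quotient_topology)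

text \<open>All the base points \<^term>\<open>(i, p i)\<close> of the disjoint union are identified to \<^term>\<open>None\<close>.\<close>

definition wedge :: "('i \<Rightarrow> 'a topology) \<Rightarrow> ('i \<Rightarrow> 'a) \<Rightarrow> 'i set \<Rightarrow> ('i \<times> 'a) option topology" where
  "wedge X p I =
     quotient_topology (sum_topology X I) (\<lambda>(i, x). if x = p i then None else Some (i, x))"

definition sphere_point :: "nat \<Rightarrow> real" where
  "sphere_point = (\<lambda>j. if j = 0 then 1 else 0)"

lemma sphere_point_in_nsphere: "sphere_point \<in> topspace (nsphere m)"
  by (simp add: sphere_point_def nsphere if_distrib [of "\<lambda>x. x ^ 2"] cong: if_cong)

definition wedge_of_spheres :: "nat \<Rightarrow> (nat \<Rightarrow> nat) \<Rightarrow> (nat \<times> (nat \<Rightarrow> real)) option topology" where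
  "wedge_of_spheres k i = wedge (\<lambda>r. nsphere (i r)) (\<lambda>r. sphere_point) {1..k}"


section \<open>Well-pointed spaces\<close>

definition homotopy_extension :: "'a topology \<Rightarrow> 'a set \<Rightarrow> 'w topology \<Rightarrow> bool" where
  "homotopy_extension X A W \<longleftrightarrow>
     (\<forall>f h. continuous_map X W f \<and>
            continuous_map (prod_topology (top_of_set {0..1::real}) (subtopology X A)) W h \<and>
            (\<forall>a\<in>topspace X \<inter> A. h (0, a) = f a) \<longrightarrow>
        (\<exists>H. continuous_map (prod_topology (top_of_set {0..1::real}) X) W H \<and>
             (\<forall>x\<in>topspace X. H (0, x) = f x) \<and>
             (\<forall>t\<in>{0..1}. \<forall>a\<in>topspace X \<inter> A. H (t, a) = h (t, a))))"

text \<open>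
  The inclusion of the base point is a cofibration. A definition cannot quantify over all
  types of test spaces; spaces on \<^typ>\<open>real \<times> 'a\<close> suffice, because the universal test space is the
  subspace $(0 \times X) \cup (I \times x_0)$ of $I \times X$. For closed points the lemma
  below recovers the property for test spaces of arbitrary type.
\<close>

definition well_pointed :: "'a topology \<Rightarrow> 'a \<Rightarrow> bool" where
  "well_pointed X x0 \<longleftrightarrow>
     x0 \<in> topspace X \<and> (\<forall>W :: (real \<times> 'a) topology. homotopy_extension X {x0} W)"

lemma well_pointed_homotopy_extension:
  fixes X :: "'a topology" and W :: "'w topology"
  assumes wp: "well_pointed X x0" and cl: "closedin X {x0}"
  shows "homotopy_extension X {x0} W"
  unfolding homotopy_extension_def
proof (intro allI impI; elim conjE)
  fix f :: "'a \<Rightarrow> 'w" and h :: "real \<times> 'a \<Rightarrow> 'w"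
  let ?I = "top_of_set {0..1::real}"
  let ?P = "prod_topology ?I X"
  define M where "M = ({0} \<times> topspace X) \<union> ({0..1::real} \<times> {x0})"
  let ?T = "subtopology ?P M"
  assume f: "continuous_map X W f"
    and h: "continuous_map (prod_topology ?I (subtopology X {x0})) W h"
    and hf: "\<forall>a\<in>topspace X \<inter> {x0}. h (0, a) = f a"
  have x0: "x0 \<in> topspace X" and hep: "homotopy_extension X {x0} ?T"
    using wp by (auto simp: well_pointed_def)
  have topT: "topspace ?T = M"
    using x0 by (auto simp: M_def)
  have 1: "continuous_map X ?T (\<lambda>y. (0, y))"
    by (auto simp: continuous_map_in_subtopology continuous_map_pairwise o_def M_def)
  have 2: "continuous_map (prod_topology ?I (subtopology X {x0})) ?T (\<lambda>z. z)"
  proof -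
    have "prod_topology ?I (subtopology X {x0}) = subtopology ?P ({0..1} \<times> {x0})"
      by (simp add: prod_topology_subtopology(2))
    then have "continuous_map (prod_topology ?I (subtopology X {x0})) ?P (\<lambda>z. z)"
      by (simp add: continuous_map_from_subtopology)
    then show ?thesis
      by (auto simp: continuous_map_in_subtopology M_def)
  qed
  have "\<exists>R. continuous_map ?P ?T R \<and> (\<forall>y\<in>topspace X. R (0, y) = (0, y)) \<and>
            (\<forall>t\<in>{0..1}. \<forall>a\<in>topspace X \<inter> {x0}. R (t, a) = (t, a))"
    by (rule hep[unfolded homotopy_extension_def, rule_format]) (use 1 2 in simp)
  then obtain R where R: "continuous_map ?P ?T R"
    and R0: "\<forall>y\<in>topspace X. R (0, y) = (0, y)"
    and Rx: "\<forall>t\<in>{0..1}. \<forall>a\<in>topspace X \<inter> {x0}. R (t, a) = (t, a)"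
    by blast
  define g where "g = (\<lambda>z. if snd z = x0 then h z else f (snd z))"
  have g: "continuous_map ?T W g"
  proof -
    let ?A = "{0} \<times> topspace X" and ?B = "{0..1::real} \<times> {x0}"
    have "closedin ?I {0}"
      by (simp add: closedin_closed_eq)
    then have A: "closedin ?T ?A"
      by (intro closedin_subset_topspace) (simp_all add: M_def closedin_prod_Times_iff)
    have "closedin ?I {0..1}"
      by (metis closedin_topspace topspace_euclidean_subtopology)
    with cl have B: "closedin ?T ?B"
      by (intro closedin_subset_topspace) (simp_all add: M_def closedin_prod_Times_iff)
    have gA: "continuous_map (subtopology ?T ?A) W g"
    proof (rule continuous_map_eq)
      show "continuous_map (subtopology ?T ?A) W (f \<circ> snd)"
        by (intro continuous_map_compose [OF _ f] continuous_map_from_subtopology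
              continuous_map_snd)
      show "\<And>z. z \<in> topspace (subtopology ?T ?A) \<Longrightarrow> (f \<circ> snd) z = g z"
        using hf x0 by (auto simp: g_def)
    qed
    have gB: "continuous_map (subtopology ?T ?B) W g"
    proof (rule continuous_map_eq)
      have "continuous_map (subtopology ?T ?B) (prod_topology ?I (subtopology X {x0})) (\<lambda>z. z)"
      proof -
        have "prod_topology ?I (subtopology X {x0}) = subtopology ?P ({0..1} \<times> {x0})"
          by (simp add: prod_topology_subtopology(2))
        then show ?thesis
          by (auto simp: continuous_map_in_subtopology continuous_map_from_subtopology)
      qed
      from continuous_map_compose [OF this h]
      show "continuous_map (subtopology ?T ?B) W h"
        by (simp add: o_def)
      show "\<And>z. z \<in> topspace (subtopology ?T ?B) \<Longrightarrow> h z = g z"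
        by (auto simp: g_def)
    qed
    show ?thesis
    proof (rule pasting_lemma_closed [where I = "UNIV :: bool set"
            and T = "\<lambda>b. if b then ?A else ?B" and f = "\<lambda>b. g"])
      show "\<exists>j. j \<in> UNIV \<and> z \<in> (if j then ?A else ?B) \<and> g z = g z"
        if "z \<in> topspace ?T" for z
        using that unfolding topT M_def by (intro exI [of _ "z \<in> ?A"]) auto
    qed (use A B gA gB in auto)
  qed
  have "(g \<circ> R) (0, y) = f y" if "y \<in> topspace X" for y
    using that R0 hf x0 by (auto simp: g_def)
  moreover have "(g \<circ> R) (t, a) = h (t, a)"
    if "t \<in> {0..1}" "a \<in> topspace X \<inter> {x0}" for t a
    using Rx[rule_format, OF that] that by (auto simp: g_def)
  ultimately
  show "\<exists>H. continuous_map ?P W H \<and> (\<forall>x\<in>topspace X. H (0, x) = f x) \<and>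
            (\<forall>t\<in>{0..1}. \<forall>a\<in>topspace X \<inter> {x0}. H (t, a) = h (t, a))"
    using continuous_map_compose [OF R g] by blast
qed


section \<open>Mapping spaces\<close>

text \<open>
  The space of unbased maps with the compact-open topology. A map on \<^term>\<open>topspace X\<close> is represented by
  the function that is \<^const>\<open>undefined\<close> outside, so that equal maps are equal points.
\<close>

definition mapping_space :: "'a topology \<Rightarrow> 'b topology \<Rightarrow> ('a \<Rightarrow> 'b) topology" where
  "mapping_space X Y =
     subtopology
       (topology_generated_by {{f. f ` K \<subseteq> U} |K U. compactin X K \<and> openin Y U})
       {f \<in> extensional (topspace X). continuous_map X Y f}"

lemma topspace_mapping_space:
  "topspace (mapping_space X Y) = {f \<in> extensional (topspace X). continuous_map X Y f}"
proof -
  have "UNIV \<in> {{f. f ` K \<subseteq> U} |K U. compactin X K \<and> openin Y U}"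
    by (rule CollectI, rule exI [of _ "{}"], rule exI [of _ "{}"]) auto
  then have "topspace (topology_generated_by {{f. f ` K \<subseteq> U} |K U. compactin X K \<and> openin Y U})
             = UNIV"
    unfolding topology_generated_by_topspace by blast
  then show ?thesis
    by (simp add: mapping_space_def)
qed

definition path_component_space :: "'a topology \<Rightarrow> 'a \<Rightarrow> 'a topology" where
  "path_component_space X x = subtopology X (path_component_of_set X x)"

definition const_map :: "'a topology \<Rightarrow> 'b \<Rightarrow> 'a \<Rightarrow> 'b" where
  "const_map X y = (\<lambda>x\<in>topspace X. y)"

definition id_map :: "'a topology \<Rightarrow> 'a \<Rightarrow> 'a" where
  "id_map X = (\<lambda>x\<in>topspace X. x)"

definition null_component :: "'a topology \<Rightarrow> 'b topology \<Rightarrow> 'b \<Rightarrow> ('a \<Rightarrow> 'b) topology" where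
  "null_component X Y y0 = path_component_space (mapping_space X Y) (const_map X y0)"

definition aut1 :: "'a topology \<Rightarrow> ('a \<Rightarrow> 'a) topology" where
  "aut1 Z = path_component_space (mapping_space Z Z) (id_map Z)"


section \<open>Homotopy groups\<close>

definition cube :: "nat \<Rightarrow> (nat \<Rightarrow> real) topology" where
  "cube n = product_topology (\<lambda>j. top_of_set {0..1}) {..<n}"

definition cube_boundary :: "nat \<Rightarrow> (nat \<Rightarrow> real) set" where
  "cube_boundary n = {s \<in> topspace (cube n). \<exists>j<n. s j = 0 \<or> s j = 1}"

definition cube_maps :: "nat \<Rightarrow> 'a topology \<Rightarrow> 'a \<Rightarrow> ((nat \<Rightarrow> real) \<Rightarrow> 'a) set" where
  "cube_maps n Z z = {f. continuous_map (cube n) Z f \<and> (\<forall>s\<in>cube_boundary n. f s = z)}"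

definition cube_homotopic ::
  "nat \<Rightarrow> 'a topology \<Rightarrow> 'a \<Rightarrow> ((nat \<Rightarrow> real) \<Rightarrow> 'a) \<Rightarrow> ((nat \<Rightarrow> real) \<Rightarrow> 'a) \<Rightarrow> bool" where
  "cube_homotopic n Z z = homotopic_with (\<lambda>f. \<forall>s\<in>cube_boundary n. f s = z) (cube n) Z"

definition cube_concat ::
  "((nat \<Rightarrow> real) \<Rightarrow> 'a) \<Rightarrow> ((nat \<Rightarrow> real) \<Rightarrow> 'a) \<Rightarrow> (nat \<Rightarrow> real) \<Rightarrow> 'a" where
  "cube_concat f g =
     (\<lambda>s. if s 0 \<le> 1/2 then f (s(0 := 2 * s 0)) else g (s(0 := 2 * s 0 - 1)))"

definition homotopy_class ::
  "nat \<Rightarrow> 'a topology \<Rightarrow> 'a \<Rightarrow> ((nat \<Rightarrow> real) \<Rightarrow> 'a) \<Rightarrow> ((nat \<Rightarrow> real) \<Rightarrow> 'a) set" where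
  "homotopy_class n Z z f = {g. cube_homotopic n Z z f g}"

text \<open>
  Meaningful for $n \ge 1$ and \<^term>\<open>z \<in> topspace Z\<close>. The product of two classes collects everything
  homotopic to a concatenation of representatives, which is a single class.
\<close>

definition homotopy_group ::
  "nat \<Rightarrow> 'a topology \<Rightarrow> 'a \<Rightarrow> ((nat \<Rightarrow> real) \<Rightarrow> 'a) set monoid" where
  "homotopy_group n Z z =
     \<lparr>carrier = homotopy_class n Z z ` cube_maps n Z z,
      monoid.mult = (\<lambda>A B. {h. \<exists>f\<in>A. \<exists>g\<in>B. cube_homotopic n Z z (cube_concat f g) h}),
      one = homotopy_class n Z z (\<lambda>s. z)\<rparr>"

text \<open>The map induced by \<^term>\<open>\<phi>\<close> into the homotopy group of \<^term>\<open>W\<close> at \<^term>\<open>w\<close>.\<close>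

definition homotopy_induced ::
  "nat \<Rightarrow> 'b topology \<Rightarrow> 'b \<Rightarrow> ('a \<Rightarrow> 'b) \<Rightarrow>
     ((nat \<Rightarrow> real) \<Rightarrow> 'a) set \<Rightarrow> ((nat \<Rightarrow> real) \<Rightarrow> 'b) set" where
  "homotopy_induced n W w \<phi> A = {g. \<exists>f\<in>A. cube_homotopic n W w (\<phi> \<circ> f) g}"

definition gottlieb_group ::
  "nat \<Rightarrow> 'a topology \<Rightarrow> 'a \<Rightarrow> ((nat \<Rightarrow> real) \<Rightarrow> 'a) set monoid" where
  "gottlieb_group n Z z =
     (homotopy_group n Z z)
       \<lparr>carrier := homotopy_induced n Z z (\<lambda>f. f z) ` carrier (homotopy_group n (aut1 Z) (id_map Z))\<rparr>"

end

theory Submission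
  imports Defs
begin

text \<open>
  Let $M$ be the null component and $W$ the wedge. Adjunction turns a Gottlieb element of $M$ into a
  map $\Psi : I^n \times W \times Y \to Y$ that is the projection to $Y$ over the boundary of the cube,
  restricted to $y_0$; conversely such a $\Psi$ acts on $M$ by $f \mapsto \Psi(s, -, f(-))$. Thus
  $G_n(M)$ is the image of $\pi_n(\mathrm{map}(W, \mathrm{aut}_1 Y))$, and substituting one $\Psi$ into another
  shows that it is abelian. The fibration $\mathrm{map}(W, -) \to (-)$ splits by the constant maps, its fibre is
  a product of loop spaces, and both facts are natural for the evaluation $\mathrm{aut}_1 Y \to Y$; so an
  element of $G_n(M)$ is uniquely a constant family from $G_n(Y)$ times the union of cells from the
  $G_{n + i_r}(Y)$.
\<close>

section \<open>Cubes and homotopy groups\<close>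

text \<open>The two facts about the fibration are each replaced by one explicit homotopy. The
  obstacle is that a homotopy of maps out of the wedge may move the wedge point, while a
  representative of a class of degree \<open>n + m r\<close> must stay at \<open>y0\<close> on the
  whole boundary of its cube. The remedy is a collar: a cell is stretched about its centre by a
  factor \<open>1 + v\<close>, what leaves the cube is pressed onto the boundary and so goes to the
  wedge point, and the overshoot serves as a clock that retraces the motion of the wedge point. Used
  on a nullhomotopy this gives injectivity, used on a family \<Psi> it gives surjectivity. In the
  second case the argument in Y has to stay free, since only then is the cell that is split off
  again a Gottlieb element; hence Gottlieb groups are described by maps on products. The cube
  \<open>cube (n + m r)\<close> carries the n parameters first and concatenation acts on coordinate
  0, so all group structures live in the same coordinate.\<close>

abbreviation UI :: "real topology" where
  "UI \<equiv> top_of_set {0..1}"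

lemma continuous_map_UI_iff:
  "continuous_map T UI a \<longleftrightarrow>
     continuous_map T euclideanreal a \<and> (\<forall>t\<in>topspace T. 0 \<le> a t \<and> a t \<le> 1)"
  by (auto simp: continuous_map_in_subtopology)

lemma in_topspace_cube:
  "s \<in> topspace (cube n) \<longleftrightarrow> s \<in> extensional {..<n} \<and> (\<forall>j<n. 0 \<le> s j \<and> s j \<le> 1)"
  by (auto simp: cube_def PiE_iff)

lemma cube_boundary_subset: "cube_boundary n \<subseteq> topspace (cube n)"
  by (auto simp: cube_boundary_def)

lemma in_cube_boundaryI:
  "s \<in> topspace (cube n) \<Longrightarrow> j < n \<Longrightarrow> s j = 0 \<or> s j = 1 \<Longrightarrow> s \<in> cube_boundary n"
  by (auto simp: cube_boundary_def)

lemma continuous_map_into_cubeI: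
  assumes "\<And>t. t \<in> topspace T \<Longrightarrow> f t \<in> extensional {..<n}"
    and "\<And>j. j < n \<Longrightarrow> continuous_map T UI (\<lambda>t. f t j)"
  shows "continuous_map T (cube n) f"
  using assms by (auto simp: cube_def continuous_map_componentwise)

lemma continuous_map_cube_coord:
  assumes "continuous_map T (cube n) f" "j < n"
  shows "continuous_map T UI (\<lambda>t. f t j)"
  using assms by (auto simp: cube_def continuous_map_componentwise)

lemma cube_upd:
  "s \<in> topspace (cube n) \<Longrightarrow> 0 < n \<Longrightarrow> 0 \<le> a \<Longrightarrow> a \<le> 1 \<Longrightarrow> s(0 := a) \<in> topspace (cube n)"
  by (auto simp: in_topspace_cube extensional_def)

lemma cube_upd_boundary:
  assumes "s \<in> cube_boundary n" "0 < n" "0 \<le> a" "a \<le> 1" "s 0 = 0 \<or> s 0 = 1 \<Longrightarrow> a = 0 \<or> a = 1"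
  shows "s(0 := a) \<in> cube_boundary n"
proof -
  obtain j where "j < n" "s j = 0 \<or> s j = 1"
    using assms(1) by (auto simp: cube_boundary_def)
  moreover have "s(0 := a) \<in> topspace (cube n)"
    using assms cube_boundary_subset cube_upd by blast
  ultimately show ?thesis
    using assms(5) by (intro in_cube_boundaryI [of _ n j]) (cases "j = 0"; auto)+
qed

lemma continuous_map_cube_upd:
  assumes f: "continuous_map T (cube n) f" and a: "continuous_map T UI a" and n: "0 < n"
  shows "continuous_map T (cube n) (\<lambda>t. (f t)(0 := a t))"
proof (rule continuous_map_into_cubeI)
  show "(f t)(0 := a t) \<in> extensional {..<n}" if "t \<in> topspace T" for t
    using continuous_map_funspace [OF f] that n by (auto simp: in_topspace_cube extensional_def Pi_iff)
  show "continuous_map T UI (\<lambda>t. ((f t)(0 := a t)) j)" if "j < n" for j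
    using continuous_map_cube_coord [OF f that] a by (cases "j = 0") auto
qed

lemma cube_boundary_nonempty: "0 < n \<Longrightarrow> (\<lambda>j\<in>{..<n}. 0) \<in> cube_boundary n"
  by (auto simp: cube_boundary_def in_topspace_cube)

lemma path_connected_space_cube: "path_connected_space (cube n)"
proof -
  have "path_connected_space UI"
    using path_connected_space_euclidean_subtopology convex_imp_path_connected by blast
  then show ?thesis
    by (auto simp: cube_def path_connected_space_product_topology)
qed

lemma compact_space_cube: "compact_space (cube n)"
proof -
  have "compact_space UI"
    by (simp add: compact_space_subtopology)
  then show ?thesis
    by (auto simp: cube_def compact_space_product_topology)
qed

text \<open>The parameter t in \<open>F\<close> and \<open>G\<close> lets one statement serve
  concatenations of maps and of homotopies.\<close>

lemma continuous_map_cube_concat: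
  assumes \<sigma>: "continuous_map T (cube n) \<sigma>" and n: "0 < n"
    and F: "continuous_map (prod_topology T (cube n)) Z (\<lambda>p. F (fst p) (snd p))"
    and G: "continuous_map (prod_topology T (cube n)) Z (\<lambda>p. G (fst p) (snd p))"
    and FG: "\<And>t. t \<in> topspace T \<Longrightarrow> \<sigma> t 0 = 1/2 \<Longrightarrow> F t ((\<sigma> t)(0 := 1)) = G t ((\<sigma> t)(0 := 0))"
  shows "continuous_map T Z (\<lambda>t. cube_concat (F t) (G t) (\<sigma> t))"
proof -
  have c0: "continuous_map T euclideanreal (\<lambda>t. \<sigma> t 0)"
    using continuous_map_cube_coord [OF \<sigma> n] by (simp add: continuous_map_UI_iff)
  have bnd: "0 \<le> \<sigma> t 0" "\<sigma> t 0 \<le> 1" if "t \<in> topspace T" for t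
    using continuous_map_cube_coord [OF \<sigma> n] that by (auto simp: continuous_map_UI_iff)
  \<comment> \<open>The clamps \<open>min 1\<close> and \<open>max 0\<close> keep both
    reparametrised points in the cube for every t, also where the other branch is selected, so each
    half is continuous on all of T.\<close>
  let ?F = "\<lambda>t. F t ((\<sigma> t)(0 := min 1 (2 * \<sigma> t 0)))"
  let ?G = "\<lambda>t. G t ((\<sigma> t)(0 := max 0 (2 * \<sigma> t 0 - 1)))"
  have "continuous_map T UI (\<lambda>t. min 1 (2 * \<sigma> t 0))" "continuous_map T UI (\<lambda>t. max 0 (2 * \<sigma> t 0 - 1))"
    using bnd by (auto simp: continuous_map_UI_iff intro!: continuous_intros c0)
  then have 1: "continuous_map T (prod_topology T (cube n)) (\<lambda>t. (t, (\<sigma> t)(0 := min 1 (2 * \<sigma> t 0))))"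
    "continuous_map T (prod_topology T (cube n)) (\<lambda>t. (t, (\<sigma> t)(0 := max 0 (2 * \<sigma> t 0 - 1))))"
    by (auto simp: continuous_map_pairwise o_def intro!: continuous_map_cube_upd \<sigma> n)
  have 2: "continuous_map T Z ?F" "continuous_map T Z ?G"
    using continuous_map_compose [OF 1(1) F] continuous_map_compose [OF 1(2) G] by (simp_all add: o_def)
  have "continuous_map T Z (\<lambda>t. if \<sigma> t 0 \<le> 1/2 then ?F t else ?G t)"
    by (rule continuous_map_cases_le)
       (use c0 2 FG in \<open>auto intro: continuous_map_from_subtopology\<close>)
  moreover have "cube_concat (F t) (G t) (\<sigma> t) = (if \<sigma> t 0 \<le> 1/2 then ?F t else ?G t)" for t
    by (simp add: cube_concat_def min_absorb2 max_absorb2)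
  ultimately show ?thesis
    by simp
qed

section \<open>Homotopy of cube maps relative to the boundary\<close>

lemma cube_homotopic_iff:
  "cube_homotopic n Z z f g \<longleftrightarrow>
     (\<exists>h. continuous_map (prod_topology UI (cube n)) Z h \<and>
          (\<forall>s\<in>topspace (cube n). h (0, s) = f s) \<and> (\<forall>s\<in>topspace (cube n). h (1, s) = g s) \<and>
          (\<forall>t\<in>{0..1}. \<forall>s\<in>cube_boundary n. h (t, s) = z))"
  unfolding cube_homotopic_def
  by (rule homotopic_with) (metis cube_boundary_subset subsetD)

lemma cube_homotopicI:
  assumes "continuous_map (prod_topology UI (cube n)) Z h"
    and "\<And>s. s \<in> topspace (cube n) \<Longrightarrow> h (0, s) = f s"
    and "\<And>s. s \<in> topspace (cube n) \<Longrightarrow> h (1, s) = g s"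
    and "\<And>t s. t \<in> {0..1} \<Longrightarrow> s \<in> cube_boundary n \<Longrightarrow> h (t, s) = z"
  shows "cube_homotopic n Z z f g"
  using assms unfolding cube_homotopic_iff by (intro exI [of _ h]) auto

lemma cube_homotopic_refl: "f \<in> cube_maps n Z z \<Longrightarrow> cube_homotopic n Z z f f"
  by (auto simp: cube_homotopic_def cube_maps_def)

lemma cube_homotopic_sym: "cube_homotopic n Z z f g \<longleftrightarrow> cube_homotopic n Z z g f"
  by (simp add: cube_homotopic_def homotopic_with_sym)

lemma cube_homotopic_trans:
  "cube_homotopic n Z z f g \<Longrightarrow> cube_homotopic n Z z g h \<Longrightarrow> cube_homotopic n Z z f h"
  unfolding cube_homotopic_def by (rule homotopic_with_trans)

lemma cube_homotopic_imp_cube_maps: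
  assumes "cube_homotopic n Z z f g"
  shows "f \<in> cube_maps n Z z" "g \<in> cube_maps n Z z"
proof -
  have "continuous_map (cube n) Z f \<and> continuous_map (cube n) Z g"
    using assms unfolding cube_homotopic_def by (rule homotopic_with_imp_continuous_maps)
  moreover have "(\<forall>s\<in>cube_boundary n. f s = z) \<and> (\<forall>s\<in>cube_boundary n. g s = z)"
    using homotopic_with_imp_property [of "\<lambda>f. \<forall>s\<in>cube_boundary n. f s = z" "cube n" Z f g]
      assms unfolding cube_homotopic_def by simp
  ultimately show "f \<in> cube_maps n Z z" "g \<in> cube_maps n Z z"
    unfolding cube_maps_def by blast+
qed

text \<open>Cube maps take arbitrary values outside \<open>topspace (cube n)\<close>, so agreement
  on the cube is weaker than equality of functions; the stationary homotopy closes this gap.\<close>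

lemma cube_homotopic_eq:
  assumes "f \<in> cube_maps n Z z" "\<And>s. s \<in> topspace (cube n) \<Longrightarrow> f s = g s"
  shows "cube_homotopic n Z z f g"
proof (rule cube_homotopicI)
  have "continuous_map (cube n) Z f"
    using assms(1) by (simp add: cube_maps_def)
  then show "continuous_map (prod_topology UI (cube n)) Z (f \<circ> snd)"
    by (rule continuous_map_compose [OF continuous_map_snd])
  show "(f \<circ> snd) (t, s) = z" if "s \<in> cube_boundary n" for t s
    using assms(1) that by (simp add: cube_maps_def)
qed (simp_all add: assms(2))

lemma homotopy_class_eq:
  "cube_homotopic n Z z f g \<Longrightarrow> homotopy_class n Z z f = homotopy_class n Z z g"
  unfolding homotopy_class_def by (rule Collect_cong) (metis cube_homotopic_sym cube_homotopic_trans)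

lemma homotopy_class_eq_iff:
  assumes "f \<in> cube_maps n Z z"
  shows "homotopy_class n Z z f = homotopy_class n Z z g \<longleftrightarrow> cube_homotopic n Z z f g"
proof
  assume "homotopy_class n Z z f = homotopy_class n Z z g"
  moreover have "f \<in> homotopy_class n Z z f"
    using assms by (simp add: homotopy_class_def cube_homotopic_refl)
  ultimately show "cube_homotopic n Z z f g"
    using cube_homotopic_sym by (force simp: homotopy_class_def)
qed (rule homotopy_class_eq)

lemma in_homotopy_class: "f \<in> cube_maps n Z z \<Longrightarrow> f \<in> homotopy_class n Z z f"
  by (simp add: homotopy_class_def cube_homotopic_refl)

lemma const_in_cube_maps: "z \<in> topspace Z \<Longrightarrow> (\<lambda>s. z) \<in> cube_maps n Z z"
  by (auto simp: cube_maps_def)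

lemma cube_concat_in_cube_maps:
  assumes "f \<in> cube_maps n Z z" "g \<in> cube_maps n Z z" "0 < n"
  shows "cube_concat f g \<in> cube_maps n Z z"
proof -
  have f: "continuous_map (cube n) Z f" "\<And>s. s \<in> cube_boundary n \<Longrightarrow> f s = z"
    and g: "continuous_map (cube n) Z g" "\<And>s. s \<in> cube_boundary n \<Longrightarrow> g s = z"
    using assms by (auto simp: cube_maps_def)
  have b: "s(0 := 1) \<in> cube_boundary n" "s(0 := 0) \<in> cube_boundary n" if "s \<in> topspace (cube n)" for s
    using that assms(3) by (auto intro!: in_cube_boundaryI [of _ n 0] cube_upd)
  have "continuous_map (cube n) Z (\<lambda>s. cube_concat f g s)"
    by (rule continuous_map_cube_concat)
       (use assms(3) b f g continuous_map_compose [OF continuous_map_snd f(1)]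
          continuous_map_compose [OF continuous_map_snd g(1)] in \<open>auto simp: o_def\<close>)
  moreover have "cube_concat f g s = z" if s: "s \<in> cube_boundary n" for s
  proof -
    have "0 \<le> s 0" "s 0 \<le> 1"
      using s assms(3) by (auto simp: cube_boundary_def in_topspace_cube)
    then show ?thesis
      using s assms(3)
      by (auto simp: cube_concat_def intro!: f g cube_upd_boundary)
  qed
  ultimately show ?thesis
    by (auto simp: cube_maps_def)
qed

lemma cube_homotopic_concat:
  assumes "cube_homotopic n Z z f f'" "cube_homotopic n Z z g g'" and n: "0 < n"
  shows "cube_homotopic n Z z (cube_concat f g) (cube_concat f' g')"
proof -
  obtain h where h: "continuous_map (prod_topology UI (cube n)) Z h"
    "\<And>s. s \<in> topspace (cube n) \<Longrightarrow> h (0, s) = f s" "\<And>s. s \<in> topspace (cube n) \<Longrightarrow> h (1, s) = f' s"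
    "\<And>t s. t \<in> {0..1} \<Longrightarrow> s \<in> cube_boundary n \<Longrightarrow> h (t, s) = z"
    using assms(1) unfolding cube_homotopic_iff by blast
  obtain k where k: "continuous_map (prod_topology UI (cube n)) Z k"
    "\<And>s. s \<in> topspace (cube n) \<Longrightarrow> k (0, s) = g s" "\<And>s. s \<in> topspace (cube n) \<Longrightarrow> k (1, s) = g' s"
    "\<And>t s. t \<in> {0..1} \<Longrightarrow> s \<in> cube_boundary n \<Longrightarrow> k (t, s) = z"
    using assms(2) unfolding cube_homotopic_iff by blast
  let ?H = "\<lambda>p. cube_concat (\<lambda>s. h (fst p, s)) (\<lambda>s. k (fst p, s)) (snd p)"
  have b: "s(0 := 1) \<in> cube_boundary n" "s(0 := 0) \<in> cube_boundary n" if "s \<in> topspace (cube n)" for s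
    using that n by (auto intro!: in_cube_boundaryI [of _ n 0] cube_upd)
  have bnd: "0 \<le> s 0" "s 0 \<le> 1" if "s \<in> topspace (cube n)" for s
    using that n by (auto simp: in_topspace_cube)
  have *: "continuous_map (prod_topology (prod_topology UI (cube n)) (cube n)) (prod_topology UI (cube n))
           (\<lambda>q. (fst (fst q), snd q))"
    by (intro continuous_map_pairedI continuous_map_snd continuous_map_fst
        continuous_map_compose [OF continuous_map_fst continuous_map_fst, unfolded o_def])
  have "continuous_map (prod_topology UI (cube n)) Z ?H"
  proof (rule continuous_map_cube_concat [OF continuous_map_snd n])
    show "continuous_map (prod_topology (prod_topology UI (cube n)) (cube n)) Z (\<lambda>q. h (fst (fst q), snd q))"
      using continuous_map_compose [OF * h(1)] by (simp add: o_def)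
    show "continuous_map (prod_topology (prod_topology UI (cube n)) (cube n)) Z (\<lambda>q. k (fst (fst q), snd q))"
      using continuous_map_compose [OF * k(1)] by (simp add: o_def)
  qed (use b h k in auto)
  then show ?thesis
  proof (rule cube_homotopicI)
    show "?H (t, s) = z" if "t \<in> {0..1}" "s \<in> cube_boundary n" for t s
      using that n bnd cube_boundary_subset
      by (auto simp: cube_concat_def subset_iff intro!: h k cube_upd_boundary)
  qed (use n h k bnd in \<open>auto simp: cube_concat_def cube_upd\<close>)
qed

text \<open>The interval is convex, so coordinate 0 can be moved along the straight line from \<rho>
  to \<rho>'. The conditions on the ends keep the two faces of coordinate 0 in the boundary at every
  stage. Associativity, unit and inverse are all instances: both sides are reparametrisations of one
  cube map.\<close>

lemma cube_homotopic_reparam: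
  assumes f: "f \<in> cube_maps n Z z" and n: "0 < n"
    and \<rho>: "continuous_map UI UI \<rho>" "continuous_map UI UI \<rho>'"
    and ends: "\<rho> 0 = \<rho>' 0" "\<rho> 1 = \<rho>' 1" "\<rho> 0 \<in> {0, 1}" "\<rho> 1 \<in> {0, 1}"
    and g: "\<And>s. s \<in> topspace (cube n) \<Longrightarrow> g s = f (s(0 := \<rho> (s 0)))"
    and g': "\<And>s. s \<in> topspace (cube n) \<Longrightarrow> g' s = f (s(0 := \<rho>' (s 0)))"
  shows "cube_homotopic n Z z g g'"
proof -
  let ?a = "\<lambda>p::real \<times> (nat \<Rightarrow> real). (1 - fst p) * \<rho> (snd p 0) + fst p * \<rho>' (snd p 0)"
  let ?P = "prod_topology UI (cube n)"
  have bnd: "0 \<le> s 0" "s 0 \<le> 1" if "s \<in> topspace (cube n)" for s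
    using that n by (auto simp: in_topspace_cube)
  have bnd\<rho>: "0 \<le> \<rho> t" "\<rho> t \<le> 1" "0 \<le> \<rho>' t" "\<rho>' t \<le> 1" if "0 \<le> t" "t \<le> 1" for t
    using \<rho> that by (auto simp: continuous_map_UI_iff)
  have c0: "continuous_map ?P UI (\<lambda>p. snd p 0)"
    by (rule continuous_map_cube_coord [OF continuous_map_snd n])
  have c: "continuous_map ?P euclideanreal (\<lambda>p. \<rho> (snd p 0))" "continuous_map ?P euclideanreal (\<lambda>p. \<rho>' (snd p 0))"
    using continuous_map_compose [OF c0 \<rho>(1)] continuous_map_compose [OF c0 \<rho>(2)]
    by (auto simp: o_def continuous_map_UI_iff)
  have cf: "continuous_map ?P euclideanreal fst"
    using continuous_map_fst [of UI "cube n"] by (simp add: continuous_map_UI_iff)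
  have a01: "0 \<le> ?a (t, s)" "?a (t, s) \<le> 1" if "0 \<le> t" "t \<le> 1" "s \<in> topspace (cube n)" for t s
  proof -
    show "0 \<le> ?a (t, s)"
      using that bnd bnd\<rho> by simp
    have "?a (t, s) \<le> (1 - t) * 1 + t * 1"
      unfolding fst_conv snd_conv
      by (intro add_mono mult_left_mono) (use that bnd bnd\<rho> in auto)
    then show "?a (t, s) \<le> 1"
      by simp
  qed
  have "continuous_map ?P UI ?a"
    using a01 by (auto simp: continuous_map_UI_iff intro!: continuous_intros c cf)
  then have "continuous_map ?P (cube n) (\<lambda>p. (snd p)(0 := ?a p))"
    by (intro continuous_map_cube_upd continuous_map_snd n)
  then have 1: "continuous_map ?P Z (\<lambda>p. f ((snd p)(0 := ?a p)))"
    using continuous_map_compose [of ?P "cube n" _ Z f] f by (auto simp: o_def cube_maps_def)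
  show ?thesis
  proof (rule cube_homotopicI [OF 1])
    fix t :: real and s assume t: "t \<in> {0..1}" and s: "s \<in> cube_boundary n"
    have "?a (t, s) = \<rho> (s 0)" if "s 0 = 0 \<or> s 0 = 1"
      using that ends by (auto simp: algebra_simps)
    then have "s 0 = 0 \<or> s 0 = 1 \<Longrightarrow> ?a (t, s) = 0 \<or> ?a (t, s) = 1"
      using ends by auto
    moreover have "s \<in> topspace (cube n)"
      using s cube_boundary_subset by blast
    ultimately have "s(0 := ?a (t, s)) \<in> cube_boundary n"
      using a01 s t n by (intro cube_upd_boundary) auto
    then show "f ((snd (t, s))(0 := ?a (t, s))) = z"
      using f by (simp add: cube_maps_def)
  qed (use g g' in auto)
qed

definition cube_rev :: "((nat \<Rightarrow> real) \<Rightarrow> 'a) \<Rightarrow> (nat \<Rightarrow> real) \<Rightarrow> 'a" where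
  "cube_rev f = (\<lambda>s. f (s(0 := 1 - s 0)))"

lemma continuous_map_UI_UI:
  assumes "continuous_on {0..1} \<rho>" "\<And>t. 0 \<le> t \<Longrightarrow> t \<le> 1 \<Longrightarrow> 0 \<le> \<rho> t \<and> \<rho> t \<le> 1"
  shows "continuous_map UI UI \<rho>"
  using assms by (auto simp: continuous_map_UI_iff)

lemma cube_rev_in_cube_maps:
  assumes "f \<in> cube_maps n Z z" "0 < n"
  shows "cube_rev f \<in> cube_maps n Z z"
proof -
  \<comment> \<open>Taking the same reparametrisation twice gives a homotopy from
    \<open>cube_rev f\<close> to itself, and the ends of a homotopy are cube maps.\<close>
  have "cube_homotopic n Z z (cube_rev f) (cube_rev f)"
    by (rule cube_homotopic_reparam [OF assms, of "\<lambda>u. 1 - u" "\<lambda>u. 1 - u"])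
       (auto simp: cube_rev_def intro!: continuous_map_UI_UI continuous_intros)
  then show ?thesis
    by (rule cube_homotopic_imp_cube_maps)
qed

lemma cube_homotopic_assoc:
  assumes "f \<in> cube_maps n Z z" "g \<in> cube_maps n Z z" "h \<in> cube_maps n Z z" "0 < n"
  shows "cube_homotopic n Z z (cube_concat (cube_concat f g) h) (cube_concat f (cube_concat g h))"
proof (rule cube_homotopic_reparam [of "cube_concat f (cube_concat g h)"])
  \<comment> \<open>The piecewise linear map that sends the break points 0, 1/4, 1/2, 1 of the left
    bracketing to the break points 0, 1/2, 3/4, 1 of the right one. Its slopes 2, 1, 1/2 decrease,
    so it is the minimum of its three lines.\<close>
  let ?\<rho> = "\<lambda>u::real. min (2 * u) (min (u + 1/4) (u/2 + 1/2))"
  show "cube_concat f (cube_concat g h) \<in> cube_maps n Z z"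
    by (intro cube_concat_in_cube_maps assms)
  show "continuous_map UI UI ?\<rho>" "continuous_map UI UI (\<lambda>u. u)"
    by (auto intro!: continuous_map_UI_UI continuous_intros)
  show "cube_concat (cube_concat f g) h s = cube_concat f (cube_concat g h) (s(0 := ?\<rho> (s 0)))" for s
  proof -
    consider "s 0 \<le> 1/4" | "1/4 < s 0" "s 0 \<le> 1/2" | "1/2 < s 0"
      by linarith
    then show ?thesis
    proof cases
      case 1
      then have "?\<rho> (s 0) = 2 * s 0"
        by (auto simp: min_def)
      then show ?thesis
        using 1 by (simp add: cube_concat_def)
    next
      case 2
      then have "?\<rho> (s 0) = s 0 + 1/4"
        by (auto simp: min_def)
      then show ?thesis
        using 2 by (simp add: cube_concat_def algebra_simps)
    next
      case 3
      then have "?\<rho> (s 0) = s 0 / 2 + 1/2"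
        by (auto simp: min_def)
      then show ?thesis
        using 3 by (simp add: cube_concat_def algebra_simps)
    qed
  qed
qed (use assms in auto)

lemma cube_homotopic_left_unit:
  assumes f: "f \<in> cube_maps n Z z" and n: "0 < n"
  shows "cube_homotopic n Z z (cube_concat (\<lambda>s. z) f) f"
proof (rule cube_homotopic_reparam [OF f n, of "\<lambda>u. max 0 (2 * u - 1)" "\<lambda>u. u"])
  show "cube_concat (\<lambda>s. z) f s = f (s(0 := max 0 (2 * s 0 - 1)))" if s: "s \<in> topspace (cube n)" for s
  proof -
    have "s(0 := 0) \<in> cube_boundary n"
      using s n by (intro in_cube_boundaryI [of _ n 0] cube_upd) auto
    then have "f (s(0 := 0)) = z"
      using f by (simp add: cube_maps_def)
    then show ?thesis
      by (cases "s 0 \<le> 1/2") (simp_all add: cube_concat_def max_absorb1 max_absorb2)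
  qed
qed (auto intro!: continuous_map_UI_UI continuous_intros)

lemma cube_homotopic_rev:
  assumes f: "f \<in> cube_maps n Z z" and n: "0 < n"
  shows "cube_homotopic n Z z (cube_concat (cube_rev f) f) (\<lambda>s. z)"
\<comment> \<open>The product runs f from 1 down to 0 and back to 1. Both ends are 1, so the path
  contracts to the constant 1, and f has the value z on that face.\<close>
proof (rule cube_homotopic_reparam [OF f n, of "\<lambda>u. \<bar>1 - 2 * u\<bar>" "\<lambda>u. 1"])
  show "cube_concat (cube_rev f) f s = f (s(0 := \<bar>1 - 2 * s 0\<bar>))" if s: "s \<in> topspace (cube n)" for s
    by (auto simp: cube_concat_def cube_rev_def abs_if)
  show "z = f (s(0 := 1))" if s: "s \<in> topspace (cube n)" for s
  proof -
    have "s(0 := 1) \<in> cube_boundary n"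
      using s n by (intro in_cube_boundaryI [of _ n 0] cube_upd) auto
    then show ?thesis
      using f by (simp add: cube_maps_def)
  qed
qed (auto intro!: continuous_map_UI_UI continuous_intros)

section \<open>The group structure on classes\<close>

lemma carrier_homotopy_group:
  "carrier (homotopy_group n Z z) = homotopy_class n Z z ` cube_maps n Z z"
  by (simp add: homotopy_group_def)

lemma one_homotopy_group: "\<one>\<^bsub>homotopy_group n Z z\<^esub> = homotopy_class n Z z (\<lambda>s. z)"
  by (simp add: homotopy_group_def)

lemma mult_homotopy_group:
  assumes f: "f \<in> cube_maps n Z z" and g: "g \<in> cube_maps n Z z" and n: "0 < n"
  shows "homotopy_class n Z z f \<otimes>\<^bsub>homotopy_group n Z z\<^esub> homotopy_class n Z z g =
         homotopy_class n Z z (cube_concat f g)"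
proof -
  have "(\<exists>f'\<in>homotopy_class n Z z f. \<exists>g'\<in>homotopy_class n Z z g. cube_homotopic n Z z (cube_concat f' g') h)
        \<longleftrightarrow> cube_homotopic n Z z (cube_concat f g) h" for h
  proof
    assume "\<exists>f'\<in>homotopy_class n Z z f. \<exists>g'\<in>homotopy_class n Z z g. cube_homotopic n Z z (cube_concat f' g') h"
    then obtain f' g' where "cube_homotopic n Z z f f'" "cube_homotopic n Z z g g'"
      "cube_homotopic n Z z (cube_concat f' g') h"
      by (auto simp: homotopy_class_def)
    then show "cube_homotopic n Z z (cube_concat f g) h"
      by (metis cube_homotopic_concat n cube_homotopic_trans)
  qed (metis f g in_homotopy_class)
  then show ?thesis
    by (simp add: homotopy_group_def homotopy_class_def)
qed

lemma group_homotopy_group: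
  assumes z: "z \<in> topspace Z" and n: "0 < n"
  shows "group (homotopy_group n Z z)"
proof (rule groupI)
  show "x \<otimes>\<^bsub>homotopy_group n Z z\<^esub> y \<in> carrier (homotopy_group n Z z)"
    if "x \<in> carrier (homotopy_group n Z z)" "y \<in> carrier (homotopy_group n Z z)" for x y
    using that n by (auto simp: carrier_homotopy_group mult_homotopy_group cube_concat_in_cube_maps)
  show "\<one>\<^bsub>homotopy_group n Z z\<^esub> \<in> carrier (homotopy_group n Z z)"
    using z by (auto simp: carrier_homotopy_group one_homotopy_group const_in_cube_maps)
  show "x \<otimes>\<^bsub>homotopy_group n Z z\<^esub> y \<otimes>\<^bsub>homotopy_group n Z z\<^esub> w =
        x \<otimes>\<^bsub>homotopy_group n Z z\<^esub> (y \<otimes>\<^bsub>homotopy_group n Z z\<^esub> w)"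
    if "x \<in> carrier (homotopy_group n Z z)" "y \<in> carrier (homotopy_group n Z z)"
      "w \<in> carrier (homotopy_group n Z z)" for x y w
  proof -
    obtain f g h where "f \<in> cube_maps n Z z" "x = homotopy_class n Z z f"
      "g \<in> cube_maps n Z z" "y = homotopy_class n Z z g" "h \<in> cube_maps n Z z" "w = homotopy_class n Z z h"
      using \<open>x \<in> _\<close> \<open>y \<in> _\<close> \<open>w \<in> _\<close> unfolding carrier_homotopy_group by blast
    then show ?thesis
      using n homotopy_class_eq [OF cube_homotopic_assoc [of f n Z z g h]]
      by (simp add: mult_homotopy_group cube_concat_in_cube_maps)
  qed
  show "\<one>\<^bsub>homotopy_group n Z z\<^esub> \<otimes>\<^bsub>homotopy_group n Z z\<^esub> x = x"
    if x: "x \<in> carrier (homotopy_group n Z z)" for x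
  proof -
    obtain f where "f \<in> cube_maps n Z z" "x = homotopy_class n Z z f"
      using x unfolding carrier_homotopy_group by blast
    then show ?thesis
      using n z homotopy_class_eq [OF cube_homotopic_left_unit [of f n Z z]]
      by (simp add: one_homotopy_group mult_homotopy_group const_in_cube_maps)
  qed
  show "\<exists>y\<in>carrier (homotopy_group n Z z). y \<otimes>\<^bsub>homotopy_group n Z z\<^esub> x = \<one>\<^bsub>homotopy_group n Z z\<^esub>"
    if x: "x \<in> carrier (homotopy_group n Z z)" for x
  proof -
    obtain f where f: "f \<in> cube_maps n Z z" "x = homotopy_class n Z z f"
      using x by (auto simp: carrier_homotopy_group)
    have "homotopy_class n Z z (cube_rev f) \<otimes>\<^bsub>homotopy_group n Z z\<^esub> x = \<one>\<^bsub>homotopy_group n Z z\<^esub>"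
      using f n homotopy_class_eq [OF cube_homotopic_rev [OF f(1) n]]
      by (simp add: one_homotopy_group mult_homotopy_group cube_rev_in_cube_maps)
    then show ?thesis
      using cube_rev_in_cube_maps [OF f(1) n] by (auto simp: carrier_homotopy_group)
  qed
qed

lemma inv_homotopy_group:
  assumes f: "f \<in> cube_maps n Z z" and n: "0 < n" and z: "z \<in> topspace Z"
  shows "inv\<^bsub>homotopy_group n Z z\<^esub> (homotopy_class n Z z f) = homotopy_class n Z z (cube_rev f)"
proof -
  interpret group "homotopy_group n Z z"
    by (rule group_homotopy_group [OF z n])
  have "homotopy_class n Z z (cube_rev f) \<otimes>\<^bsub>homotopy_group n Z z\<^esub> homotopy_class n Z z f
        = \<one>\<^bsub>homotopy_group n Z z\<^esub>"
    using f n homotopy_class_eq [OF cube_homotopic_rev [OF f n]]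
    by (simp add: one_homotopy_group mult_homotopy_group cube_rev_in_cube_maps)
  then show ?thesis
    using f n by (intro inv_equality) (auto simp: carrier_homotopy_group cube_rev_in_cube_maps)
qed

section \<open>Induced homomorphisms\<close>

lemma comp_in_cube_maps:
  "f \<in> cube_maps n Z z \<Longrightarrow> continuous_map Z W \<phi> \<Longrightarrow> \<phi> z = w \<Longrightarrow> \<phi> \<circ> f \<in> cube_maps n W w"
  by (auto simp: cube_maps_def intro: continuous_map_compose)

lemma cube_homotopic_comp:
  assumes "cube_homotopic n Z z f g" "continuous_map Z W \<phi>" "\<phi> z = w"
  shows "cube_homotopic n W w (\<phi> \<circ> f) (\<phi> \<circ> g)"
proof -
  obtain h where h: "continuous_map (prod_topology UI (cube n)) Z h"
    "\<And>s. s \<in> topspace (cube n) \<Longrightarrow> h (0, s) = f s" "\<And>s. s \<in> topspace (cube n) \<Longrightarrow> h (1, s) = g s"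
    "\<And>t s. t \<in> {0..1} \<Longrightarrow> s \<in> cube_boundary n \<Longrightarrow> h (t, s) = z"
    using assms(1) unfolding cube_homotopic_iff by blast
  show ?thesis
    by (rule cube_homotopicI [OF continuous_map_compose [OF h(1) assms(2)]]) (use h assms(3) in auto)
qed

lemma homotopy_induced_class:
  assumes "f \<in> cube_maps n Z z" "continuous_map Z W \<phi>" "\<phi> z = w"
  shows "homotopy_induced n W w \<phi> (homotopy_class n Z z f) = homotopy_class n W w (\<phi> \<circ> f)"
proof -
  have "(\<exists>f'\<in>homotopy_class n Z z f. cube_homotopic n W w (\<phi> \<circ> f') g) \<longleftrightarrow>
        cube_homotopic n W w (\<phi> \<circ> f) g" for g
    using cube_homotopic_comp [OF _ assms(2,3)] cube_homotopic_refl [OF assms(1)]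
    unfolding homotopy_class_def mem_Collect_eq Bex_def by (metis cube_homotopic_trans)
  then show ?thesis
    by (simp add: homotopy_induced_def homotopy_class_def)
qed

lemma homotopy_induced_hom:
  assumes \<phi>: "continuous_map Z W \<phi>" "\<phi> z = w" and n: "0 < n"
  shows "homotopy_induced n W w \<phi> \<in> hom (homotopy_group n Z z) (homotopy_group n W w)"
proof (rule homI)
  have *: "\<phi> \<circ> cube_concat f g = cube_concat (\<phi> \<circ> f) (\<phi> \<circ> g)" for f g :: "(nat \<Rightarrow> real) \<Rightarrow> 'a"
    by (auto simp: cube_concat_def)
  show "homotopy_induced n W w \<phi> A \<in> carrier (homotopy_group n W w)"
    if "A \<in> carrier (homotopy_group n Z z)" for A
    using that by (auto simp: carrier_homotopy_group homotopy_induced_class [OF _ \<phi>]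
        intro!: imageI comp_in_cube_maps \<phi>)
  show "homotopy_induced n W w \<phi> (A \<otimes>\<^bsub>homotopy_group n Z z\<^esub> B) =
        homotopy_induced n W w \<phi> A \<otimes>\<^bsub>homotopy_group n W w\<^esub> homotopy_induced n W w \<phi> B"
    if "A \<in> carrier (homotopy_group n Z z)" "B \<in> carrier (homotopy_group n Z z)" for A B
    using that n
    by (auto simp: carrier_homotopy_group mult_homotopy_group cube_concat_in_cube_maps
        homotopy_induced_class [OF _ \<phi>] comp_in_cube_maps [OF _ \<phi>] *)
qed

section \<open>The compact-open topology\<close>

lemma openin_mapping_space:
  assumes "compactin X K" "openin Y U"
  shows "openin (mapping_space X Y) ({f. f ` K \<subseteq> U} \<inter> topspace (mapping_space X Y))"
proof -
  have "openin (topology_generated_by {{f. f ` K \<subseteq> U} |K U. compactin X K \<and> openin Y U}) {f. f ` K \<subseteq> U}"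
    by (rule topology_generated_by_Basis) (use assms in blast)
  then show ?thesis
    unfolding topspace_mapping_space unfolding mapping_space_def by (rule openin_subtopology_Int)
qed

text \<open>The half of the exponential law that holds for every X: if the map at t sends a compact
  K into U, the tube lemma thickens t to a neighbourhood on which this persists.\<close>

lemma continuous_map_into_mapping_space:
  assumes g: "continuous_map (prod_topology T X) Y (\<lambda>p. g (fst p) (snd p))"
  shows "continuous_map T (mapping_space X Y) (\<lambda>t. \<lambda>x\<in>topspace X. g t x)"
  unfolding mapping_space_def continuous_map_in_subtopology
proof (intro conjI)
  let ?B = "{{f. f ` K \<subseteq> U} |K U. compactin X K \<and> openin Y U}"
  show "continuous_map T (topology_generated_by ?B) (\<lambda>t. \<lambda>x\<in>topspace X. g t x)"
  proof (rule continuous_on_generated_topo)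
    fix B assume "B \<in> ?B"
    then obtain K U where B: "B = {f. f ` K \<subseteq> U}" and K: "compactin X K" and U: "openin Y U"
      by blast
    have KX: "K \<subseteq> topspace X"
      using K by (simp add: compactin_subset_topspace)
    define W where "W = {p \<in> topspace (prod_topology T X). g (fst p) (snd p) \<in> U}"
    have W: "openin (prod_topology T X) W"
      unfolding W_def using g U by (rule openin_continuous_map_preimage)
    show "openin T ((\<lambda>t. \<lambda>x\<in>topspace X. g t x) -` B \<inter> topspace T)" (is "openin T ?V")
    proof (subst openin_subopen, intro ballI)
      fix t assume t: "t \<in> ?V"
      then have tK: "{t} \<times> K \<subseteq> W"
        using KX by (auto simp: B W_def image_subset_iff subset_iff)
      have "t \<in> topspace T"
        using t by blast
      from tube_lemma_right [OF W K this tK]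
      obtain V V' where V: "openin T V" "t \<in> V" "K \<subseteq> V'" "V \<times> V' \<subseteq> W"
        by blast
      have "V \<subseteq> ?V"
      proof
        fix u assume u: "u \<in> V"
        have "g u x \<in> U" if "x \<in> K" for x
          using V(3,4) u that by (auto simp: W_def subset_iff)
        then show "u \<in> ?V"
          using KX u openin_subset [OF V(1)] by (auto simp: B subset_iff)
      qed
      with V show "\<exists>S. openin T S \<and> t \<in> S \<and> S \<subseteq> ?V"
        by blast
    qed
  next
    have "UNIV \<in> ?B"
      by (rule CollectI, rule exI [of _ "{}"], rule exI [of _ "{}"]) auto
    then show "(\<lambda>t. \<lambda>x\<in>topspace X. g t x) ` topspace T \<subseteq> \<Union> ?B"
      by blast
  qed
  show "(\<lambda>t. \<lambda>x\<in>topspace X. g t x) \<in> topspace T \<rightarrow> {f \<in> extensional (topspace X). continuous_map X Y f}"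
  proof (intro funcsetI CollectI conjI)
    fix t assume t: "t \<in> topspace T"
    have "continuous_map X (prod_topology T X) (\<lambda>x. (t, x))"
      using t by (simp add: continuous_map_pairwise o_def)
    from continuous_map_compose [OF this g] have "continuous_map X Y (\<lambda>x. g t x)"
      by (simp add: o_def)
    then show "continuous_map X Y (\<lambda>x\<in>topspace X. g t x)"
      by (rule continuous_map_eq) simp
  qed auto
qed

text \<open>The other half of the exponential law, pulled back along \<sigma>. Local compactness is
  asked of the source X of \<sigma> and not of Q: a compact neighbourhood in X has a compact image
  in Q, and that image defines the subbasic open set. This allows Q to be the null component, with
  \<sigma> the inclusion of the constant maps.\<close>

lemma continuous_map_mapping_space_apply:
  assumes \<phi>: "continuous_map T (mapping_space Q R) \<phi>" and \<sigma>: "continuous_map X Q \<sigma>"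
    and X: "locally_compact_space X" "Hausdorff_space X"
  shows "continuous_map (prod_topology T X) R (\<lambda>p. \<phi> (fst p) (\<sigma> (snd p)))"
proof -
  have \<phi>t: "continuous_map Q R (\<phi> t)" if "t \<in> topspace T" for t
    using continuous_map_funspace [OF \<phi>] that by (auto simp: topspace_mapping_space Pi_iff)
  have nb: "neighbourhood_base_of (compactin X) X"
    using X locally_compact_space_neighbourhood_base by blast
  show ?thesis
    unfolding continuous_map_def
  proof (intro conjI funcsetI allI impI)
    show "\<phi> (fst p) (\<sigma> (snd p)) \<in> topspace R" if "p \<in> topspace (prod_topology T X)" for p
      using that continuous_map_funspace [OF \<phi>t] continuous_map_funspace [OF \<sigma>]
      by (auto simp: Pi_iff)
    fix U assume U: "openin R U"
    show "openin (prod_topology T X) {p \<in> topspace (prod_topology T X). \<phi> (fst p) (\<sigma> (snd p)) \<in> U}"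
      (is "openin _ ?W")
    proof (subst openin_subopen, intro ballI)
      fix p assume p: "p \<in> ?W"
      obtain t x where tx: "p = (t, x)" "t \<in> topspace T" "x \<in> topspace X" "\<phi> t (\<sigma> x) \<in> U"
        using p by auto
      have "openin X {x \<in> topspace X. (\<phi> t \<circ> \<sigma>) x \<in> U}"
        using continuous_map_compose [OF \<sigma> \<phi>t [OF tx(2)]] U by (rule openin_continuous_map_preimage)
      then obtain V K where V: "openin X V" "compactin X K" "x \<in> V" "V \<subseteq> K" "\<And>y. y \<in> K \<Longrightarrow> \<phi> t (\<sigma> y) \<in> U"
        using nb [unfolded neighbourhood_base_of, rule_format, of "{x \<in> topspace X. (\<phi> t \<circ> \<sigma>) x \<in> U}" x] tx
        by (auto simp: subset_iff)
      have "compactin Q (\<sigma> ` K)"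
        using V(2) \<sigma> by (rule image_compactin)
      from openin_mapping_space [OF this U]
      have "openin T {t \<in> topspace T. \<phi> t \<in> {f. f ` \<sigma> ` K \<subseteq> U} \<inter> topspace (mapping_space Q R)}"
        by (rule openin_continuous_map_preimage [OF \<phi>])
      then have 1: "openin (prod_topology T X)
          ({t \<in> topspace T. \<phi> t \<in> {f. f ` \<sigma> ` K \<subseteq> U} \<inter> topspace (mapping_space Q R)} \<times> V)" (is "openin _ ?N")
        using V(1) by (simp add: openin_prod_Times_iff)
      have 2: "p \<in> ?N"
        using tx V continuous_map_funspace [OF \<phi>] by auto
      have 3: "?N \<subseteq> ?W"
        using V(4) openin_subset [OF V(1)] by (auto simp: image_subset_iff subset_iff)
      show "\<exists>S. openin (prod_topology T X) S \<and> p \<in> S \<and> S \<subseteq> ?W"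
        using 1 2 3 by blast
    qed
  qed
qed

section \<open>Path components of mapping spaces\<close>

lemma continuous_map_path_component_spaceI:
  assumes \<phi>: "continuous_map T S \<phi>" and T: "path_connected_space T"
    and t: "t \<in> topspace T" "path_component_of S x (\<phi> t)"
  shows "continuous_map T (path_component_space S x) \<phi>"
proof -
  have "path_connectedin S (\<phi> ` topspace T)"
    using path_connectedin_continuous_map_image [OF \<phi>] T by (simp add: path_connectedin_topspace)
  then have "path_component_of S (\<phi> t) (\<phi> u)" if "u \<in> topspace T" for u
    using path_component_of_maximal [of S "\<phi> ` topspace T" "\<phi> t"] t that by auto
  then have "path_component_of S x (\<phi> u)" if "u \<in> topspace T" for u
    using t that by (blast intro: path_component_of_trans)
  then show ?thesis
    unfolding path_component_space_def continuous_map_in_subtopology using \<phi> by auto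
qed

lemma continuous_map_path_component_spaceD:
  "continuous_map T (path_component_space S x) \<phi> \<Longrightarrow> continuous_map T S \<phi>"
  by (simp add: path_component_space_def continuous_map_in_subtopology)

lemma topspace_path_component_space:
  "topspace (path_component_space S x) = path_component_of_set S x"
  using path_component_of_subset_topspace [of S x]
  by (auto simp: path_component_space_def)

lemma path_connected_space_path_component_space: "path_connected_space (path_component_space S x)"
  using path_connectedin_path_component_of [of S x]
  by (simp add: path_component_space_def path_connectedin_def)

lemma continuous_map_from_path_component_space:
  "continuous_map S Z \<phi> \<Longrightarrow> continuous_map (path_component_space S x) Z \<phi>"
  by (simp add: path_component_space_def continuous_map_from_subtopology)

lemma continuous_map_eval_mapping_space:
  assumes "x \<in> topspace X"
  shows "continuous_map (mapping_space X Y) Y (\<lambda>f. f x)"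
  unfolding continuous_map_def
proof (intro conjI funcsetI allI impI)
  show "f x \<in> topspace Y" if "f \<in> topspace (mapping_space X Y)" for f
    using that assms by (auto simp: topspace_mapping_space dest: continuous_map_funspace)
  fix U assume "openin Y U"
  then have "openin (mapping_space X Y) ({f. f ` {x} \<subseteq> U} \<inter> topspace (mapping_space X Y))"
    using assms by (intro openin_mapping_space) auto
  moreover have "{f. f ` {x} \<subseteq> U} \<inter> topspace (mapping_space X Y) = {f \<in> topspace (mapping_space X Y). f x \<in> U}"
    by auto
  ultimately show "openin (mapping_space X Y) {f \<in> topspace (mapping_space X Y). f x \<in> U}"
    by simp
qed

lemma const_map_in_null_component:
  "y \<in> topspace Y \<Longrightarrow> const_map X y \<in> topspace (null_component X Y y)"
  by (auto simp: null_component_def topspace_path_component_space path_component_of_refl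
      topspace_mapping_space const_map_def intro: continuous_map_eq [of X Y "\<lambda>x. y"])

lemma id_map_in_aut1: "id_map Z \<in> topspace (aut1 Z)"
  by (auto simp: aut1_def topspace_path_component_space path_component_of_refl
      topspace_mapping_space id_map_def intro: continuous_map_eq [of Z Z "\<lambda>x. x"])

lemma in_null_componentD:
  assumes "f \<in> topspace (null_component X Y y)"
  shows "continuous_map X Y f" "f \<in> extensional (topspace X)"
  using assms path_component_of_subset_topspace [of "mapping_space X Y" "const_map X y"]
  by (auto simp: null_component_def topspace_path_component_space topspace_mapping_space)

text \<open>Over a path connected parameter space a single parameter with the constant map puts the
  whole family into the null component. In the applications it is taken on the boundary of a
  cube.\<close>

lemma continuous_map_into_null_component:
  assumes g: "continuous_map (prod_topology T X) Y (\<lambda>p. g (fst p) (snd p))"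
    and T: "path_connected_space T" "t \<in> topspace T" "\<And>x. x \<in> topspace X \<Longrightarrow> g t x = y0"
    and "y0 \<in> topspace Y"
  shows "continuous_map T (null_component X Y y0) (\<lambda>t. \<lambda>x\<in>topspace X. g t x)"
proof -
  have "(\<lambda>x\<in>topspace X. g t x) = const_map X y0"
    using T(3) by (auto simp: const_map_def)
  then show ?thesis
    using const_map_in_null_component [OF assms(5), of X] unfolding null_component_def topspace_path_component_space
    by (intro continuous_map_path_component_spaceI [OF continuous_map_into_mapping_space [OF g] T(1,2)]) simp
qed

lemma continuous_map_null_component_apply:
  assumes "continuous_map T (null_component X Y y0) \<phi>" "locally_compact_space X" "Hausdorff_space X"
  shows "continuous_map (prod_topology T X) Y (\<lambda>p. \<phi> (fst p) (snd p))"
  using continuous_map_mapping_space_apply [of T X Y \<phi> X "\<lambda>x. x"] assms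
  by (simp add: null_component_def continuous_map_path_component_spaceD)

lemma continuous_map_const_map:
  assumes "path_connected_space Y" "y0 \<in> topspace Y"
  shows "continuous_map Y (null_component X Y y0) (const_map X)"
  unfolding const_map_def
  by (rule continuous_map_into_null_component) (use assms in \<open>auto intro: continuous_map_fst\<close>)


section \<open>Gottlieb groups\<close>

lemma carrier_gottlieb_group:
  "carrier (gottlieb_group n Z z) =
   homotopy_induced n Z z (\<lambda>f. f z) ` homotopy_class n (aut1 Z) (id_map Z) ` cube_maps n (aut1 Z) (id_map Z)"
  by (simp add: gottlieb_group_def carrier_homotopy_group)

lemma mult_gottlieb_group [simp]: "(\<otimes>\<^bsub>gottlieb_group n Z z\<^esub>) = (\<otimes>\<^bsub>homotopy_group n Z z\<^esub>)"
  by (simp add: gottlieb_group_def)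

lemma continuous_map_eval_aut1:
  "z \<in> topspace Z \<Longrightarrow> continuous_map (aut1 Z) Z (\<lambda>f. f z)"
  by (simp add: aut1_def continuous_map_from_path_component_space continuous_map_eval_mapping_space)

lemma eval_id_map: "z \<in> topspace Z \<Longrightarrow> id_map Z z = z"
  by (simp add: id_map_def)

lemma homotopy_induced_eval_aut1:
  assumes "a \<in> cube_maps n (aut1 Z) (id_map Z)" "z \<in> topspace Z"
  shows "homotopy_induced n Z z (\<lambda>f. f z) (homotopy_class n (aut1 Z) (id_map Z) a) =
         homotopy_class n Z z (\<lambda>s. a s z)"
  using homotopy_induced_class [of a n "aut1 Z" "id_map Z" Z "\<lambda>f. f z" z] assms
  by (simp add: continuous_map_eval_aut1 eval_id_map o_def)

lemma subgroup_gottlieb_group: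
  assumes z: "z \<in> topspace Z" and n: "0 < n"
  shows "subgroup (carrier (gottlieb_group n Z z)) (homotopy_group n Z z)"
proof -
  interpret group_hom "homotopy_group n (aut1 Z) (id_map Z)" "homotopy_group n Z z" "homotopy_induced n Z z (\<lambda>f. f z)"
    using z n
    by (intro group_hom.intro group_hom_axioms.intro group_homotopy_group id_map_in_aut1
        homotopy_induced_hom continuous_map_eval_aut1 eval_id_map)
  show ?thesis
    using img_is_subgroup by (simp add: gottlieb_group_def)
qed

lemma group_gottlieb_group:
  assumes "z \<in> topspace Z" "0 < n"
  shows "group (gottlieb_group n Z z)"
proof -
  have "gottlieb_group n Z z = (homotopy_group n Z z)\<lparr>carrier := carrier (gottlieb_group n Z z)\<rparr>"
    by (simp add: gottlieb_group_def)
  then show ?thesis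
    using group.subgroup_imp_group [OF group_homotopy_group subgroup_gottlieb_group] assms by metis
qed

text \<open>The adjoint of a cube map into \<open>aut1 Y\<close> based at the identity. Modulo the
  boundary it is the classical affiliated map: an extension over the product of the n-sphere with Y
  of a map that is the identity on Y.\<close>

definition gottlieb_ext :: "nat \<Rightarrow> 'b topology \<Rightarrow> ((nat \<Rightarrow> real) \<times> 'b \<Rightarrow> 'b) \<Rightarrow> bool" where
  "gottlieb_ext n Y \<Phi> \<longleftrightarrow> continuous_map (prod_topology (cube n) Y) Y \<Phi> \<and>
     (\<forall>s\<in>cube_boundary n. \<forall>y\<in>topspace Y. \<Phi> (s, y) = y)"

lemma gottlieb_ext_in_cube_maps:
  assumes "gottlieb_ext n Y \<Phi>" "y0 \<in> topspace Y"
  shows "(\<lambda>s. \<Phi> (s, y0)) \<in> cube_maps n Y y0"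
proof -
  have "continuous_map (cube n) (prod_topology (cube n) Y) (\<lambda>s. (s, y0))"
    using assms(2) by (simp add: continuous_map_pairwise o_def)
  then have "continuous_map (cube n) Y (\<lambda>s. \<Phi> (s, y0))"
    using continuous_map_compose [of "cube n" _ _ Y \<Phi>] assms(1) by (force simp: o_def gottlieb_ext_def)
  then show ?thesis
    using assms by (simp add: cube_maps_def gottlieb_ext_def)
qed

text \<open>Local compactness of Y turns a cube map into \<open>aut1 Y\<close> into a map on the
  product. Conversely the cube is path connected and its boundary goes to the identity, so an
  adjoint of \<Phi> stays in the component of the identity.\<close>

lemma carrier_gottlieb_group_ext:
  assumes Y: "locally_compact_space Y" "Hausdorff_space Y" and y0: "y0 \<in> topspace Y" and n: "0 < n"
  shows "carrier (gottlieb_group n Y y0) =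
         {homotopy_class n Y y0 (\<lambda>s. \<Phi> (s, y0)) |\<Phi>. gottlieb_ext n Y \<Phi>}" (is "_ = ?R")
proof (intro equalityI subsetI)
  fix A assume "A \<in> carrier (gottlieb_group n Y y0)"
  then obtain a where a: "a \<in> cube_maps n (aut1 Y) (id_map Y)"
    and A: "A = homotopy_induced n Y y0 (\<lambda>f. f y0) (homotopy_class n (aut1 Y) (id_map Y) a)"
    by (auto simp: carrier_gottlieb_group)
  have A': "A = homotopy_class n Y y0 (\<lambda>s. a s y0)"
    unfolding A by (rule homotopy_induced_eval_aut1 [OF a y0])
  have "continuous_map (cube n) (mapping_space Y Y) a"
    using a by (auto simp: cube_maps_def aut1_def dest: continuous_map_path_component_spaceD)
  from continuous_map_mapping_space_apply [OF this continuous_map_id Y]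
  have "gottlieb_ext n Y (\<lambda>p. a (fst p) (snd p))"
    using a by (simp add: gottlieb_ext_def cube_maps_def id_map_def)
  then show "A \<in> ?R"
    unfolding A' by (intro CollectI exI [of _ "\<lambda>p. a (fst p) (snd p)"]) simp
next
  fix A assume "A \<in> ?R"
  then obtain \<Phi> where A: "A = homotopy_class n Y y0 (\<lambda>s. \<Phi> (s, y0))" and \<Phi>: "gottlieb_ext n Y \<Phi>"
    by blast
  define a where "a = (\<lambda>s. \<lambda>y\<in>topspace Y. \<Phi> (s, y))"
  have 1: "continuous_map (cube n) (mapping_space Y Y) a"
    unfolding a_def by (rule continuous_map_into_mapping_space) (use \<Phi> in \<open>simp add: gottlieb_ext_def\<close>)
  have bd: "a s = id_map Y" if "s \<in> cube_boundary n" for s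
    using \<Phi> that by (auto simp: gottlieb_ext_def a_def id_map_def)
  have "continuous_map (cube n) (aut1 Y) a"
    unfolding aut1_def
    by (rule continuous_map_path_component_spaceI [OF 1 path_connected_space_cube])
       (use cube_boundary_nonempty [OF n] cube_boundary_subset bd id_map_in_aut1 [of Y]
        in \<open>auto simp: aut1_def topspace_path_component_space\<close>)
  then have a: "a \<in> cube_maps n (aut1 Y) (id_map Y)"
    using bd by (simp add: cube_maps_def)
  have "(\<lambda>s. a s y0) = (\<lambda>s. \<Phi> (s, y0))"
    using y0 by (auto simp: a_def)
  then have "A = homotopy_induced n Y y0 (\<lambda>f. f y0) (homotopy_class n (aut1 Y) (id_map Y) a)"
    using A homotopy_induced_eval_aut1 [OF a y0] by simp
  then show "A \<in> carrier (gottlieb_group n Y y0)"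
    using a by (auto simp: carrier_gottlieb_group)
qed

text \<open>A family of affiliated maps indexed by X. The pair \<open>(s, y)\<close> is bracketed
  first because it is the parameter that is carried along when such maps are glued over the cells of
  X.\<close>

definition gottlieb_family ::
  "nat \<Rightarrow> 'a topology \<Rightarrow> 'b topology \<Rightarrow> (((nat \<Rightarrow> real) \<times> 'b) \<times> 'a \<Rightarrow> 'b) \<Rightarrow> bool" where
  "gottlieb_family n X Y \<Psi> \<longleftrightarrow>
     continuous_map (prod_topology (prod_topology (cube n) Y) X) Y \<Psi> \<and>
     (\<forall>s\<in>cube_boundary n. \<forall>y\<in>topspace Y. \<forall>x\<in>topspace X. \<Psi> ((s, y), x) = y)"

lemma gottlieb_family_in_cube_maps:
  assumes \<Psi>: "gottlieb_family n X Y \<Psi>" and y0: "y0 \<in> topspace Y" and n: "0 < n"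
  shows "(\<lambda>s. \<lambda>x\<in>topspace X. \<Psi> ((s, y0), x)) \<in> cube_maps n (null_component X Y y0) (const_map X y0)"
proof -
  have "continuous_map (prod_topology (cube n) X) (prod_topology (prod_topology (cube n) Y) X) (\<lambda>p. ((fst p, y0), snd p))"
    using y0 by (auto simp: continuous_map_pairwise o_def intro: continuous_map_fst continuous_map_snd)
  then have "continuous_map (prod_topology (cube n) X) Y (\<lambda>p. \<Psi> ((fst p, y0), snd p))"
    using continuous_map_compose [of _ _ _ Y \<Psi>] \<Psi> by (force simp: o_def gottlieb_family_def)
  then have "continuous_map (cube n) (null_component X Y y0) (\<lambda>s. \<lambda>x\<in>topspace X. \<Psi> ((s, y0), x))"
    by (rule continuous_map_into_null_component [where t = "\<lambda>j\<in>{..<n}. 0"])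
       (use \<Psi> y0 cube_boundary_nonempty [OF n] cube_boundary_subset [of n] path_connected_space_cube
        in \<open>auto simp: gottlieb_family_def simp del: restrict_apply\<close>)
  then show ?thesis
    using \<Psi> y0 by (auto simp: cube_maps_def gottlieb_family_def const_map_def)
qed

text \<open>
  The null component need not be locally compact, so a map from the cube into its self-maps has no
  adjoint. Precomposition with the constant maps $Y \to \mathrm{map}(X, Y; 0)$ gives one on $Y$.
\<close>

lemma carrier_gottlieb_group_null_component:
  assumes X: "locally_compact_space X" "Hausdorff_space X"
    and Y: "locally_compact_space Y" "Hausdorff_space Y" "path_connected_space Y"
    and y0: "y0 \<in> topspace Y" and n: "0 < n"
  shows "carrier (gottlieb_group n (null_component X Y y0) (const_map X y0)) =
         {homotopy_class n (null_component X Y y0) (const_map X y0) (\<lambda>s. \<lambda>x\<in>topspace X. \<Psi> ((s, y0), x)) |\<Psi>.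
            gottlieb_family n X Y \<Psi>}" (is "carrier (gottlieb_group n ?M ?c) = ?R")
proof (intro equalityI subsetI)
  have c: "?c \<in> topspace ?M"
    using y0 by (rule const_map_in_null_component)
  show "A \<in> ?R" if "A \<in> carrier (gottlieb_group n ?M ?c)" for A
  proof -
    from that obtain a where a: "a \<in> cube_maps n (aut1 ?M) (id_map ?M)"
      and A: "A = homotopy_induced n ?M ?c (\<lambda>f. f ?c) (homotopy_class n (aut1 ?M) (id_map ?M) a)"
      by (auto simp: carrier_gottlieb_group)
    have A': "A = homotopy_class n ?M ?c (\<lambda>s. a s ?c)"
      unfolding A by (rule homotopy_induced_eval_aut1 [OF a c])
    let ?\<Psi> = "\<lambda>p. a (fst (fst p)) (const_map X (snd (fst p))) (snd p)"
    have am: "continuous_map (cube n) (mapping_space ?M ?M) a"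
      using a by (auto simp: cube_maps_def aut1_def dest: continuous_map_path_component_spaceD)
    from continuous_map_mapping_space_apply [OF this continuous_map_const_map [OF Y(3) y0] Y(1,2)]
    have 1: "continuous_map (prod_topology (cube n) Y) ?M (\<lambda>q. a (fst q) (const_map X (snd q)))" .
    have cy: "const_map X y \<in> topspace ?M" if "y \<in> topspace Y" for y
      using continuous_map_funspace [OF continuous_map_const_map [OF Y(3) y0]] that by auto
    have \<Psi>: "gottlieb_family n X Y ?\<Psi>"
      using continuous_map_null_component_apply [OF 1 X] a cy
      by (simp add: gottlieb_family_def cube_maps_def id_map_def) (simp add: const_map_def)
    \<comment> \<open>Outside the cube \<open>a s\<close> is arbitrary, so the two representatives
      agree only on the cube. There \<open>a s ?c\<close> is a point of the null component, hence
      extensional, and restricting it changes nothing.\<close>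
    have "cube_homotopic n ?M ?c (\<lambda>s. \<lambda>x\<in>topspace X. ?\<Psi> ((s, y0), x)) (\<lambda>s. a s ?c)"
    proof (rule cube_homotopic_eq [OF gottlieb_family_in_cube_maps [OF \<Psi> y0 n]])
      fix s assume "s \<in> topspace (cube n)"
      then have "a s \<in> topspace (mapping_space ?M ?M)"
        using continuous_map_funspace [OF am] by auto
      then have "a s ?c \<in> topspace ?M"
        using c by (auto simp: topspace_mapping_space dest: continuous_map_funspace)
      then show "(\<lambda>x\<in>topspace X. ?\<Psi> ((s, y0), x)) = a s ?c"
        by (simp add: in_null_componentD(2) extensional_restrict)
    qed
    then have "A = homotopy_class n ?M ?c (\<lambda>s. \<lambda>x\<in>topspace X. ?\<Psi> ((s, y0), x))"
      unfolding A' by (rule homotopy_class_eq [symmetric])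
    then show ?thesis
      using \<Psi> by (intro CollectI exI [of _ ?\<Psi>]) simp
  qed
  show "A \<in> carrier (gottlieb_group n ?M ?c)" if "A \<in> ?R" for A
  proof -
    from that obtain \<Psi> where A: "A = homotopy_class n ?M ?c (\<lambda>s. \<lambda>x\<in>topspace X. \<Psi> ((s, y0), x))"
      and \<Psi>: "gottlieb_family n X Y \<Psi>"
      by blast
    let ?g = "\<lambda>q x. \<Psi> ((fst q, snd q x), x)"
    let ?T = "prod_topology (cube n) ?M"
    have \<Psi>c: "continuous_map (prod_topology (prod_topology (cube n) Y) X) Y \<Psi>"
      using \<Psi> by (simp add: gottlieb_family_def)
    have "continuous_map (prod_topology ?T X) Y (\<lambda>p. snd (fst p) (snd p))"
      by (rule continuous_map_null_component_apply [OF continuous_map_snd X])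
    then have "continuous_map (prod_topology ?T X) (prod_topology (prod_topology (cube n) Y) X)
        (\<lambda>p. ((fst (fst p), snd (fst p) (snd p)), snd p))"
      by (intro continuous_map_pairedI continuous_map_snd
          continuous_map_compose [OF continuous_map_fst continuous_map_fst, unfolded o_def])
    from continuous_map_compose [OF this \<Psi>c]
    have g: "continuous_map (prod_topology ?T X) Y (\<lambda>p. ?g (fst p) (snd p))"
      by (simp add: o_def)
    \<comment> \<open>Over the corner \<open>?s0\<close> of the cube \<Psi> is the projection to Y,
      so this parameter fixes \<open>?c\<close>. That anchors the action in the null component, and
      later its adjoint in the component of the identity.\<close>
    let ?s0 = "\<lambda>j\<in>{..<n}. 0::real"
    have s0: "?s0 \<in> cube_boundary n" "?s0 \<in> topspace (cube n)"
      using cube_boundary_nonempty [OF n] cube_boundary_subset by auto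
    have cx: "?c x = y0" if "x \<in> topspace X" for x
      using that by (simp add: const_map_def)
    have "path_connected_space ?T"
      by (auto simp: path_connected_space_prod_topology path_connected_space_cube
          null_component_def path_connected_space_path_component_space)
    then have "continuous_map ?T ?M (\<lambda>q. \<lambda>x\<in>topspace X. ?g q x)"
      using \<Psi> y0 s0 c cx
      by (intro continuous_map_into_null_component [OF g, of "(?s0, ?c)"])
         (auto simp: gottlieb_family_def simp del: restrict_apply)
    then have g': "continuous_map ?T ?M (\<lambda>q. \<lambda>x\<in>topspace X. ?g (fst q, snd q) x)"
      by simp
    define a where "a = (\<lambda>s. \<lambda>f\<in>topspace ?M. \<lambda>x\<in>topspace X. ?g (s, f) x)"
    have 1: "continuous_map (cube n) (mapping_space ?M ?M) a"
      unfolding a_def by (rule continuous_map_into_mapping_space [OF g'])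
    have bd: "a s = id_map ?M" if s: "s \<in> cube_boundary n" for s
    proof -
      have "(\<lambda>x\<in>topspace X. \<Psi> ((s, f x), x)) = f" if f: "f \<in> topspace ?M" for f
      proof
        fix x
        have "f x \<in> topspace Y" if "x \<in> topspace X"
          using that in_null_componentD(1) [OF f] by (auto dest: continuous_map_funspace)
        then show "(\<lambda>x\<in>topspace X. \<Psi> ((s, f x), x)) x = f x"
          using \<Psi> s in_null_componentD(2) [OF f] by (auto simp: gottlieb_family_def extensional_def)
      qed
      then show ?thesis
        by (auto simp: a_def id_map_def)
    qed
    have "continuous_map (cube n) (aut1 ?M) a"
      unfolding aut1_def
      by (rule continuous_map_path_component_spaceI [OF 1 path_connected_space_cube s0(2)])
         (use bd [OF s0(1)] id_map_in_aut1 [of ?M] in \<open>auto simp: aut1_def topspace_path_component_space\<close>)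
    then have a: "a \<in> cube_maps n (aut1 ?M) (id_map ?M)"
      using bd by (simp add: cube_maps_def)
    have "(\<lambda>s. a s ?c) = (\<lambda>s. \<lambda>x\<in>topspace X. \<Psi> ((s, y0), x))"
      using c by (auto simp: a_def const_map_def restrict_def fun_eq_iff)
    then have "A = homotopy_induced n ?M ?c (\<lambda>f. f ?c) (homotopy_class n (aut1 ?M) (id_map ?M) a)"
      using A homotopy_induced_eval_aut1 [OF a c] by simp
    then show ?thesis
      using a by (auto simp: carrier_gottlieb_group)
  qed
qed

section \<open>Radial expansion and products of cubes\<close>

lemma continuous_map_comp:
  "continuous_map S Z h \<Longrightarrow> continuous_map T S f \<Longrightarrow> continuous_map T Z (\<lambda>t. h (f t))"
  using continuous_map_compose [of T S f Z h] by (simp add: o_def)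

lemma continuous_map_Max:
  assumes "finite I" "I \<noteq> {}" "\<And>i. i \<in> I \<Longrightarrow> continuous_map T euclideanreal (\<lambda>t. f t i)"
  shows "continuous_map T euclideanreal (\<lambda>t. Max (f t ` I) :: real)"
  using assms
proof (induction rule: finite_ne_induct)
  case (insert i I)
  then have "continuous_map T euclideanreal (\<lambda>t. max (f t i) (Max (f t ` I)))"
    by (intro continuous_map_real_max) auto
  moreover have "Max (f t ` insert i I) = max (f t i) (Max (f t ` I))" for t
    using insert.hyps by simp
  ultimately show ?case
    by simp
qed auto

text \<open>The maximum norm of \<open>2 x - 1\<close>: the distance from the centre, scaled to be 1
  on the boundary.\<close>

definition cube_radius :: "nat \<Rightarrow> (nat \<Rightarrow> real) \<Rightarrow> real" where
  "cube_radius m x = Max ((\<lambda>j. \<bar>2 * x j - 1\<bar>) ` {..<m})"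

lemma continuous_map_cube_radius:
  assumes "continuous_map T (cube m) f" "0 < m"
  shows "continuous_map T euclideanreal (\<lambda>t. cube_radius m (f t))"
  unfolding cube_radius_def
proof (rule continuous_map_Max)
  fix j assume "j \<in> {..<m}"
  then have "continuous_map T euclideanreal (\<lambda>t. f t j)"
    using continuous_map_cube_coord [OF assms(1)] by (simp add: continuous_map_UI_iff)
  then show "continuous_map T euclideanreal (\<lambda>t. \<bar>2 * f t j - 1\<bar>)"
    by (intro continuous_intros)
qed (use assms(2) in auto)

lemma cube_radius_ge: "j < m \<Longrightarrow> \<bar>2 * x j - 1\<bar> \<le> cube_radius m x"
  by (simp add: cube_radius_def)

lemma cube_radius_attained:
  assumes "0 < m"
  shows "\<exists>j<m. cube_radius m x = \<bar>2 * x j - 1\<bar>"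
proof -
  have "cube_radius m x \<in> (\<lambda>j. \<bar>2 * x j - 1\<bar>) ` {..<m}"
    unfolding cube_radius_def using assms by (intro Max_in) auto
  then show ?thesis
    by auto
qed

lemma cube_radius_nonneg: "0 < m \<Longrightarrow> 0 \<le> cube_radius m x"
  using cube_radius_ge [of 0 m x] by linarith

lemma cube_radius_le_1:
  assumes "0 < m" "x \<in> topspace (cube m)"
  shows "cube_radius m x \<le> 1"
proof -
  obtain j where "j < m" "cube_radius m x = \<bar>2 * x j - 1\<bar>"
    using cube_radius_attained [OF assms(1)] by blast
  moreover from this have "0 \<le> x j" "x j \<le> 1"
    using assms(2) by (auto simp: in_topspace_cube)
  ultimately show ?thesis
    by auto
qed

lemma cube_radius_eq_1_iff:
  assumes m: "0 < m" and x: "x \<in> topspace (cube m)"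
  shows "cube_radius m x = 1 \<longleftrightarrow> x \<in> cube_boundary m"
proof
  assume 1: "cube_radius m x = 1"
  obtain j where j: "j < m" "cube_radius m x = \<bar>2 * x j - 1\<bar>"
    using cube_radius_attained [OF m] by blast
  then have "x j = 0 \<or> x j = 1"
    using 1 by auto
  then show "x \<in> cube_boundary m"
    using in_cube_boundaryI [OF x j(1)] by blast
next
  assume "x \<in> cube_boundary m"
  then obtain j where "j < m" "x j = 0 \<or> x j = 1"
    by (auto simp: cube_boundary_def)
  then have "1 \<le> cube_radius m x"
    using cube_radius_ge [of j m x] by auto
  then show "cube_radius m x = 1"
    using cube_radius_le_1 [OF m x] by simp
qed

text \<open>In the centred coordinates \<open>2 x - 1\<close> this multiplies by
  \<open>1 + v\<close> and then clamps each coordinate, so that the collar left outside is pressed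
  onto the boundary.\<close>

definition cube_expand :: "nat \<Rightarrow> real \<Rightarrow> (nat \<Rightarrow> real) \<Rightarrow> nat \<Rightarrow> real" where
  "cube_expand m v x = (\<lambda>j\<in>{..<m}. max 0 (min 1 (((1 + v) * (2 * x j - 1) + 1) / 2)))"

text \<open>How far the stretched point overshoots the boundary before clamping. It serves as a
  clock on the collar: it starts at 0 where the stretched cell reaches the boundary and ends at v on
  the boundary itself.\<close>

definition cube_excess :: "nat \<Rightarrow> real \<Rightarrow> (nat \<Rightarrow> real) \<Rightarrow> real" where
  "cube_excess m v x = max 0 ((1 + v) * cube_radius m x - 1)"

lemma cube_expand_in_cube: "cube_expand m v x \<in> topspace (cube m)"
  by (auto simp: in_topspace_cube cube_expand_def)

lemma cube_expand_0: "x \<in> topspace (cube m) \<Longrightarrow> cube_expand m 0 x = x"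
  by (auto simp: in_topspace_cube cube_expand_def extensional_def fun_eq_iff)

text \<open>A coordinate of largest deviation from the centre realises the radius; it is stretched
  to a face or past it, and the clamp leaves it on that face.\<close>

lemma cube_expand_boundary:
  assumes "0 < m" "1 \<le> (1 + v) * cube_radius m x"
  shows "cube_expand m v x \<in> cube_boundary m"
proof -
  obtain j where j: "j < m" "cube_radius m x = \<bar>2 * x j - 1\<bar>"
    using cube_radius_attained [OF assms(1)] by blast
  define w where "w = 2 * x j - 1"
  have "1 \<le> (1 + v) * \<bar>w\<bar>"
    using assms(2) j by (simp add: w_def)
  moreover have "(1 + v) * \<bar>w\<bar> = (1 + v) * w \<or> (1 + v) * \<bar>w\<bar> = - ((1 + v) * w)"
    by (cases "0 \<le> w") simp_all
  ultimately have "1 \<le> (1 + v) * (2 * x j - 1) \<or> (1 + v) * (2 * x j - 1) \<le> -1"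
    unfolding w_def by linarith
  moreover have "max 0 (min 1 ((e + 1) / 2)) = 0 \<or> max 0 (min 1 ((e + 1) / 2)) = 1"
    if "1 \<le> e \<or> e \<le> -1" for e :: real
    using that by (elim disjE) simp_all
  ultimately have "cube_expand m v x j = 0 \<or> cube_expand m v x j = 1"
    unfolding cube_expand_def restrict_apply' [OF lessThan_iff [THEN iffD2, OF j(1)]] by blast
  then show ?thesis
    using in_cube_boundaryI [OF cube_expand_in_cube j(1)] by blast
qed

lemma continuous_map_cube_expand:
  assumes v: "continuous_map T UI v" and x: "continuous_map T (cube m) x"
  shows "continuous_map T (cube m) (\<lambda>t. cube_expand m (v t) (x t))"
proof (rule continuous_map_into_cubeI)
  fix j assume j: "j < m"
  have "continuous_map T euclideanreal (\<lambda>t. x t j)" "continuous_map T euclideanreal v"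
    using continuous_map_cube_coord [OF x j] v by (simp_all add: continuous_map_UI_iff)
  then have "continuous_map T euclideanreal (\<lambda>t. max 0 (min 1 (((1 + v t) * (2 * x t j - 1) + 1) * (1/2))))"
    by (intro continuous_intros)
  then show "continuous_map T UI (\<lambda>t. cube_expand m (v t) (x t) j)"
    using j by (simp add: continuous_map_UI_iff cube_expand_def)
qed (auto simp: cube_expand_def)

lemma cube_excess_bounds:
  assumes "0 < m" "x \<in> topspace (cube m)" "0 \<le> v"
  shows "0 \<le> cube_excess m v x" "cube_excess m v x \<le> v"
proof -
  have "(1 + v) * cube_radius m x \<le> (1 + v) * 1"
    using assms cube_radius_le_1 by (intro mult_left_mono) auto
  then have "(1 + v) * cube_radius m x - 1 \<le> v"
    unfolding mult_1_right by linarith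
  then show "0 \<le> cube_excess m v x" "cube_excess m v x \<le> v"
    unfolding cube_excess_def using assms(3) by (rule_tac max.cobounded1, intro max.boundedI)
qed

lemma cube_excess_0: "0 < m \<Longrightarrow> x \<in> topspace (cube m) \<Longrightarrow> cube_excess m 0 x = 0"
  using cube_excess_bounds [of m x 0] by simp

lemma cube_excess_boundary:
  assumes "0 < m" "x \<in> cube_boundary m" "0 \<le> v"
  shows "cube_excess m v x = v" "cube_expand m v x \<in> cube_boundary m"
proof -
  have "cube_radius m x = 1"
    using cube_radius_eq_1_iff [of m x] assms cube_boundary_subset by auto
  then show "cube_excess m v x = v" "cube_expand m v x \<in> cube_boundary m"
    using assms by (auto simp: cube_excess_def intro!: cube_expand_boundary)
qed

lemma cube_expand_boundary_excess:
  assumes "0 < m" "cube_excess m v x \<noteq> 0"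
  shows "cube_expand m v x \<in> cube_boundary m"
  using assms by (intro cube_expand_boundary) (auto simp: cube_excess_def max_def split: if_splits)

lemma continuous_map_cube_excess:
  assumes v: "continuous_map T UI v" and x: "continuous_map T (cube m) x" and m: "0 < m"
  shows "continuous_map T UI (\<lambda>t. cube_excess m (v t) (x t))"
proof -
  have "continuous_map T euclideanreal (\<lambda>t. cube_excess m (v t) (x t))"
    using v unfolding cube_excess_def continuous_map_UI_iff
    by (intro continuous_intros continuous_map_cube_radius [OF x m]) auto
  moreover have "0 \<le> cube_excess m (v t) (x t) \<and> cube_excess m (v t) (x t) \<le> 1" if "t \<in> topspace T" for t
    using cube_excess_bounds [OF m, of "x t" "v t"] that v continuous_map_funspace [OF x]
    by (force simp: continuous_map_UI_iff)
  ultimately show ?thesis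
    by (simp add: continuous_map_UI_iff)
qed

text \<open>The parameters s come first, so for \<open>0 < n\<close> coordinate 0, in which
  \<open>cube_concat\<close> operates, belongs to s and never to the cell.\<close>

definition cube_join :: "nat \<Rightarrow> nat \<Rightarrow> (nat \<Rightarrow> real) \<Rightarrow> (nat \<Rightarrow> real) \<Rightarrow> nat \<Rightarrow> real" where
  "cube_join n m s x = (\<lambda>j\<in>{..<n + m}. if j < n then s j else x (j - n))"

definition cube_left :: "nat \<Rightarrow> (nat \<Rightarrow> real) \<Rightarrow> nat \<Rightarrow> real" where
  "cube_left n z = restrict z {..<n}"

definition cube_right :: "nat \<Rightarrow> nat \<Rightarrow> (nat \<Rightarrow> real) \<Rightarrow> nat \<Rightarrow> real" where
  "cube_right n m z = (\<lambda>j\<in>{..<m}. z (n + j))"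

lemma cube_join_in_cube:
  "s \<in> topspace (cube n) \<Longrightarrow> x \<in> topspace (cube m) \<Longrightarrow> cube_join n m s x \<in> topspace (cube (n + m))"
  by (auto simp: in_topspace_cube cube_join_def)

lemma continuous_map_cube_join:
  assumes s: "continuous_map T (cube n) s" and x: "continuous_map T (cube m) x"
  shows "continuous_map T (cube (n + m)) (\<lambda>t. cube_join n m (s t) (x t))"
proof (rule continuous_map_into_cubeI)
  show "continuous_map T UI (\<lambda>t. cube_join n m (s t) (x t) j)" if "j < n + m" for j
    using that continuous_map_cube_coord [OF s, of j] continuous_map_cube_coord [OF x, of "j - n"]
    by (cases "j < n") (auto simp: cube_join_def)
qed (auto simp: cube_join_def)

lemma cube_join_boundary:
  assumes "s \<in> topspace (cube n)" "x \<in> topspace (cube m)" "s \<in> cube_boundary n \<or> x \<in> cube_boundary m"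
  shows "cube_join n m s x \<in> cube_boundary (n + m)"
  using assms(3)
proof
  assume "s \<in> cube_boundary n"
  then obtain j where "j < n" "s j = 0 \<or> s j = 1"
    by (auto simp: cube_boundary_def)
  then show ?thesis
    using cube_join_in_cube [OF assms(1,2)] by (intro in_cube_boundaryI [of _ _ j]) (auto simp: cube_join_def)
next
  assume "x \<in> cube_boundary m"
  then obtain j where "j < m" "x j = 0 \<or> x j = 1"
    by (auto simp: cube_boundary_def)
  then show ?thesis
    using cube_join_in_cube [OF assms(1,2)] by (intro in_cube_boundaryI [of _ _ "n + j"]) (auto simp: cube_join_def)
qed

lemma cube_join_upd: "0 < n \<Longrightarrow> (cube_join n m s x)(0 := a) = cube_join n m (s(0 := a)) x"
  by (auto simp: cube_join_def fun_eq_iff)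

lemma cube_join_at_0: "0 < n \<Longrightarrow> cube_join n m s x 0 = s 0"
  by (simp add: cube_join_def)

lemma cube_left_in_cube: "z \<in> topspace (cube (n + m)) \<Longrightarrow> cube_left n z \<in> topspace (cube n)"
  by (auto simp: in_topspace_cube cube_left_def)

lemma cube_right_in_cube: "z \<in> topspace (cube (n + m)) \<Longrightarrow> cube_right n m z \<in> topspace (cube m)"
  by (auto simp: in_topspace_cube cube_right_def)

lemma continuous_map_cube_left:
  assumes z: "continuous_map T (cube (n + m)) z"
  shows "continuous_map T (cube n) (\<lambda>t. cube_left n (z t))"
proof (rule continuous_map_into_cubeI)
  show "continuous_map T UI (\<lambda>t. cube_left n (z t) j)" if "j < n" for j
    using that continuous_map_cube_coord [OF z, of j] by (simp add: cube_left_def)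
qed (auto simp: cube_left_def)

lemma continuous_map_cube_right:
  assumes z: "continuous_map T (cube (n + m)) z"
  shows "continuous_map T (cube m) (\<lambda>t. cube_right n m (z t))"
proof (rule continuous_map_into_cubeI)
  show "continuous_map T UI (\<lambda>t. cube_right n m (z t) j)" if "j < m" for j
    using that continuous_map_cube_coord [OF z, of "n + j"] by (simp add: cube_right_def)
qed (auto simp: cube_right_def)

lemma cube_join_left_right:
  "z \<in> topspace (cube (n + m)) \<Longrightarrow> cube_join n m (cube_left n z) (cube_right n m z) = z"
  by (auto simp: in_topspace_cube cube_join_def cube_left_def cube_right_def extensional_def fun_eq_iff)

lemma cube_left_join: "s \<in> topspace (cube n) \<Longrightarrow> cube_left n (cube_join n m s x) = s"
  by (auto simp: in_topspace_cube cube_join_def cube_left_def extensional_def fun_eq_iff)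

lemma cube_right_join: "x \<in> topspace (cube m) \<Longrightarrow> cube_right n m (cube_join n m s x) = x"
  by (auto simp: in_topspace_cube cube_join_def cube_right_def extensional_def fun_eq_iff)

lemma cube_boundary_split:
  assumes "z \<in> cube_boundary (n + m)"
  shows "cube_left n z \<in> cube_boundary n \<or> cube_right n m z \<in> cube_boundary m"
proof -
  obtain j where j: "j < n + m" "z j = 0 \<or> z j = 1" and z: "z \<in> topspace (cube (n + m))"
    using assms by (auto simp: cube_boundary_def)
  show ?thesis
  proof (cases "j < n")
    case True
    then have "cube_left n z \<in> cube_boundary n"
      using j cube_left_in_cube [OF z] by (intro in_cube_boundaryI [of _ _ j]) (auto simp: cube_left_def)
    then show ?thesis ..
  next
    case False
    then have "cube_right n m z \<in> cube_boundary m"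
      using j cube_right_in_cube [OF z]
      by (intro in_cube_boundaryI [of _ _ "j - n"]) (auto simp: cube_right_def)
    then show ?thesis ..
  qed
qed

section \<open>Maps out of a wedge of spheres\<close>

lemma null_component_cube_mapsI:
  assumes F: "continuous_map (prod_topology (cube n) X) Y F"
    and bd: "\<And>s x. s \<in> cube_boundary n \<Longrightarrow> x \<in> topspace X \<Longrightarrow> F (s, x) = y0"
    and y0: "y0 \<in> topspace Y" and n: "0 < n"
  shows "(\<lambda>s. \<lambda>x\<in>topspace X. F (s, x)) \<in> cube_maps n (null_component X Y y0) (const_map X y0)"
proof -
  have "(\<lambda>j\<in>{..<n}. 0::real) \<in> topspace (cube n)"
    using cube_boundary_nonempty [OF n] cube_boundary_subset by blast
  then have "continuous_map (cube n) (null_component X Y y0) (\<lambda>s. \<lambda>x\<in>topspace X. F (s, x))"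
    using F bd cube_boundary_nonempty [OF n] y0
    by (intro continuous_map_into_null_component [OF _ path_connected_space_cube]) simp_all
  then show ?thesis
    using bd by (auto simp: cube_maps_def const_map_def)
qed

lemma cube_homotopic_null_componentI:
  assumes H: "continuous_map (prod_topology (prod_topology UI (cube n)) X) Y H"
    and bd: "\<And>t s x. t \<in> {0..1} \<Longrightarrow> s \<in> cube_boundary n \<Longrightarrow> x \<in> topspace X \<Longrightarrow> H ((t, s), x) = y0"
    and f: "\<And>s. s \<in> topspace (cube n) \<Longrightarrow> (\<lambda>x\<in>topspace X. H ((0, s), x)) = f s"
    and g: "\<And>s. s \<in> topspace (cube n) \<Longrightarrow> (\<lambda>x\<in>topspace X. H ((1, s), x)) = g s"
    and y0: "y0 \<in> topspace Y" and n: "0 < n"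
  shows "cube_homotopic n (null_component X Y y0) (const_map X y0) f g"
proof (rule cube_homotopicI [where h = "\<lambda>q. \<lambda>x\<in>topspace X. H (q, x)"])
  let ?s0 = "\<lambda>j\<in>{..<n}. 0::real"
  have "path_connected_space UI"
    using path_connected_space_euclidean_subtopology convex_imp_path_connected by blast
  then have "path_connected_space (prod_topology UI (cube n))"
    by (simp add: path_connected_space_prod_topology path_connected_space_cube)
  moreover have "?s0 \<in> cube_boundary n" "?s0 \<in> topspace (cube n)"
    using cube_boundary_nonempty [OF n] cube_boundary_subset by auto
  ultimately show "continuous_map (prod_topology UI (cube n)) (null_component X Y y0)
      (\<lambda>q. \<lambda>x\<in>topspace X. H (q, x))"
    using H y0 bd
    by (intro continuous_map_into_null_component [where t = "(0, ?s0)"]) (simp_all del: restrict_apply)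
  show "(\<lambda>x\<in>topspace X. H ((t, s), x)) = const_map X y0" if "t \<in> {0..1}" "s \<in> cube_boundary n" for t s
    using bd that by (auto simp: const_map_def)
qed (use f g in auto)

text \<open>
  A wedge of spheres enters only through the characteristic maps \<open>\<kappa> r\<close> of its cells, which collapse the
  boundary of a cube to the wedge point \<open>w0\<close>.
\<close>

locale sphere_wedge =
  fixes X :: "'x topology" and w0 :: 'x and R :: "'r set" and m :: "'r \<Rightarrow> nat"
    and \<kappa> :: "'r \<Rightarrow> (nat \<Rightarrow> real) \<Rightarrow> 'x"
  assumes Hausdorff_X: "Hausdorff_space X"
    and finite_R: "finite R" and R_nonempty: "R \<noteq> {}"
    and m_pos: "r \<in> R \<Longrightarrow> 0 < m r"
    and continuous_\<kappa>: "r \<in> R \<Longrightarrow> continuous_map (cube (m r)) X (\<kappa> r)"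
    and \<kappa>_cover: "topspace X = (\<Union>r\<in>R. \<kappa> r ` topspace (cube (m r)))"
    and \<kappa>_boundary: "r \<in> R \<Longrightarrow> x \<in> topspace (cube (m r)) \<Longrightarrow> \<kappa> r x = w0 \<longleftrightarrow> x \<in> cube_boundary (m r)"
    and \<kappa>_inj: "r \<in> R \<Longrightarrow> r' \<in> R \<Longrightarrow> x \<in> topspace (cube (m r)) \<Longrightarrow> x' \<in> topspace (cube (m r')) \<Longrightarrow>
           \<kappa> r x = \<kappa> r' x' \<Longrightarrow> x \<notin> cube_boundary (m r) \<Longrightarrow> r = r' \<and> x = x'"
begin

lemma \<kappa>_in_X: "r \<in> R \<Longrightarrow> x \<in> topspace (cube (m r)) \<Longrightarrow> \<kappa> r x \<in> topspace X"
  using \<kappa>_cover by blast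

lemma \<kappa>_at_boundary: "r \<in> R \<Longrightarrow> x \<in> cube_boundary (m r) \<Longrightarrow> \<kappa> r x = w0"
  using \<kappa>_boundary cube_boundary_subset by blast

lemma prod_pieceE:
  assumes "p \<in> topspace (prod_topology T X)"
  obtains t r x where "t \<in> topspace T" "r \<in> R" "x \<in> topspace (cube (m r))" "p = (t, \<kappa> r x)"
proof -
  obtain t w where tw: "p = (t, w)" "t \<in> topspace T" "w \<in> topspace X"
    using assms by (cases p) auto
  then obtain r x where "r \<in> R" "x \<in> topspace (cube (m r))" "w = \<kappa> r x"
    using \<kappa>_cover by blast
  with tw that show ?thesis
    by blast
qed

lemma w0_in_X: "w0 \<in> topspace X"
proof -
  obtain r where r: "r \<in> R"
    using R_nonempty by blast
  then have "(\<lambda>j\<in>{..<m r}. 0) \<in> cube_boundary (m r)"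
    using m_pos by (intro cube_boundary_nonempty)
  then show ?thesis
    using \<kappa>_at_boundary [OF r] \<kappa>_in_X [OF r] cube_boundary_subset by (metis subsetD)
qed

lemma locally_compact_X: "locally_compact_space X"
proof -
  have "compactin X (\<Union>r\<in>R. \<kappa> r ` topspace (cube (m r)))"
    using finite_R compact_space_cube
    by (intro compactin_Union)
       (auto simp: compact_space_def intro!: image_compactin [OF _ continuous_\<kappa>])
  then have "compact_space X"
    using \<kappa>_cover by (simp add: compact_space_def)
  then show ?thesis
    using Hausdorff_X compact_imp_locally_compact_space by blast
qed

text \<open>A characteristic map goes from a compact to a Hausdorff space and is therefore proper;
  properness survives the product with any T, so its images of closed sets are closed. The preimage
  of a closed set under h is a finite union of such images. No assumption on T is made.\<close>

lemma continuous_map_from_pieces: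
  assumes h: "\<And>r. r \<in> R \<Longrightarrow>
    continuous_map (prod_topology T (cube (m r))) Z (\<lambda>p. h (fst p, \<kappa> r (snd p)))"
  shows "continuous_map (prod_topology T X) Z h"
  unfolding continuous_map_closedin
proof (intro conjI funcsetI allI impI)
  fix p assume "p \<in> topspace (prod_topology T X)"
  then obtain t r x where "t \<in> topspace T" "r \<in> R" "x \<in> topspace (cube (m r))" "p = (t, \<kappa> r x)"
    by (rule prod_pieceE)
  then show "h p \<in> topspace Z"
    using continuous_map_funspace [OF h, of r] by (force simp: Pi_iff)
next
  fix C assume C: "closedin Z C"
  let ?\<kappa> = "\<lambda>r (t, x). (t, \<kappa> r x)"
  let ?C = "\<lambda>r. {p \<in> topspace (prod_topology T (cube (m r))). h (fst p, \<kappa> r (snd p)) \<in> C}"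
  have "closedin (prod_topology T X) (?\<kappa> r ` ?C r)" if r: "r \<in> R" for r
  proof -
    have "proper_map (cube (m r)) X (\<kappa> r)"
      by (rule continuous_imp_proper_map [OF compact_space_cube Hausdorff_imp_kc_space [OF Hausdorff_X]
            continuous_\<kappa> [OF r]])
    moreover have "proper_map T T (\<lambda>t. t)"
      using proper_map_id [of T] by (simp add: id_def)
    ultimately have "proper_map (prod_topology T (cube (m r))) (prod_topology T X) (?\<kappa> r)"
      by (simp add: proper_map_prod)
    then have "closed_map (prod_topology T (cube (m r))) (prod_topology T X) (?\<kappa> r)"
      by (simp add: proper_imp_closed_map)
    then show ?thesis
      using closedin_continuous_map_preimage [OF h [OF r] C] by (simp add: closed_map_def)
  qed
  then have "closedin (prod_topology T X) (\<Union>r\<in>R. ?\<kappa> r ` ?C r)"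
    using finite_R by (intro closedin_Union) auto
  moreover have "{p \<in> topspace (prod_topology T X). h p \<in> C} = (\<Union>r\<in>R. ?\<kappa> r ` ?C r)" (is "?L = ?U")
  proof (intro equalityI subsetI)
    fix p assume p: "p \<in> ?L"
    then have "p \<in> topspace (prod_topology T X)"
      by simp
    then obtain t r x where trx: "t \<in> topspace T" "r \<in> R" "x \<in> topspace (cube (m r))" "p = (t, \<kappa> r x)"
      by (rule prod_pieceE)
    then have "(t, x) \<in> ?C r" "p = ?\<kappa> r (t, x)"
      using p by auto
    then show "p \<in> ?U"
      using trx(2) by blast
  qed (use \<kappa>_in_X in auto)
  ultimately show "closedin (prod_topology T X) {p \<in> topspace (prod_topology T X). h p \<in> C}"
    by simp
qed

text \<open>On X the choice is forced except at the wedge point, which all cell boundaries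
  share.\<close>

definition piece :: "'x \<Rightarrow> 'r \<times> (nat \<Rightarrow> real)" where
  "piece w = (SOME q. fst q \<in> R \<and> snd q \<in> topspace (cube (m (fst q))) \<and> \<kappa> (fst q) (snd q) = w)"

text \<open>Meaningful when, for the given t, \<open>g t\<close> takes one common value on all cell
  boundaries; the arbitrary choice at the wedge point is then invisible.\<close>

definition glue :: "('t \<Rightarrow> 'r \<Rightarrow> (nat \<Rightarrow> real) \<Rightarrow> 'z) \<Rightarrow> 't \<Rightarrow> 'x \<Rightarrow> 'z" where
  "glue g t w = g t (fst (piece w)) (snd (piece w))"

lemma glue_\<kappa>:
  assumes bd: "\<And>r r' x x'. r \<in> R \<Longrightarrow> r' \<in> R \<Longrightarrow> x \<in> cube_boundary (m r) \<Longrightarrow> x' \<in> cube_boundary (m r') \<Longrightarrow>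
      g t r x = g t r' x'"
    and r: "r \<in> R" and x: "x \<in> topspace (cube (m r))"
  shows "glue g t (\<kappa> r x) = g t r x"
proof -
  define r' x' where "r' = fst (piece (\<kappa> r x))" and "x' = snd (piece (\<kappa> r x))"
  have "fst (piece (\<kappa> r x)) \<in> R \<and> snd (piece (\<kappa> r x)) \<in> topspace (cube (m (fst (piece (\<kappa> r x))))) \<and>
        \<kappa> (fst (piece (\<kappa> r x))) (snd (piece (\<kappa> r x))) = \<kappa> r x"
    unfolding piece_def by (rule someI [of _ "(r, x)"]) (use r x in simp)
  then have r': "r' \<in> R" "x' \<in> topspace (cube (m r'))" "\<kappa> r' x' = \<kappa> r x"
    by (auto simp: r'_def x'_def)
  have "g t r' x' = g t r x"
  proof (cases "x \<in> cube_boundary (m r)")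
    case True
    then have "x' \<in> cube_boundary (m r')"
      using r' \<kappa>_at_boundary [OF r] \<kappa>_boundary [OF r'(1,2)] by metis
    then show ?thesis
      using bd [OF r'(1) r] True by blast
  next
    case False
    then show ?thesis
      using \<kappa>_inj [OF r r'(1) x r'(2)] r'(3) by metis
  qed
  then show ?thesis
    by (simp add: glue_def r'_def x'_def)
qed

lemma continuous_map_glue:
  assumes g: "\<And>r. r \<in> R \<Longrightarrow> continuous_map (prod_topology T (cube (m r))) Z (\<lambda>p. g (fst p) r (snd p))"
    and bd: "\<And>t r r' x x'. t \<in> topspace T \<Longrightarrow> r \<in> R \<Longrightarrow> r' \<in> R \<Longrightarrow>
      x \<in> cube_boundary (m r) \<Longrightarrow> x' \<in> cube_boundary (m r') \<Longrightarrow> g t r x = g t r' x'"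
  shows "continuous_map (prod_topology T X) Z (\<lambda>p. glue g (fst p) (snd p))"
proof (rule continuous_map_from_pieces)
  fix r assume r: "r \<in> R"
  show "continuous_map (prod_topology T (cube (m r))) Z
      (\<lambda>p. glue g (fst (fst p, \<kappa> r (snd p))) (snd (fst p, \<kappa> r (snd p))))"
  proof (rule continuous_map_eq [OF g [OF r]])
    fix p assume "p \<in> topspace (prod_topology T (cube (m r)))"
    then have p: "fst p \<in> topspace T" "snd p \<in> topspace (cube (m r))"
      by auto
    show "g (fst p) r (snd p) = glue g (fst (fst p, \<kappa> r (snd p))) (snd (fst p, \<kappa> r (snd p)))"
      using glue_\<kappa> [of g "fst p" r "snd p", OF bd [OF p(1)] r p(2)] by simp
  qed
qed

lemma glue_ext:
  assumes "\<And>r x. r \<in> R \<Longrightarrow> x \<in> topspace (cube (m r)) \<Longrightarrow> f (\<kappa> r x) = h (\<kappa> r x)"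
  shows "restrict f (topspace X) = restrict h (topspace X)"
  using assms \<kappa>_cover by (intro restrict_ext) auto

end

locale wedge_mapping = sphere_wedge X w0 R m \<kappa>
  for X :: "'x topology" and w0 :: 'x and R :: "'r set" and m :: "'r \<Rightarrow> nat"
    and \<kappa> :: "'r \<Rightarrow> (nat \<Rightarrow> real) \<Rightarrow> 'x" +
  fixes Y :: "'y topology" and y0 :: 'y and n :: nat
  assumes y0: "y0 \<in> topspace Y" and n_pos: "0 < n"
    and Y_conn: "path_connected_space Y"
    and Y_lc: "locally_compact_space Y" and Y_Hausdorff: "Hausdorff_space Y"
begin

abbreviation M :: "('x \<Rightarrow> 'y) topology" where
  "M \<equiv> null_component X Y y0"

abbreviation c0 :: "'x \<Rightarrow> 'y" where
  "c0 \<equiv> const_map X y0"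

abbreviation PM where "PM \<equiv> homotopy_group n M c0"

abbreviation PY where "PY \<equiv> \<lambda>j. homotopy_group j Y y0"

abbreviation GM where "GM \<equiv> gottlieb_group n M c0"

abbreviation GY where "GY \<equiv> \<lambda>j. gottlieb_group j Y y0"

lemma c0_in_M: "c0 \<in> topspace M"
  using y0 by (rule const_map_in_null_component)

lemma c0_at: "w \<in> topspace X \<Longrightarrow> c0 w = y0"
  by (simp add: const_map_def)

sublocale PM: group PM
  by (rule group_homotopy_group [OF c0_in_M n_pos])

lemma group_PY: "0 < j \<Longrightarrow> group (PY j)"
  using group_homotopy_group [OF y0] .

lemma mult_PM:
  "f \<in> cube_maps n M c0 \<Longrightarrow> g \<in> cube_maps n M c0 \<Longrightarrow>
     homotopy_class n M c0 f \<otimes>\<^bsub>PM\<^esub> homotopy_class n M c0 g = homotopy_class n M c0 (cube_concat f g)"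
  by (rule mult_homotopy_group [OF _ _ n_pos])

lemma cube_maps_apply:
  assumes "b \<in> cube_maps j Z z" "continuous_map T (cube j) f"
  shows "continuous_map T Z (\<lambda>t. b (f t))"
  using assms continuous_map_comp by (force simp: cube_maps_def)

lemma cube_maps_boundary: "b \<in> cube_maps j Z z \<Longrightarrow> s \<in> cube_boundary j \<Longrightarrow> b s = z"
  by (simp add: cube_maps_def)

subsection \<open>The maps between homotopy groups\<close>

abbreviation section_map where "section_map \<equiv> homotopy_induced n M c0 (const_map X)"

abbreviation eval_map where "eval_map \<equiv> homotopy_induced n Y y0 (\<lambda>f. f w0)"

text \<open>The fibre of evaluation at \<open>w0\<close> is a product of iterated loop spaces, and
  degree n of the (m r)-fold loop space is degree \<open>n + m r\<close> of Y. This is the inclusion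
  of that fibre on representatives.\<close>

definition union_map :: "('r \<Rightarrow> (nat \<Rightarrow> real) \<Rightarrow> 'y) \<Rightarrow> (nat \<Rightarrow> real) \<Rightarrow> 'x \<Rightarrow> 'y" where
  "union_map b s = (\<lambda>w\<in>topspace X. glue (\<lambda>s r x. b r (cube_join n (m r) s x)) s w)"

text \<open>All representatives are used at once, as in the product of
  \<open>homotopy_group\<close>, so no choice enters. Only the values of \<open>B\<close> on
  \<open>R\<close> matter.\<close>

definition union_class :: "('r \<Rightarrow> ((nat \<Rightarrow> real) \<Rightarrow> 'y) set) \<Rightarrow> ((nat \<Rightarrow> real) \<Rightarrow> 'x \<Rightarrow> 'y) set" where
  "union_class B = {h. \<exists>b. (\<forall>r\<in>R. b r \<in> B r) \<and> cube_homotopic n M c0 (union_map b) h}"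

lemma section_hom: "section_map \<in> hom (PY n) PM"
  by (rule homotopy_induced_hom [OF continuous_map_const_map [OF Y_conn y0] refl n_pos])

lemma section_class:
  "a \<in> cube_maps n Y y0 \<Longrightarrow>
     section_map (homotopy_class n Y y0 a) = homotopy_class n M c0 (const_map X \<circ> a)"
  by (rule homotopy_induced_class [OF _ continuous_map_const_map [OF Y_conn y0] refl])

lemma section_in_cube_maps: "a \<in> cube_maps n Y y0 \<Longrightarrow> const_map X \<circ> a \<in> cube_maps n M c0"
  by (rule comp_in_cube_maps [OF _ continuous_map_const_map [OF Y_conn y0] refl])

lemma continuous_map_eval_M: "continuous_map M Y (\<lambda>f. f w0)"
  unfolding null_component_def
  by (intro continuous_map_from_path_component_space continuous_map_eval_mapping_space w0_in_X)

lemma eval_hom: "eval_map \<in> hom PM (PY n)"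
  using homotopy_induced_hom [of M Y "\<lambda>f. f w0" c0 y0 n] continuous_map_eval_M c0_at [OF w0_in_X] n_pos
  by simp

lemma eval_class:
  "f \<in> cube_maps n M c0 \<Longrightarrow> eval_map (homotopy_class n M c0 f) = homotopy_class n Y y0 (\<lambda>s. f s w0)"
  using homotopy_induced_class [of f n M c0 Y "\<lambda>f. f w0" y0] continuous_map_eval_M c0_at [OF w0_in_X]
  by (simp add: o_def)

lemma eval_section:
  assumes "A \<in> carrier (PY n)"
  shows "eval_map (section_map A) = A"
proof -
  obtain a where a: "a \<in> cube_maps n Y y0" "A = homotopy_class n Y y0 a"
    using assms by (auto simp: carrier_homotopy_group)
  then show ?thesis
    using w0_in_X by (simp add: section_class eval_class section_in_cube_maps) (simp add: const_map_def)
qed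

section \<open>Unions of cells\<close>

lemma union_map_\<kappa>:
  assumes b: "\<And>r. r \<in> R \<Longrightarrow> b r \<in> cube_maps (n + m r) Y y0"
    and s: "s \<in> topspace (cube n)" and r: "r \<in> R" "x \<in> topspace (cube (m r))"
  shows "union_map b s (\<kappa> r x) = b r (cube_join n (m r) s x)"
proof -
  have "b r (cube_join n (m r) s x) = y0" if "r \<in> R" "x \<in> cube_boundary (m r)" for r x
    using cube_maps_boundary [OF b [OF that(1)] cube_join_boundary] s that cube_boundary_subset by blast
  then have "glue (\<lambda>s r x. b r (cube_join n (m r) s x)) s (\<kappa> r x) = b r (cube_join n (m r) s x)"
    by (intro glue_\<kappa>) (use r in auto)
  then show ?thesis
    using \<kappa>_in_X r by (simp add: union_map_def)
qed

lemma union_map_in_cube_maps: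
  assumes b: "\<And>r. r \<in> R \<Longrightarrow> b r \<in> cube_maps (n + m r) Y y0"
  shows "union_map b \<in> cube_maps n M c0"
proof -
  let ?F = "\<lambda>p. glue (\<lambda>s r x. b r (cube_join n (m r) s x)) (fst p) (snd p)"
  have b0: "b r (cube_join n (m r) s x) = y0"
    if "r \<in> R" "s \<in> topspace (cube n)" "x \<in> topspace (cube (m r))" "s \<in> cube_boundary n \<or> x \<in> cube_boundary (m r)" for r s x
    using cube_maps_boundary [OF b cube_join_boundary] that by blast
  have b1: "b r (cube_join n (m r) s x) = b r' (cube_join n (m r') s x')"
    if "s \<in> topspace (cube n)" "r \<in> R" "r' \<in> R" "x \<in> cube_boundary (m r)" "x' \<in> cube_boundary (m r')" for s r r' x x'
  proof -
    have "x \<in> topspace (cube (m r))" "x' \<in> topspace (cube (m r'))"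
      using that(4,5) cube_boundary_subset by auto
    then show ?thesis
      using b0 [of r s x] b0 [of r' s x'] that by simp
  qed
  have "continuous_map (prod_topology (cube n) X) Y ?F"
    by (rule continuous_map_glue)
       (rule cube_maps_apply [OF b] continuous_map_cube_join continuous_map_fst continuous_map_snd b1 | assumption)+
  moreover have "?F (s, w) = y0" if s: "s \<in> cube_boundary n" and w: "w \<in> topspace X" for s w
  proof -
    obtain r x where "r \<in> R" "x \<in> topspace (cube (m r))" "w = \<kappa> r x"
      using w \<kappa>_cover by auto
    moreover have "s \<in> topspace (cube n)"
      using s cube_boundary_subset by auto
    ultimately show ?thesis
      using glue_\<kappa> [of "\<lambda>s r x. b r (cube_join n (m r) s x)" s r x, OF b1] b0 s by simp
  qed
  ultimately have "(\<lambda>s. \<lambda>w\<in>topspace X. ?F (s, w)) \<in> cube_maps n M c0"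
    by (intro null_component_cube_mapsI y0 n_pos)
  then show ?thesis
    by (simp add: union_map_def [abs_def])
qed

lemma union_map_w0:
  assumes b: "\<And>r. r \<in> R \<Longrightarrow> b r \<in> cube_maps (n + m r) Y y0" and s: "s \<in> topspace (cube n)"
  shows "union_map b s w0 = y0"
proof -
  obtain r where r: "r \<in> R"
    using R_nonempty by blast
  define x where "x = (\<lambda>j\<in>{..<m r}. 0::real)"
  have x: "x \<in> cube_boundary (m r)" "x \<in> topspace (cube (m r))"
    unfolding x_def using cube_boundary_nonempty [OF m_pos [OF r]] cube_boundary_subset by auto
  show ?thesis
    using union_map_\<kappa> [OF b s r x(2)] \<kappa>_at_boundary [OF r x(1)]
      cube_maps_boundary [OF b [OF r] cube_join_boundary [OF s x(2)]] x(1) by simp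
qed

text \<open>The cell boundaries only have to agree with each other at each t and s; they need not be
  sent to \<open>y0\<close>. Thus the wedge point may move during the homotopy, which is a free one
  on the wedge.\<close>

lemma cube_homotopic_glueI:
  assumes H: "\<And>r. r \<in> R \<Longrightarrow>
      continuous_map (prod_topology (prod_topology UI (cube n)) (cube (m r))) Y (\<lambda>p. H (fst (fst p)) (snd (fst p)) r (snd p))"
    and comp: "\<And>t s r r' x x'. t \<in> {0..1} \<Longrightarrow> s \<in> topspace (cube n) \<Longrightarrow> r \<in> R \<Longrightarrow> r' \<in> R \<Longrightarrow>
      x \<in> cube_boundary (m r) \<Longrightarrow> x' \<in> cube_boundary (m r') \<Longrightarrow> H t s r x = H t s r' x'"
    and bd: "\<And>t s r x. t \<in> {0..1} \<Longrightarrow> s \<in> cube_boundary n \<Longrightarrow> r \<in> R \<Longrightarrow> x \<in> topspace (cube (m r)) \<Longrightarrow>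
      H t s r x = y0"
    and f: "\<And>s r x. s \<in> topspace (cube n) \<Longrightarrow> r \<in> R \<Longrightarrow> x \<in> topspace (cube (m r)) \<Longrightarrow> H 0 s r x = f s (\<kappa> r x)"
    and g: "\<And>s r x. s \<in> topspace (cube n) \<Longrightarrow> r \<in> R \<Longrightarrow> x \<in> topspace (cube (m r)) \<Longrightarrow> H 1 s r x = g s (\<kappa> r x)"
    and fM: "f \<in> cube_maps n M c0" and gM: "g \<in> cube_maps n M c0"
  shows "cube_homotopic n M c0 f g"
proof (rule cube_homotopic_null_componentI [OF _ _ _ _ y0 n_pos])
  let ?G = "\<lambda>q r x. H (fst q) (snd q) r x"
  let ?F = "\<lambda>p. glue ?G (fst p) (snd p)"
  have G: "glue ?G (t, s) (\<kappa> r x) = H t s r x"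
    if "t \<in> {0..1}" "s \<in> topspace (cube n)" "r \<in> R" "x \<in> topspace (cube (m r))" for t s r x
  proof -
    have "?G (t, s) r x = ?G (t, s) r' x'"
      if "r \<in> R" "r' \<in> R" "x \<in> cube_boundary (m r)" "x' \<in> cube_boundary (m r')" for r r' x x'
      unfolding fst_conv snd_conv by (rule comp) (fact that \<open>t \<in> {0..1}\<close> \<open>s \<in> topspace (cube n)\<close>)+
    from glue_\<kappa> [of ?G "(t, s)" r x, OF this that(3,4)] show ?thesis
      by simp
  qed
  show "continuous_map (prod_topology (prod_topology UI (cube n)) X) Y ?F"
  proof (rule continuous_map_glue)
    fix q :: "real \<times> (nat \<Rightarrow> real)" and r r' x x'
    assume "q \<in> topspace (prod_topology UI (cube n))" "r \<in> R" "r' \<in> R"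
      "x \<in> cube_boundary (m r)" "x' \<in> cube_boundary (m r')"
    then show "?G q r x = ?G q r' x'"
      by (intro comp) (auto simp: mem_Times_iff)
  qed (rule H)
  show "?F ((t, s), w) = y0" if t: "t \<in> {0..1}" and s: "s \<in> cube_boundary n" and w: "w \<in> topspace X" for t s w
  proof -
    obtain r x where "r \<in> R" "x \<in> topspace (cube (m r))" "w = \<kappa> r x"
      using w \<kappa>_cover by auto
    moreover have "s \<in> topspace (cube n)"
      using s cube_boundary_subset by auto
    ultimately show ?thesis
      using G t bd s by simp
  qed
  \<comment> \<open>Points of the null component are extensional, so agreement on all cells is
    equality.\<close>
  have ext: "h s \<in> extensional (topspace X)" if "h \<in> cube_maps n M c0" "s \<in> topspace (cube n)" for h s
  proof -
    have "continuous_map (cube n) M h"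
      using that(1) by (simp add: cube_maps_def)
    then show ?thesis
      using that(2) by (blast dest: continuous_map_funspace in_null_componentD(2))
  qed
  have *: "(\<lambda>w\<in>topspace X. ?F ((t, s), w)) = h s"
    if "t \<in> {0..1}" "s \<in> topspace (cube n)" "h \<in> cube_maps n M c0"
      and "\<And>r x. r \<in> R \<Longrightarrow> x \<in> topspace (cube (m r)) \<Longrightarrow> H t s r x = h s (\<kappa> r x)" for t s h
  proof -
    have "(\<lambda>w\<in>topspace X. ?F ((t, s), w)) = restrict (h s) (topspace X)"
      by (rule glue_ext) (use that G in simp)
    then show ?thesis
      using extensional_restrict [OF ext [OF that(3,2)]] by simp
  qed
  show "(\<lambda>w\<in>topspace X. ?F ((0, s), w)) = f s" if "s \<in> topspace (cube n)" for s
    by (rule *) (use that f fM in auto)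
  show "(\<lambda>w\<in>topspace X. ?F ((1, s), w)) = g s" if "s \<in> topspace (cube n)" for s
    by (rule *) (use that g gM in auto)
qed

lemma union_map_homotopic:
  assumes bb': "\<And>r. r \<in> R \<Longrightarrow> cube_homotopic (n + m r) Y y0 (b r) (b' r)"
  shows "cube_homotopic n M c0 (union_map b) (union_map b')"
proof -
  have b: "b r \<in> cube_maps (n + m r) Y y0" "b' r \<in> cube_maps (n + m r) Y y0" if "r \<in> R" for r
    using cube_homotopic_imp_cube_maps [OF bb' [OF that]] by auto
  have "\<forall>r\<in>R. \<exists>h. continuous_map (prod_topology UI (cube (n + m r))) Y h \<and>
      (\<forall>s\<in>topspace (cube (n + m r)). h (0, s) = b r s) \<and> (\<forall>s\<in>topspace (cube (n + m r)). h (1, s) = b' r s) \<and>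
      (\<forall>t\<in>{0..1}. \<forall>s\<in>cube_boundary (n + m r). h (t, s) = y0)"
    using bb' unfolding cube_homotopic_iff by blast
  then obtain h where h: "\<And>r. r \<in> R \<Longrightarrow> continuous_map (prod_topology UI (cube (n + m r))) Y (h r) \<and>
      (\<forall>s\<in>topspace (cube (n + m r)). h r (0, s) = b r s) \<and> (\<forall>s\<in>topspace (cube (n + m r)). h r (1, s) = b' r s) \<and>
      (\<forall>t\<in>{0..1}. \<forall>s\<in>cube_boundary (n + m r). h r (t, s) = y0)"
    by (metis (no_types, lifting))
  have h0: "h r (t, cube_join n (m r) s x) = y0"
    if "r \<in> R" "t \<in> {0..1}" "s \<in> topspace (cube n)" "x \<in> topspace (cube (m r))" "s \<in> cube_boundary n \<or> x \<in> cube_boundary (m r)" for r t s x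
    using h [OF that(1)] cube_join_boundary [OF that(3-5)] that(2) by blast
  show ?thesis
  proof (rule cube_homotopic_glueI [where H = "\<lambda>t s r x. h r (t, cube_join n (m r) s x)"])
    fix r assume r: "r \<in> R"
    let ?T = "prod_topology (prod_topology UI (cube n)) (cube (m r))"
    have "continuous_map ?T (prod_topology UI (cube (n + m r))) (\<lambda>p. (fst (fst p), cube_join n (m r) (snd (fst p)) (snd p)))"
      by (intro continuous_map_pairedI continuous_map_cube_join continuous_map_snd
          continuous_map_comp [OF continuous_map_fst continuous_map_fst] continuous_map_comp [OF continuous_map_snd continuous_map_fst])
    then show "continuous_map ?T Y (\<lambda>p. h r (fst (fst p), cube_join n (m r) (snd (fst p)) (snd p)))"
      using continuous_map_comp h r by blast
  next
    fix t :: real and s r r' x x'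
    assume "t \<in> {0..1}" "s \<in> topspace (cube n)" "r \<in> R" "r' \<in> R" "x \<in> cube_boundary (m r)" "x' \<in> cube_boundary (m r')"
    then show "h r (t, cube_join n (m r) s x) = h r' (t, cube_join n (m r') s x')"
      using h0 [of r t s x] h0 [of r' t s x'] cube_boundary_subset by (metis subsetD)
  next
    fix t :: real and s r x
    assume "t \<in> {0..1}" "s \<in> cube_boundary n" "r \<in> R" "x \<in> topspace (cube (m r))"
    then show "h r (t, cube_join n (m r) s x) = y0"
      using h0 [of r t s x] cube_boundary_subset by blast
  qed (use h b in \<open>auto simp: union_map_\<kappa> cube_join_in_cube intro!: union_map_in_cube_maps\<close>)
qed

lemma union_class_class:
  assumes b: "\<And>r. r \<in> R \<Longrightarrow> b r \<in> cube_maps (n + m r) Y y0"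
    and B: "\<And>r. r \<in> R \<Longrightarrow> B r = homotopy_class (n + m r) Y y0 (b r)"
  shows "union_class B = homotopy_class n M c0 (union_map b)"
proof -
  have "(\<exists>b'. (\<forall>r\<in>R. b' r \<in> B r) \<and> cube_homotopic n M c0 (union_map b') h) \<longleftrightarrow>
        cube_homotopic n M c0 (union_map b) h" for h
  proof
    assume "\<exists>b'. (\<forall>r\<in>R. b' r \<in> B r) \<and> cube_homotopic n M c0 (union_map b') h"
    then obtain b' where b': "\<And>r. r \<in> R \<Longrightarrow> cube_homotopic (n + m r) Y y0 (b r) (b' r)"
      and h: "cube_homotopic n M c0 (union_map b') h"
      using B by (auto simp: homotopy_class_def)
    show "cube_homotopic n M c0 (union_map b) h"
      by (rule cube_homotopic_trans [OF union_map_homotopic h]) (rule b')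
  next
    assume "cube_homotopic n M c0 (union_map b) h"
    moreover have "\<forall>r\<in>R. b r \<in> B r"
      using B in_homotopy_class [OF b] by simp
    ultimately show "\<exists>b'. (\<forall>r\<in>R. b' r \<in> B r) \<and> cube_homotopic n M c0 (union_map b') h"
      by blast
  qed
  then show ?thesis
    by (simp add: union_class_def homotopy_class_def)
qed

lemma representatives:
  assumes "\<And>r. r \<in> R \<Longrightarrow> B r \<in> carrier (PY (n + m r))"
  shows "\<exists>b. \<forall>r\<in>R. b r \<in> cube_maps (n + m r) Y y0 \<and> B r = homotopy_class (n + m r) Y y0 (b r)"
  using assms unfolding carrier_homotopy_group by (intro bchoice) blast

lemma union_class_in_PM:
  assumes "\<And>r. r \<in> R \<Longrightarrow> B r \<in> carrier (PY (n + m r))"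
  shows "union_class B \<in> carrier PM"
proof -
  obtain b where b: "\<And>r. r \<in> R \<Longrightarrow> b r \<in> cube_maps (n + m r) Y y0"
    "\<And>r. r \<in> R \<Longrightarrow> B r = homotopy_class (n + m r) Y y0 (b r)"
    using representatives [OF assms] by metis
  then show ?thesis
    using union_class_class [OF b] union_map_in_cube_maps [of b] by (simp add: carrier_homotopy_group)
qed

text \<open>Concatenation acts on coordinate 0, which belongs to s, so the union of concatenations
  is literally the concatenation of unions. The product is given by an equation on \<open>R\<close>,
  so that restricted families and quotients can be inserted.\<close>

lemma union_class_mult:
  assumes B: "\<And>r. r \<in> R \<Longrightarrow> B r \<in> carrier (PY (n + m r))"
    and B': "\<And>r. r \<in> R \<Longrightarrow> B' r \<in> carrier (PY (n + m r))"
    and BB': "\<And>r. r \<in> R \<Longrightarrow> BB' r = B r \<otimes>\<^bsub>PY (n + m r)\<^esub> B' r"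
  shows "union_class BB' = union_class B \<otimes>\<^bsub>PM\<^esub> union_class B'"
proof -
  obtain b where b: "\<And>r. r \<in> R \<Longrightarrow> b r \<in> cube_maps (n + m r) Y y0"
    "\<And>r. r \<in> R \<Longrightarrow> B r = homotopy_class (n + m r) Y y0 (b r)"
    using representatives [OF B] by metis
  obtain b' where b': "\<And>r. r \<in> R \<Longrightarrow> b' r \<in> cube_maps (n + m r) Y y0"
    "\<And>r. r \<in> R \<Longrightarrow> B' r = homotopy_class (n + m r) Y y0 (b' r)"
    using representatives [OF B'] by metis
  have cc: "cube_concat (b r) (b' r) \<in> cube_maps (n + m r) Y y0" if "r \<in> R" for r
    using cube_concat_in_cube_maps [OF b(1) [OF that] b'(1) [OF that]] n_pos by simp
  have *: "BB' r = homotopy_class (n + m r) Y y0 (cube_concat (b r) (b' r))" if r: "r \<in> R" for r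
    using mult_homotopy_group [OF b(1) [OF r] b'(1) [OF r]] BB' [OF r] b(2) [OF r] b'(2) [OF r] n_pos by simp
  have "union_map (\<lambda>r. cube_concat (b r) (b' r)) = cube_concat (union_map b) (union_map b')"
    using n_pos
    by (auto simp: fun_eq_iff union_map_def cube_concat_def glue_def cube_join_at_0 cube_join_upd restrict_def)
  then show ?thesis
    using union_class_class [OF cc *] union_class_class [OF b] union_class_class [OF b']
      union_map_in_cube_maps [of b] union_map_in_cube_maps [of b'] b b' mult_PM by simp
qed

lemma eval_union:
  assumes "\<And>r. r \<in> R \<Longrightarrow> B r \<in> carrier (PY (n + m r))"
  shows "eval_map (union_class B) = \<one>\<^bsub>PY n\<^esub>"
proof -
  obtain b where b: "\<And>r. r \<in> R \<Longrightarrow> b r \<in> cube_maps (n + m r) Y y0"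
    "\<And>r. r \<in> R \<Longrightarrow> B r = homotopy_class (n + m r) Y y0 (b r)"
    using representatives [OF assms] by metis
  have "cube_homotopic n Y y0 (\<lambda>s. y0) (\<lambda>s. union_map b s w0)"
    by (intro cube_homotopic_eq const_in_cube_maps y0) (simp add: union_map_w0 [OF b(1)])
  then show ?thesis
    using union_class_class [OF b] eval_class [OF union_map_in_cube_maps [OF b(1)]] homotopy_class_eq [symmetric]
    by (simp add: one_homotopy_group)
qed

end

text \<open>In coordinate 0 the two concatenations are two paths from (0,0) to (1,1) in the unit
  square: along the bottom and the right edge, D shows f and then g; along the left and the top
  edge, g and then f. The square is convex, so the straight line between the paths is a homotopy.
  The other coordinates of s are fed to both arguments of D.\<close>

lemma cube_homotopic_commute:
  assumes D: "continuous_map (prod_topology (cube n) (cube n)) Z D" and n: "0 < n"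
    and f: "f \<in> cube_maps n Z z"
    and Df: "\<And>s s'. s \<in> topspace (cube n) \<Longrightarrow> s' \<in> cube_boundary n \<Longrightarrow> D (s, s') = f s"
    and Dg: "\<And>s s'. s \<in> cube_boundary n \<Longrightarrow> s' \<in> topspace (cube n) \<Longrightarrow> D (s, s') = g s'"
  shows "cube_homotopic n Z z (cube_concat f g) (cube_concat g f)"
proof -
  let ?a = "\<lambda>s::nat \<Rightarrow> real. min 1 (2 * s 0)" and ?b = "\<lambda>s::nat \<Rightarrow> real. max 0 (2 * s 0 - 1)"
  let ?u = "\<lambda>p. (1 - fst p) * ?a (snd p) + fst p * ?b (snd p)"
  let ?v = "\<lambda>p. (1 - fst p) * ?b (snd p) + fst p * ?a (snd p)"
  let ?P = "prod_topology UI (cube n)"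
  have s01: "0 \<le> s 0" "s 0 \<le> 1" if "s \<in> topspace (cube n)" for s
    using that n by (auto simp: in_topspace_cube)
  have conv: "0 \<le> (1 - t) * a + t * b \<and> (1 - t) * a + t * b \<le> 1"
    if "0 \<le> t" "t \<le> 1" "0 \<le> a" "a \<le> 1" "0 \<le> b" "b \<le> 1" for t a b :: real
  proof -
    have "(1 - t) * a + t * b \<le> (1 - t) * 1 + t * 1"
      by (intro add_mono mult_left_mono) (use that in auto)
    moreover have "0 \<le> (1 - t) * a + t * b"
      using that by simp
    ultimately show ?thesis
      by simp
  qed
  have uv: "0 \<le> ?u (t, s) \<and> ?u (t, s) \<le> 1" "0 \<le> ?v (t, s) \<and> ?v (t, s) \<le> 1"
    if "0 \<le> t" "t \<le> 1" "s \<in> topspace (cube n)" for t s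
    unfolding fst_conv snd_conv by (rule conv; use that s01 [OF that(3)] in simp)+
  have c0: "continuous_map ?P euclideanreal (\<lambda>p. snd p 0)"
    using continuous_map_cube_coord [OF continuous_map_snd n, of UI] by (simp add: continuous_map_UI_iff)
  have cf: "continuous_map ?P euclideanreal fst"
    using continuous_map_fst [of UI "cube n"] by (simp add: continuous_map_UI_iff)
  have "continuous_map ?P euclideanreal ?u" "continuous_map ?P euclideanreal ?v"
    by (intro continuous_intros c0 cf)+
  then have "continuous_map ?P UI ?u" "continuous_map ?P UI ?v"
    unfolding continuous_map_UI_iff using uv by (auto simp del: max.bounded_iff min.bounded_iff)
  then have "continuous_map ?P (prod_topology (cube n) (cube n)) (\<lambda>p. ((snd p)(0 := ?u p), (snd p)(0 := ?v p)))"
    by (intro continuous_map_pairedI continuous_map_cube_upd continuous_map_snd n)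
  from continuous_map_comp [OF D this]
  have "continuous_map ?P Z (\<lambda>p. D ((snd p)(0 := ?u p), (snd p)(0 := ?v p)))" .
  then show ?thesis
  proof (rule cube_homotopicI)
    fix s assume s: "s \<in> topspace (cube n)"
    have e: "s(0 := 0) \<in> cube_boundary n" "s(0 := 1) \<in> cube_boundary n"
      using s n by (auto intro!: in_cube_boundaryI [of _ n 0] cube_upd)
    have a: "?a s = 2 * s 0" "?b s = 0" if "s 0 \<le> 1/2"
      using that by (simp_all add: min_absorb2 max_absorb1)
    have b: "?a s = 1" "?b s = 2 * s 0 - 1" if "\<not> s 0 \<le> 1/2"
      using that by (simp_all add: min_absorb1 max_absorb2)
    show "D ((snd (0, s))(0 := ?u (0, s)), (snd (0, s))(0 := ?v (0, s))) = cube_concat f g s"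
      using a b Df [OF cube_upd [OF s n] e(1)] Dg [OF e(2) cube_upd [OF s n]] s01 [OF s]
      by (cases "s 0 \<le> 1/2") (simp_all add: cube_concat_def)
    show "D ((snd (1, s))(0 := ?u (1, s)), (snd (1, s))(0 := ?v (1, s))) = cube_concat g f s"
      using a b Df [OF cube_upd [OF s n] e(2)] Dg [OF e(1) cube_upd [OF s n]] s01 [OF s]
      by (cases "s 0 \<le> 1/2") (simp_all add: cube_concat_def)
  next
    fix t :: real and s assume t: "t \<in> {0..1}" and s: "s \<in> cube_boundary n"
    have sc: "s \<in> topspace (cube n)"
      using s cube_boundary_subset by auto
    \<comment> \<open>At \<open>s 0 = 0\<close> both paths are at (0,0) and at
      \<open>s 0 = 1\<close> both are at (1,1), so the straight line does not leave these
      corners.\<close>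
    have e: "?u (t, s) = 0 \<or> ?u (t, s) = 1" "?v (t, s) = 0 \<or> ?v (t, s) = 1" if "s 0 = 0 \<or> s 0 = 1"
      using that by auto
    have t': "0 \<le> t" "t \<le> 1"
      using t by auto
    have "s(0 := ?u (t, s)) \<in> cube_boundary n" "s(0 := ?v (t, s)) \<in> cube_boundary n"
      using uv [OF t' sc] e by (blast intro: cube_upd_boundary [OF s n])+
    then have "D (s(0 := ?u (t, s)), s(0 := ?v (t, s))) = f (s(0 := ?u (t, s)))" "f (s(0 := ?u (t, s))) = z"
      using f subsetD [OF cube_boundary_subset] by (blast intro: Df, simp add: cube_maps_def)
    then show "D ((snd (t, s))(0 := ?u (t, s)), (snd (t, s))(0 := ?v (t, s))) = z"
      by simp
  qed
qed

context wedge_mapping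
begin

text \<open>
  A nullhomotopy of the union moves the wedge point along a loop $L$ of maps. Expanding the cubes and
  retracing $L$ on the collar makes it a homotopy relative to the boundary, ending in a map that
  factors through the radius and contracts along $L$.
\<close>

lemma union_map_null_imp:
  assumes b: "\<And>r. r \<in> R \<Longrightarrow> b r \<in> cube_maps (n + m r) Y y0"
    and null: "cube_homotopic n M c0 (union_map b) (\<lambda>s. c0)" and r: "r \<in> R"
  shows "cube_homotopic (n + m r) Y y0 (b r) (\<lambda>s. y0)"
proof -
  obtain h where h: "continuous_map (prod_topology UI (cube n)) M h"
    and h0: "\<And>s. s \<in> topspace (cube n) \<Longrightarrow> h (0, s) = union_map b s"
    and h1: "\<And>s. s \<in> topspace (cube n) \<Longrightarrow> h (1, s) = c0"
    and hb: "\<And>t s. t \<in> {0..1} \<Longrightarrow> s \<in> cube_boundary n \<Longrightarrow> h (t, s) = c0"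
    using null unfolding cube_homotopic_iff by blast
  have hc: "continuous_map T Y (\<lambda>t. h (u t, s t) (w t))"
    if "continuous_map T UI u" "continuous_map T (cube n) s" "continuous_map T X w" for T :: "(real \<times> (nat \<Rightarrow> real)) topology" and u s w
  proof -
    have "continuous_map T (prod_topology (prod_topology UI (cube n)) X) (\<lambda>t. ((u t, s t), w t))"
      using that by (intro continuous_map_pairedI)
    from continuous_map_comp [OF continuous_map_null_component_apply [OF h locally_compact_X Hausdorff_X] this]
    show ?thesis
      by simp
  qed
  let ?m = "m r"
  have mp: "0 < ?m"
    using m_pos r .
  let ?P = "prod_topology UI (cube (n + ?m))"
  let ?s = "cube_left n" and ?x = "cube_right n ?m"
  have cs: "continuous_map ?P (cube n) (\<lambda>p. ?s (snd p))" and cx: "continuous_map ?P (cube ?m) (\<lambda>p. ?x (snd p))"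
    and cu: "continuous_map ?P UI fst"
    by (rule continuous_map_cube_left [OF continuous_map_snd] continuous_map_cube_right [OF continuous_map_snd]
        continuous_map_fst)+
  have c1: "continuous_map ?P UI (\<lambda>p. 1)"
    by (simp add: continuous_map_UI_iff)
  have in_s: "?s z \<in> topspace (cube n)" and in_x: "?x z \<in> topspace (cube ?m)"
    if "z \<in> topspace (cube (n + ?m))" for z
    using that by (simp_all add: cube_left_in_cube cube_right_in_cube)
  \<comment> \<open>At stage u the stretched cell shows h at time u. On the collar the wedge
    coordinate is already \<open>w0\<close>, and the clock runs back from u to 0, which it reaches
    on the cell boundary; there h starts from the union, whose value at \<open>w0\<close> is
    \<open>y0\<close>.\<close>
  let ?K = "\<lambda>p. h (fst p - cube_excess ?m (fst p) (?x (snd p)), ?s (snd p))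
      (\<kappa> r (cube_expand ?m (fst p) (?x (snd p))))"
  \<comment> \<open>The end of \<open>?K\<close>: h at time 1 is constant, so the stretched cell may
    be replaced by \<open>w0\<close> throughout, and x enters only through the clock. Scaling the
    time down to 0 then contracts the map to \<open>y0\<close>.\<close>
  let ?L = "\<lambda>p. h ((1 - fst p) * (1 - cube_excess ?m 1 (?x (snd p))), ?s (snd p)) w0"
  have ex: "0 \<le> cube_excess ?m u (?x z)" "cube_excess ?m u (?x z) \<le> u"
    if "0 \<le> u" "z \<in> topspace (cube (n + ?m))" for u z
    using cube_excess_bounds [OF mp in_x] that by auto
  have X0: "w0 \<in> topspace X"
    by (rule w0_in_X)
  have in_X: "\<kappa> r (cube_expand ?m u x) \<in> topspace X" for u x
    using \<kappa>_in_X [OF r cube_expand_in_cube] .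
  have start: "h (0, ?s z) w0 = y0" if "z \<in> topspace (cube (n + ?m))" for z
    using h0 [OF in_s [OF that]] union_map_w0 [OF b in_s [OF that]] by simp
  have K: "cube_homotopic (n + ?m) Y y0 (b r) (\<lambda>z. ?L (0, z))"
  proof (rule cube_homotopicI [where h = ?K])
    have "continuous_map ?P UI (\<lambda>p. cube_excess ?m (fst p) (?x (snd p)))"
      by (intro continuous_map_cube_excess cu cx mp)
    then have "continuous_map ?P UI (\<lambda>p. fst p - cube_excess ?m (fst p) (?x (snd p)))"
      using cu ex unfolding continuous_map_UI_iff
      by (auto intro!: continuous_intros)
         (smt (verit, best) ex(1))
    moreover have "continuous_map ?P X (\<lambda>p. \<kappa> r (cube_expand ?m (fst p) (?x (snd p))))"
      by (intro continuous_map_comp [OF continuous_\<kappa> [OF r]] continuous_map_cube_expand cu cx)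
    ultimately show "continuous_map ?P Y ?K"
      by (intro hc cs)
    show "?K (0, z) = b r z" if z: "z \<in> topspace (cube (n + ?m))" for z
      using h0 [OF in_s [OF z]] union_map_\<kappa> [OF b in_s [OF z] r in_x [OF z]] z
      by (simp add: cube_excess_0 mp in_x cube_expand_0 cube_join_left_right)
    show "?K (1, z) = ?L (0, z)" if z: "z \<in> topspace (cube (n + ?m))" for z
    \<comment> \<open>With zero excess both sides are values of the constant map at time 1;
      otherwise the stretched point is \<open>w0\<close>.\<close>
    proof (cases "cube_excess ?m 1 (?x z) = 0")
      case True
      then show ?thesis
        using h1 [OF in_s [OF z]] X0 in_X by (simp add: c0_at)
    next
      case False
      then show ?thesis
        using \<kappa>_at_boundary [OF r cube_expand_boundary_excess [OF mp False]] by simp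
    qed
    show "?K (u, z) = y0" if u: "u \<in> {0..1}" and z: "z \<in> cube_boundary (n + ?m)" for u z
    proof -
      have zc: "z \<in> topspace (cube (n + ?m))"
        using z cube_boundary_subset by blast
      consider "?s z \<in> cube_boundary n" | "?x z \<in> cube_boundary ?m"
        using cube_boundary_split [OF z] by blast
      then show ?thesis
      proof cases
        case 1
        have "u - cube_excess ?m u (?x z) \<in> {0..1}"
          using ex [of u z] u zc by auto
        then show ?thesis
          using hb [OF _ 1] in_X by (simp add: c0_at)
      next
        case 2
        then show ?thesis
          using cube_excess_boundary [OF mp 2, of u] u \<kappa>_at_boundary [OF r] start [OF zc] by simp
      qed
    qed
  qed
  have "cube_homotopic (n + ?m) Y y0 (\<lambda>z. ?L (0, z)) (\<lambda>z. y0)"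
  proof (rule cube_homotopicI [where h = ?L])
    have "continuous_map ?P UI (\<lambda>p. cube_excess ?m 1 (?x (snd p)))"
      by (intro continuous_map_cube_excess c1 cx mp)
    then have "continuous_map ?P euclideanreal (\<lambda>p. (1 - fst p) * (1 - cube_excess ?m 1 (?x (snd p))))"
      using cu unfolding continuous_map_UI_iff by (intro continuous_intros) auto
    moreover have "0 \<le> (1 - u) * (1 - cube_excess ?m 1 (?x z)) \<and> (1 - u) * (1 - cube_excess ?m 1 (?x z)) \<le> 1"
      if "0 \<le> u" "u \<le> 1" "z \<in> topspace (cube (n + ?m))" for u z
      using ex [of 1 z] that by (auto intro: mult_le_one)
    ultimately have "continuous_map ?P UI (\<lambda>p. (1 - fst p) * (1 - cube_excess ?m 1 (?x (snd p))))"
      unfolding continuous_map_UI_iff by auto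
    then show "continuous_map ?P Y ?L"
      by (intro hc cs continuous_map_const [THEN iffD2] disjI2 X0)
    show "?L (1, z) = y0" if z: "z \<in> topspace (cube (n + ?m))" for z
      using start [OF z] by simp
    show "?L (u, z) = y0" if u: "u \<in> {0..1}" and z: "z \<in> cube_boundary (n + ?m)" for u z
    proof -
      have zc: "z \<in> topspace (cube (n + ?m))"
        using z cube_boundary_subset by blast
      consider "?s z \<in> cube_boundary n" | "?x z \<in> cube_boundary ?m"
        using cube_boundary_split [OF z] by blast
      then show ?thesis
      proof cases
        case 1
        have "(1 - u) * (1 - cube_excess ?m 1 (?x z)) \<in> {0..1}"
          using ex [of 1 z] u zc by (auto intro: mult_le_one)
        then show ?thesis
          using hb [OF _ 1] X0 by (simp add: c0_at)
      next
        case 2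
        then show ?thesis
          using cube_excess_boundary [OF mp 2, of 1] start [OF zc] by simp
      qed
    qed
  qed simp
  with K show ?thesis
    by (rule cube_homotopic_trans)
qed

lemma union_class_eq_one:
  assumes "\<And>r. r \<in> R \<Longrightarrow> B r \<in> carrier (PY (n + m r))" "union_class B = \<one>\<^bsub>PM\<^esub>" "r \<in> R"
  shows "B r = \<one>\<^bsub>PY (n + m r)\<^esub>"
proof -
  obtain b where b: "\<And>r. r \<in> R \<Longrightarrow> b r \<in> cube_maps (n + m r) Y y0"
    "\<And>r. r \<in> R \<Longrightarrow> B r = homotopy_class (n + m r) Y y0 (b r)"
    using representatives [OF assms(1)] by metis
  have "homotopy_class n M c0 (union_map b) = homotopy_class n M c0 (\<lambda>s. c0)"
    using union_class_class [OF b] assms(2) by (simp add: one_homotopy_group)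
  then have "cube_homotopic n M c0 (union_map b) (\<lambda>s. c0)"
    using homotopy_class_eq_iff [OF union_map_in_cube_maps [OF b(1)]] by simp
  from homotopy_class_eq [OF union_map_null_imp [OF b(1) this assms(3)]] show ?thesis
    using b(2) [OF assms(3)] by (simp add: one_homotopy_group)
qed

subsection \<open>Gottlieb elements\<close>

lemma carrier_GM:
  "carrier GM = {homotopy_class n M c0 (\<lambda>s. \<lambda>x\<in>topspace X. \<Psi> ((s, y0), x)) |\<Psi>. gottlieb_family n X Y \<Psi>}"
  by (rule carrier_gottlieb_group_null_component
      [OF locally_compact_X Hausdorff_X Y_lc Y_Hausdorff Y_conn y0 n_pos])

lemma carrier_GY:
  "0 < j \<Longrightarrow> carrier (GY j) = {homotopy_class j Y y0 (\<lambda>s. \<Phi> (s, y0)) |\<Phi>. gottlieb_ext j Y \<Phi>}"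
  by (rule carrier_gottlieb_group_ext [OF Y_lc Y_Hausdorff y0])

lemma GM_subgroup: "subgroup (carrier GM) PM"
  by (rule subgroup_gottlieb_group [OF c0_in_M n_pos])

lemma GY_subgroup: "0 < j \<Longrightarrow> subgroup (carrier (GY j)) (PY j)"
  by (rule subgroup_gottlieb_group [OF y0])

lemma GY_in_PY: "0 < j \<Longrightarrow> A \<in> carrier (GY j) \<Longrightarrow> A \<in> carrier (PY j)"
  using GY_subgroup subgroup.subset by blast

lemma section_in_GM:
  assumes "A \<in> carrier (GY n)"
  shows "section_map A \<in> carrier GM"
proof -
  obtain \<Phi> where \<Phi>: "gottlieb_ext n Y \<Phi>" "A = homotopy_class n Y y0 (\<lambda>s. \<Phi> (s, y0))"
    using assms carrier_GY [OF n_pos] by blast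
  have "gottlieb_family n X Y (\<lambda>p. \<Phi> (fst p))"
    using \<Phi>(1) by (auto simp: gottlieb_family_def gottlieb_ext_def intro: continuous_map_comp [OF _ continuous_map_fst])
  moreover have "section_map A = homotopy_class n M c0 (\<lambda>s. \<lambda>x\<in>topspace X. \<Phi> (fst ((s, y0), x)))"
    using section_class [OF gottlieb_ext_in_cube_maps [OF \<Phi>(1) y0]] \<Phi>(2) by (simp add: const_map_def o_def)
  ultimately show ?thesis
    unfolding carrier_GM by (intro CollectI exI [of _ "\<lambda>p. \<Phi> (fst p)"] conjI)
qed

text \<open>Each extension is the projection to Y over the boundary of its cube, so on the cell
  boundaries all of them agree for every y and not only for \<open>y0\<close>. Hence they glue to a
  family over the wedge.\<close>

lemma union_in_GM:
  assumes B: "\<And>r. r \<in> R \<Longrightarrow> B r \<in> carrier (GY (n + m r))"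
  shows "union_class B \<in> carrier GM"
proof -
  have "\<forall>r\<in>R. \<exists>\<Phi>. gottlieb_ext (n + m r) Y \<Phi> \<and> B r = homotopy_class (n + m r) Y y0 (\<lambda>s. \<Phi> (s, y0))"
  proof
    fix r assume "r \<in> R"
    then have "B r \<in> {homotopy_class (n + m r) Y y0 (\<lambda>s. \<Phi> (s, y0)) |\<Phi>. gottlieb_ext (n + m r) Y \<Phi>}"
      using B [of r] carrier_GY [of "n + m r"] n_pos by simp
    then show "\<exists>\<Phi>. gottlieb_ext (n + m r) Y \<Phi> \<and> B r = homotopy_class (n + m r) Y y0 (\<lambda>s. \<Phi> (s, y0))"
      by blast
  qed
  from bchoice [OF this] obtain \<Phi> where
    \<Phi>': "\<forall>r\<in>R. gottlieb_ext (n + m r) Y (\<Phi> r) \<and> B r = homotopy_class (n + m r) Y y0 (\<lambda>s. \<Phi> r (s, y0))" ..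
  then have \<Phi>: "\<And>r. r \<in> R \<Longrightarrow> gottlieb_ext (n + m r) Y (\<Phi> r)"
    "\<And>r. r \<in> R \<Longrightarrow> B r = homotopy_class (n + m r) Y y0 (\<lambda>s. \<Phi> r (s, y0))"
    by simp_all
  let ?g = "\<lambda>q r x. \<Phi> r (cube_join n (m r) (fst q) x, snd q)"
  let ?\<Psi> = "\<lambda>p. glue ?g (fst p) (snd p)"
  have g0: "?g q r x = snd q"
    if "q \<in> topspace (prod_topology (cube n) Y)" "r \<in> R" "x \<in> topspace (cube (m r))"
      "fst q \<in> cube_boundary n \<or> x \<in> cube_boundary (m r)" for q r x
    using \<Phi>(1) [OF that(2)] cube_join_boundary [of "fst q" n x "m r"] that
    by (auto simp: gottlieb_ext_def mem_Times_iff)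
  have g1: "?g q r x = ?g q r' x'"
    if "q \<in> topspace (prod_topology (cube n) Y)" "r \<in> R" "r' \<in> R"
      "x \<in> cube_boundary (m r)" "x' \<in> cube_boundary (m r')" for q r r' x x'
  proof -
    have "x \<in> topspace (cube (m r))" "x' \<in> topspace (cube (m r'))"
      using that(4,5) cube_boundary_subset by auto
    then show ?thesis
      using g0 [of q r x] g0 [of q r' x'] that by simp
  qed
  have "continuous_map (prod_topology (prod_topology (cube n) Y) X) Y ?\<Psi>"
  proof (rule continuous_map_glue)
    fix r assume r: "r \<in> R"
    let ?T = "prod_topology (prod_topology (cube n) Y) (cube (m r))"
    have "continuous_map ?T (prod_topology (cube (n + m r)) Y) (\<lambda>p. (cube_join n (m r) (fst (fst p)) (snd p), snd (fst p)))"
      by (intro continuous_map_pairedI continuous_map_cube_join continuous_map_snd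
          continuous_map_comp [OF continuous_map_fst continuous_map_fst] continuous_map_comp [OF continuous_map_snd continuous_map_fst])
    then show "continuous_map ?T Y (\<lambda>p. ?g (fst p) r (snd p))"
      using continuous_map_comp [of _ Y "\<Phi> r"] \<Phi>(1) [OF r] unfolding gottlieb_ext_def by blast
  qed (rule g1)
  moreover have "?\<Psi> ((s, y), w) = y"
    if s: "s \<in> cube_boundary n" and y: "y \<in> topspace Y" and w: "w \<in> topspace X" for s y w
  proof -
    obtain r x where rx: "r \<in> R" "x \<in> topspace (cube (m r))" "w = \<kappa> r x"
      using w \<kappa>_cover by auto
    have q: "(s, y) \<in> topspace (prod_topology (cube n) Y)"
      using s y cube_boundary_subset by auto
    show ?thesis
      using glue_\<kappa> [of ?g "(s, y)" r x, OF g1 [OF q] rx(1,2)] g0 [OF q rx(1,2)] s rx(3) by simp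
  qed
  ultimately have "gottlieb_family n X Y ?\<Psi>"
    by (simp add: gottlieb_family_def)
  moreover have "union_class B = homotopy_class n M c0 (\<lambda>s. \<lambda>x\<in>topspace X. ?\<Psi> ((s, y0), x))"
    using union_class_class [OF gottlieb_ext_in_cube_maps [OF \<Phi>(1) y0] \<Phi>(2)]
    by (simp add: union_map_def [abs_def] glue_def [abs_def])
  ultimately show ?thesis
    unfolding carrier_GM by (intro CollectI exI [of _ ?\<Psi>] conjI)
qed

text \<open>For \<open>n = 1\<close> the ambient group \<open>PM\<close> may be noncommutative; this
  relation lets a constant family pass a union, which makes the product map of the final isomorphism
  a homomorphism.\<close>

lemma GM_commute:
  assumes "A \<in> carrier GM" "B \<in> carrier GM"
  shows "A \<otimes>\<^bsub>PM\<^esub> B = B \<otimes>\<^bsub>PM\<^esub> A"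
proof -
  obtain \<Psi> where \<Psi>: "gottlieb_family n X Y \<Psi>"
    and A: "A = homotopy_class n M c0 (\<lambda>s. \<lambda>x\<in>topspace X. \<Psi> ((s, y0), x))"
    using assms(1) unfolding carrier_GM by blast
  obtain \<Psi>' where \<Psi>': "gottlieb_family n X Y \<Psi>'"
    and B: "B = homotopy_class n M c0 (\<lambda>s. \<lambda>x\<in>topspace X. \<Psi>' ((s, y0), x))"
    using assms(2) unfolding carrier_GM by blast
  have c: "continuous_map (prod_topology (prod_topology (cube n) Y) X) Y \<Psi>"
    "continuous_map (prod_topology (prod_topology (cube n) Y) X) Y \<Psi>'"
    and bd: "\<And>s y x. s \<in> cube_boundary n \<Longrightarrow> y \<in> topspace Y \<Longrightarrow> x \<in> topspace X \<Longrightarrow> \<Psi> ((s, y), x) = y"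
    "\<And>s y x. s \<in> cube_boundary n \<Longrightarrow> y \<in> topspace Y \<Longrightarrow> x \<in> topspace X \<Longrightarrow> \<Psi>' ((s, y), x) = y"
    using \<Psi> \<Psi>' by (auto simp: gottlieb_family_def)
  let ?f = "\<lambda>s. \<lambda>x\<in>topspace X. \<Psi> ((s, y0), x)" and ?g = "\<lambda>s. \<lambda>x\<in>topspace X. \<Psi>' ((s, y0), x)"
  have fg: "?f \<in> cube_maps n M c0" "?g \<in> cube_maps n M c0"
    using gottlieb_family_in_cube_maps [OF \<Psi> y0 n_pos] gottlieb_family_in_cube_maps [OF \<Psi>' y0 n_pos] by auto
  let ?T = "prod_topology (cube n) (cube n)"
  \<comment> \<open>Two independent parameters: on the boundary of the second the inner family
    returns \<open>y0\<close>, on the boundary of the first the outer family returns its argument.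
    These are the two axes that \<open>cube_homotopic_commute\<close> asks for.\<close>
  let ?d = "\<lambda>q x. \<Psi> ((fst q, \<Psi>' ((snd q, y0), x)), x)"
  let ?s0 = "\<lambda>j\<in>{..<n}. 0::real"
  have s0: "?s0 \<in> cube_boundary n" "?s0 \<in> topspace (cube n)"
    using cube_boundary_nonempty [OF n_pos] cube_boundary_subset by auto
  have "continuous_map (prod_topology ?T X) (prod_topology (prod_topology (cube n) Y) X) (\<lambda>p. ((snd (fst p), y0), snd p))"
    using y0 by (intro continuous_map_pairedI continuous_map_snd continuous_map_comp [OF continuous_map_snd continuous_map_fst]) simp
  from continuous_map_comp [OF c(2) this]
  have "continuous_map (prod_topology ?T X) (prod_topology (prod_topology (cube n) Y) X)
      (\<lambda>p. ((fst (fst p), \<Psi>' ((snd (fst p), y0), snd p)), snd p))"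
    by (intro continuous_map_pairedI continuous_map_snd continuous_map_comp [OF continuous_map_fst continuous_map_fst])
  from continuous_map_comp [OF c(1) this]
  have "continuous_map (prod_topology ?T X) Y (\<lambda>p. ?d (fst p) (snd p))"
    by simp
  moreover have "path_connected_space ?T"
    by (simp add: path_connected_space_prod_topology path_connected_space_cube)
  moreover have "?d (?s0, ?s0) x = y0" if "x \<in> topspace X" for x
    using that bd s0(1) y0 by (simp del: restrict_apply)
  ultimately have D: "continuous_map ?T M (\<lambda>q. \<lambda>x\<in>topspace X. ?d q x)"
    using s0 y0 by (intro continuous_map_into_null_component [where t = "(?s0, ?s0)"]) (auto simp del: restrict_apply)
  have in_Y: "\<Psi>' ((s, y0), x) \<in> topspace Y" if "s \<in> topspace (cube n)" "x \<in> topspace X" for s x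
    using continuous_map_funspace [OF c(2)] that y0 by auto
  have "cube_homotopic n M c0 (cube_concat ?f ?g) (cube_concat ?g ?f)"
  proof (rule cube_homotopic_commute [OF D n_pos fg(1)])
    show "(\<lambda>x\<in>topspace X. ?d (s, s') x) = ?f s" if "s \<in> topspace (cube n)" "s' \<in> cube_boundary n" for s s'
      by (rule restrict_ext) (use that bd y0 in simp)
    show "(\<lambda>x\<in>topspace X. ?d (s, s') x) = ?g s'" if "s \<in> cube_boundary n" "s' \<in> topspace (cube n)" for s s'
      by (rule restrict_ext) (use that bd in_Y in simp)
  qed
  then show ?thesis
    unfolding A B mult_PM [OF fg] mult_PM [OF fg(2,1)] by (rule homotopy_class_eq)
qed

end

lemma (in group) mult_interchange:
  assumes "a \<in> carrier G" "a' \<in> carrier G" "b \<in> carrier G" "b' \<in> carrier G" "a' \<otimes> b = b \<otimes> a'"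
  shows "(a \<otimes> a') \<otimes> (b \<otimes> b') = (a \<otimes> b) \<otimes> (a' \<otimes> b')"
proof -
  have "a' \<otimes> (b \<otimes> b') = b \<otimes> (a' \<otimes> b')"
    using assms by (simp add: m_assoc [symmetric])
  then show ?thesis
    using assms by (simp add: m_assoc)
qed

context wedge_mapping
begin

subsection \<open>The decomposition\<close>

text \<open>
  In \<open>s 0\<close> this runs the family over \<open>w0\<close> backwards and then \<open>\<Psi>\<close> itself. On the collar, where the expanded
  cube leaves the unit cube, the point of the wedge is \<open>w0\<close> and the parameter \<open>s\<close> is pushed to the
  boundary, where the family is the identity.
\<close>

definition collar ::
  "(((nat \<Rightarrow> real) \<times> 'y) \<times> 'x \<Rightarrow> 'y) \<Rightarrow> 'r \<Rightarrow> real \<Rightarrow> (nat \<Rightarrow> real) \<Rightarrow> 'y \<Rightarrow> (nat \<Rightarrow> real) \<Rightarrow> 'y" where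
  "collar \<Psi> r v s y x =
     \<Psi> ((s(0 := (1 - cube_excess (m r) v x) * \<bar>1 - 2 * s 0\<bar> + cube_excess (m r) v x), y),
        if s 0 \<le> 1/2 then w0 else \<kappa> r (cube_expand (m r) v x))"

lemma collar_param_bounds:
  assumes "r \<in> R" "x \<in> topspace (cube (m r))" "0 \<le> v" "v \<le> 1" "s \<in> topspace (cube n)"
  shows "0 \<le> (1 - cube_excess (m r) v x) * \<bar>1 - 2 * s 0\<bar> + cube_excess (m r) v x"
    "(1 - cube_excess (m r) v x) * \<bar>1 - 2 * s 0\<bar> + cube_excess (m r) v x \<le> 1"
proof -
  have e: "0 \<le> cube_excess (m r) v x" "cube_excess (m r) v x \<le> 1"
    using cube_excess_bounds [OF m_pos [OF assms(1)] assms(2,3)] assms(4) by auto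
  have "0 \<le> s 0" "s 0 \<le> 1"
    using assms(5) n_pos by (auto simp: in_topspace_cube)
  then have "\<bar>1 - 2 * s 0\<bar> \<le> 1"
    by auto
  then have "(1 - cube_excess (m r) v x) * \<bar>1 - 2 * s 0\<bar> \<le> (1 - cube_excess (m r) v x) * 1"
    using e by (intro mult_left_mono) auto
  then show "(1 - cube_excess (m r) v x) * \<bar>1 - 2 * s 0\<bar> + cube_excess (m r) v x \<le> 1"
    by simp
  show "0 \<le> (1 - cube_excess (m r) v x) * \<bar>1 - 2 * s 0\<bar> + cube_excess (m r) v x"
    using e by simp
qed

text \<open>The branches must meet at \<open>s 0 = 1/2\<close>, for either of two reasons. With zero
  excess the new coordinate 0 is 0, so the parameter is on the boundary and \<Psi> ignores the point
  of the wedge; with positive excess the stretched point is \<open>w0\<close> in both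
  branches.\<close>

lemma continuous_map_collar:
  assumes \<Psi>: "gottlieb_family n X Y \<Psi>" and r: "r \<in> R"
    and v: "continuous_map T UI v" and s: "continuous_map T (cube n) s"
    and y: "continuous_map T Y y" and x: "continuous_map T (cube (m r)) x"
  shows "continuous_map T Y (\<lambda>t. collar \<Psi> r (v t) (s t) (y t) (x t))"
proof -
  let ?e = "\<lambda>t. cube_excess (m r) (v t) (x t)"
  let ?a = "\<lambda>t. (1 - ?e t) * \<bar>1 - 2 * s t 0\<bar> + ?e t"
  let ?s = "\<lambda>t. (s t)(0 := ?a t)"
  have in_T: "v t \<in> {0..1}" "s t \<in> topspace (cube n)" "x t \<in> topspace (cube (m r))" "y t \<in> topspace Y"
    if "t \<in> topspace T" for t
    using that continuous_map_funspace [OF v] continuous_map_funspace [OF s] continuous_map_funspace [OF x]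
      continuous_map_funspace [OF y] by auto
  have c0: "continuous_map T euclideanreal (\<lambda>t. s t 0)"
    using continuous_map_cube_coord [OF s n_pos] by (simp add: continuous_map_UI_iff)
  have "continuous_map T euclideanreal ?e"
    using continuous_map_cube_excess [OF v x m_pos [OF r]] by (simp add: continuous_map_UI_iff)
  then have "continuous_map T euclideanreal ?a"
    by (intro continuous_intros c0)
  then have "continuous_map T UI ?a"
    unfolding continuous_map_UI_iff using collar_param_bounds [OF r] in_T by auto
  then have cs: "continuous_map T (cube n) ?s"
    by (intro continuous_map_cube_upd s n_pos)
  have c\<Psi>: "continuous_map (prod_topology (prod_topology (cube n) Y) X) Y \<Psi>"
    and bd: "\<And>s y x. s \<in> cube_boundary n \<Longrightarrow> y \<in> topspace Y \<Longrightarrow> x \<in> topspace X \<Longrightarrow> \<Psi> ((s, y), x) = y"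
    using \<Psi> by (auto simp: gottlieb_family_def)
  have in_X: "\<kappa> r (cube_expand (m r) u z) \<in> topspace X" for u z
    using \<kappa>_in_X [OF r cube_expand_in_cube] .
  have 1: "continuous_map T Y (\<lambda>t. \<Psi> ((?s t, y t), w0))"
    by (intro continuous_map_comp [OF c\<Psi>] continuous_map_pairedI cs y
        continuous_map_const [THEN iffD2] disjI2 w0_in_X)
  have 2: "continuous_map T Y (\<lambda>t. \<Psi> ((?s t, y t), \<kappa> r (cube_expand (m r) (v t) (x t))))"
    by (intro continuous_map_comp [OF c\<Psi>] continuous_map_pairedI cs y
        continuous_map_comp [OF continuous_\<kappa> [OF r]] continuous_map_cube_expand v x)
  have "continuous_map T Y (\<lambda>t. if s t 0 \<le> 1/2 then \<Psi> ((?s t, y t), w0)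
      else \<Psi> ((?s t, y t), \<kappa> r (cube_expand (m r) (v t) (x t))))"
  proof (rule continuous_map_cases_le [OF c0])
    fix t assume t: "t \<in> topspace T" and half: "s t 0 = 1/2"
    show "\<Psi> ((?s t, y t), w0) = \<Psi> ((?s t, y t), \<kappa> r (cube_expand (m r) (v t) (x t)))"
    proof (cases "?e t = 0")
      case True
      then have "?s t \<in> cube_boundary n"
        using in_T [OF t] n_pos half by (intro in_cube_boundaryI [of _ n 0] cube_upd) auto
      then show ?thesis
        using bd w0_in_X in_X in_T [OF t] by simp
    next
      case False
      then show ?thesis
        using \<kappa>_at_boundary [OF r cube_expand_boundary_excess [OF m_pos [OF r] False]] by simp
    qed
  qed (use 1 2 in \<open>simp_all add: continuous_map_from_subtopology\<close>)
  moreover have "collar \<Psi> r (v t) (s t) (y t) (x t) = (if s t 0 \<le> 1/2 then \<Psi> ((?s t, y t), w0)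
      else \<Psi> ((?s t, y t), \<kappa> r (cube_expand (m r) (v t) (x t))))" for t
    by (simp add: collar_def)
  ultimately show ?thesis
    by simp
qed

lemma collar_boundary:
  assumes \<Psi>: "gottlieb_family n X Y \<Psi>" and r: "r \<in> R"
    and x: "x \<in> topspace (cube (m r))" and v: "0 \<le> v" "v \<le> 1" and y: "y \<in> topspace Y"
    and s: "s \<in> cube_boundary n"
  shows "collar \<Psi> r v s y x = y"
proof -
  let ?a = "(1 - cube_excess (m r) v x) * \<bar>1 - 2 * s 0\<bar> + cube_excess (m r) v x"
  have sc: "s \<in> topspace (cube n)"
    using s cube_boundary_subset by auto
  have "?a = 1" if "s 0 = 0 \<or> s 0 = 1"
    using that by auto
  then have "s(0 := ?a) \<in> cube_boundary n"
    using collar_param_bounds [OF r x v sc] by (intro cube_upd_boundary [OF s n_pos]) auto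
  then show ?thesis
    using \<Psi> y w0_in_X \<kappa>_in_X [OF r cube_expand_in_cube]
    by (auto simp: collar_def gottlieb_family_def)
qed

text \<open>The right-hand side mentions neither r nor x, which is the gluing condition at every
  stage v. At \<open>v = 1\<close> coordinate 0 becomes 1, so the wedge point has come to
  rest.\<close>

lemma collar_at_boundary:
  assumes r: "r \<in> R" and x: "x \<in> cube_boundary (m r)" and v: "0 \<le> v"
  shows "collar \<Psi> r v s y x = \<Psi> ((s(0 := (1 - v) * \<bar>1 - 2 * s 0\<bar> + v), y), w0)"
  using cube_excess_boundary [OF m_pos [OF r] x v] \<kappa>_at_boundary [OF r] by (simp add: collar_def)

text \<open>At stage 1 a point of the cell boundary pushes s onto the face where coordinate 0 is 1,
  and a boundary point s stays on the boundary; in both cases \<Psi> is the projection to Y. Since y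
  is free, the cell split off from \<Psi> is a Gottlieb element and not merely a homotopy
  class.\<close>

lemma gottlieb_ext_collar:
  assumes \<Psi>: "gottlieb_family n X Y \<Psi>" and r: "r \<in> R"
  shows "gottlieb_ext (n + m r) Y
    (\<lambda>p. collar \<Psi> r 1 (cube_left n (fst p)) (snd p) (cube_right n (m r) (fst p)))"
  unfolding gottlieb_ext_def
proof (intro conjI ballI)
  show "continuous_map (prod_topology (cube (n + m r)) Y) Y
      (\<lambda>p. collar \<Psi> r 1 (cube_left n (fst p)) (snd p) (cube_right n (m r) (fst p)))"
    by (intro continuous_map_collar [OF \<Psi> r] continuous_map_snd
        continuous_map_cube_left [OF continuous_map_fst] continuous_map_cube_right [OF continuous_map_fst]
        continuous_map_const [THEN iffD2] disjI2) simp
  fix z y assume z: "z \<in> cube_boundary (n + m r)" and y: "y \<in> topspace Y"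
  let ?s = "cube_left n z" and ?x = "cube_right n (m r) z"
  have "z \<in> topspace (cube (n + m r))"
    using z cube_boundary_subset by auto
  then have c: "?s \<in> topspace (cube n)" "?x \<in> topspace (cube (m r))"
    by (simp_all add: cube_left_in_cube cube_right_in_cube)
  have "collar \<Psi> r 1 ?s y ?x = y"
    using cube_boundary_split [OF z]
  proof
    assume "?s \<in> cube_boundary n"
    then show ?thesis
      using collar_boundary [OF \<Psi> r c(2) _ _ y] by simp
  next
    assume x: "?x \<in> cube_boundary (m r)"
    have "?s(0 := 1) \<in> cube_boundary n"
      using c(1) n_pos by (intro in_cube_boundaryI [of _ n 0] cube_upd) auto
    then show ?thesis
      using \<Psi> y w0_in_X by (simp add: collar_at_boundary [OF r x] gottlieb_family_def)
  qed
  then show "collar \<Psi> r 1 (cube_left n (fst (z, y))) (snd (z, y)) (cube_right n (m r) (fst (z, y))) = y"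
    by simp
qed

text \<open>\<open>collar\<close> at \<open>v = 0\<close> is the reversed family over
  \<open>w0\<close> followed by \<Psi>, and at \<open>v = 1\<close> it is a union of cells. So the
  inverse of the constant family times C is a union class, and C is the product.\<close>

lemma GM_decompose:
  assumes "C \<in> carrier GM"
  obtains A B where "A \<in> carrier (GY n)" "\<And>r. r \<in> R \<Longrightarrow> B r \<in> carrier (GY (n + m r))"
    "C = section_map A \<otimes>\<^bsub>PM\<^esub> union_class B"
proof -
  obtain \<Psi> where \<Psi>: "gottlieb_family n X Y \<Psi>"
    and C: "C = homotopy_class n M c0 (\<lambda>s. \<lambda>x\<in>topspace X. \<Psi> ((s, y0), x))"
    using assms unfolding carrier_GM by blast
  have c\<Psi>: "continuous_map (prod_topology (prod_topology (cube n) Y) X) Y \<Psi>"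
    and bd: "\<And>s y x. s \<in> cube_boundary n \<Longrightarrow> y \<in> topspace Y \<Longrightarrow> x \<in> topspace X \<Longrightarrow> \<Psi> ((s, y), x) = y"
    using \<Psi> by (auto simp: gottlieb_family_def)
  define \<phi> where "\<phi> = (\<lambda>s. \<lambda>x\<in>topspace X. \<Psi> ((s, y0), x))"
  have \<phi>: "\<phi> \<in> cube_maps n M c0"
    unfolding \<phi>_def by (rule gottlieb_family_in_cube_maps [OF \<Psi> y0 n_pos])
  \<comment> \<open>The family over the wedge point alone: its class is the component in degree
    n.\<close>
  define \<Phi> where "\<Phi> = (\<lambda>p. \<Psi> (p, w0))"
  have "continuous_map (prod_topology (cube n) Y) (prod_topology (prod_topology (cube n) Y) X) (\<lambda>p. (p, w0))"
    using w0_in_X by (intro continuous_map_pairedI continuous_map_const [THEN iffD2] disjI2) simp_all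
  then have \<Phi>: "gottlieb_ext n Y \<Phi>"
    using continuous_map_comp [OF c\<Psi>] bd w0_in_X by (simp add: gottlieb_ext_def \<Phi>_def)
  define a where "a = (\<lambda>s. \<Phi> (s, y0))"
  have a: "a \<in> cube_maps n Y y0"
    unfolding a_def by (rule gottlieb_ext_in_cube_maps [OF \<Phi> y0])
  define A where "A = homotopy_class n Y y0 a"
  have A: "A \<in> carrier (GY n)"
    using carrier_GY [OF n_pos] \<Phi> by (auto simp: A_def a_def)
  define b where "b = (\<lambda>r z. collar \<Psi> r 1 (cube_left n z) y0 (cube_right n (m r) z))"
  define B where "B = (\<lambda>r. homotopy_class (n + m r) Y y0 (b r))"
  have b: "b r \<in> cube_maps (n + m r) Y y0" if "r \<in> R" for r
    using gottlieb_ext_in_cube_maps [OF gottlieb_ext_collar [OF \<Psi> that] y0] by (simp add: b_def)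
  have B: "B r \<in> carrier (GY (n + m r))" if "r \<in> R" for r
  proof -
    have "B r = homotopy_class (n + m r) Y y0
        (\<lambda>z. (\<lambda>p. collar \<Psi> r 1 (cube_left n (fst p)) (snd p) (cube_right n (m r) (fst p))) (z, y0))"
      by (simp add: B_def b_def)
    moreover have "0 < n + m r"
      using n_pos by simp
    ultimately show ?thesis
      unfolding carrier_GY [OF \<open>0 < n + m r\<close>] using gottlieb_ext_collar [OF \<Psi> that]
      by (intro CollectI exI conjI)
  qed
  have UB: "union_class B = homotopy_class n M c0 (union_map b)"
    by (rule union_class_class [OF b]) (simp_all add: B_def)
  let ?\<alpha> = "const_map X \<circ> cube_rev a"
  have \<alpha>: "?\<alpha> \<in> cube_maps n M c0"
    by (intro section_in_cube_maps cube_rev_in_cube_maps a n_pos)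
  have "cube_homotopic n M c0 (cube_concat ?\<alpha> \<phi>) (union_map b)"
  proof (rule cube_homotopic_glueI [where H = "\<lambda>v s r x. collar \<Psi> r v s y0 x"])
    show "continuous_map (prod_topology (prod_topology UI (cube n)) (cube (m r))) Y
        (\<lambda>p. collar \<Psi> r (fst (fst p)) (snd (fst p)) y0 (snd p))" if r: "r \<in> R" for r
      using y0
      by (intro continuous_map_collar [OF \<Psi> r] continuous_map_snd continuous_map_comp [OF continuous_map_fst continuous_map_fst]
          continuous_map_comp [OF continuous_map_snd continuous_map_fst] continuous_map_const [THEN iffD2] disjI2)
    show "collar \<Psi> r v s y0 x = collar \<Psi> r' v s y0 x'"
      if "v \<in> {0..1}" "r \<in> R" "r' \<in> R" "x \<in> cube_boundary (m r)" "x' \<in> cube_boundary (m r')" for v s r r' x x'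
      using that by (simp add: collar_at_boundary)
    show "collar \<Psi> r v s y0 x = y0"
      if "v \<in> {0..1}" "s \<in> cube_boundary n" "r \<in> R" "x \<in> topspace (cube (m r))" for v s r x
      using that collar_boundary [OF \<Psi>] y0 by simp
    show "collar \<Psi> r 1 s y0 x = union_map b s (\<kappa> r x)"
      if "s \<in> topspace (cube n)" "r \<in> R" "x \<in> topspace (cube (m r))" for s r x
      using union_map_\<kappa> [OF b that] that by (simp add: b_def cube_left_join cube_right_join)
    show "collar \<Psi> r 0 s y0 x = cube_concat ?\<alpha> \<phi> s (\<kappa> r x)"
      if s: "s \<in> topspace (cube n)" and r: "r \<in> R" and x: "x \<in> topspace (cube (m r))" for s r x
      using \<kappa>_in_X [OF r x]
      by (cases "s 0 \<le> 1/2")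
         (simp_all add: collar_def cube_excess_0 [OF m_pos [OF r] x] cube_expand_0 [OF x] cube_concat_def
           cube_rev_def a_def \<Phi>_def \<phi>_def const_map_def)
    show "cube_concat ?\<alpha> \<phi> \<in> cube_maps n M c0"
      by (rule cube_concat_in_cube_maps [OF \<alpha> \<phi> n_pos])
    show "union_map b \<in> cube_maps n M c0"
      by (rule union_map_in_cube_maps [OF b])
  qed
  then have "homotopy_class n M c0 ?\<alpha> \<otimes>\<^bsub>PM\<^esub> C = union_class B"
    unfolding UB C \<phi>_def [symmetric] mult_PM [OF \<alpha> \<phi>] by (rule homotopy_class_eq)
  moreover have "homotopy_class n M c0 ?\<alpha> = inv\<^bsub>PM\<^esub> section_map A"
  proof -
    have "const_map X \<circ> cube_rev a = cube_rev (const_map X \<circ> a)"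
      by (auto simp: cube_rev_def)
    then show ?thesis
      using inv_homotopy_group [OF section_in_cube_maps [OF a] n_pos c0_in_M] section_class [OF a]
      by (simp add: A_def)
  qed
  moreover have "section_map A \<in> carrier PM" "C \<in> carrier PM"
    using section_in_GM [OF A] assms GM_subgroup subgroup.subset by blast+
  ultimately have "C = section_map A \<otimes>\<^bsub>PM\<^esub> union_class B"
    using PM.inv_solve_left PM.m_assoc [symmetric] PM.inv_closed
    by (metis PM.l_one PM.r_inv)
  then show ?thesis
    using that A B by blast
qed

text \<open>Evaluation at \<open>w0\<close> inverts the section and kills unions, so A can be read
  off from the product. The union factor is then determined by cancellation.\<close>

lemma gottlieb_group_null_component_iso:
  "GM \<cong> GY n \<times>\<times> sum_group R (\<lambda>r. GY (n + m r))"
proof -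
  let ?S = "sum_group R (\<lambda>r. GY (n + m r))"
  let ?H = "GY n \<times>\<times> ?S"
  define \<Theta> where "\<Theta> = (\<lambda>(A, B). section_map A \<otimes>\<^bsub>PM\<^esub> union_class B)"
  have GY: "group (GY (n + j))" for j
    using group_gottlieb_group [OF y0] n_pos by simp
  interpret H: group ?H
    by (intro DirProd_group sum_group GY) (use GY [of 0] in simp)
  \<comment> \<open>Finiteness of \<open>R\<close> makes the finite support condition of the direct
    sum void.\<close>
  have carS: "carrier ?S = (\<Pi>\<^sub>E r\<in>R. carrier (GY (n + m r)))"
    using carrier_sum_group [of R "\<lambda>r. GY (n + m r)"] GY finite_R by auto
  have GYc: "A \<in> carrier (PY n)" if "A \<in> carrier (GY n)" for A
    using GY_in_PY [OF n_pos that] .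
  have SB: "B r \<in> carrier (GY (n + m r))" "B r \<in> carrier (PY (n + m r))" if "B \<in> carrier ?S" "r \<in> R" for B r
  proof -
    show 1: "B r \<in> carrier (GY (n + m r))"
      using that carS by auto
    show "B r \<in> carrier (PY (n + m r))"
      by (rule GY_in_PY [OF _ 1]) (use n_pos in simp)
  qed
  have sG: "section_map A \<in> carrier GM" and sP: "section_map A \<in> carrier PM" if "A \<in> carrier (GY n)" for A
    using section_in_GM [OF that] subgroup.subset [OF GM_subgroup] by auto
  have uG: "union_class B \<in> carrier GM" and uP: "union_class B \<in> carrier PM" if "B \<in> carrier ?S" for B
    using union_in_GM [of B] SB(1) [OF that] subgroup.subset [OF GM_subgroup] by auto
  have "\<Theta> \<in> hom ?H GM"
  proof (rule homI)
    show "\<Theta> p \<in> carrier GM" if "p \<in> carrier ?H" for p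
      using that sG uG subgroup.m_closed [OF GM_subgroup] by (auto simp: \<Theta>_def)
    show "\<Theta> (p \<otimes>\<^bsub>?H\<^esub> q) = \<Theta> p \<otimes>\<^bsub>GM\<^esub> \<Theta> q" if "p \<in> carrier ?H" "q \<in> carrier ?H" for p q
    proof -
      obtain A B A' B' where pq: "p = (A, B)" "q = (A', B')" "A \<in> carrier (GY n)" "A' \<in> carrier (GY n)"
        "B \<in> carrier ?S" "B' \<in> carrier ?S"
        using \<open>p \<in> _\<close> \<open>q \<in> _\<close> by (auto simp: DirProd_def)
      let ?BB = "\<lambda>r\<in>R. B r \<otimes>\<^bsub>PY (n + m r)\<^esub> B' r"
      have "section_map (A \<otimes>\<^bsub>PY n\<^esub> A') = section_map A \<otimes>\<^bsub>PM\<^esub> section_map A'"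
        using hom_mult [OF section_hom] GYc pq by blast
      moreover have "union_class ?BB = union_class B \<otimes>\<^bsub>PM\<^esub> union_class B'"
        by (rule union_class_mult) (use SB(2) pq in auto)
      moreover have "section_map A' \<otimes>\<^bsub>PM\<^esub> union_class B = union_class B \<otimes>\<^bsub>PM\<^esub> section_map A'"
        by (rule GM_commute) (use sG uG pq in auto)
      moreover have "section_map A \<in> carrier PM" "section_map A' \<in> carrier PM"
        "union_class B \<in> carrier PM" "union_class B' \<in> carrier PM"
        using sP uP pq by auto
      ultimately have "section_map (A \<otimes>\<^bsub>PY n\<^esub> A') \<otimes>\<^bsub>PM\<^esub> union_class ?BB =
          (section_map A \<otimes>\<^bsub>PM\<^esub> union_class B) \<otimes>\<^bsub>PM\<^esub> (section_map A' \<otimes>\<^bsub>PM\<^esub> union_class B')"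
        using PM.mult_interchange by simp
      then show ?thesis
        by (simp add: \<Theta>_def pq)
    qed
  qed
  moreover have "inj_on \<Theta> (carrier ?H)"
  proof (rule inj_onI)
    fix p q assume p: "p \<in> carrier ?H" and q: "q \<in> carrier ?H" and eq: "\<Theta> p = \<Theta> q"
    obtain A B A' B' where pq: "p = (A, B)" "q = (A', B')" "A \<in> carrier (GY n)" "A' \<in> carrier (GY n)"
      "B \<in> carrier ?S" "B' \<in> carrier ?S"
      using p q by (auto simp: DirProd_def)
    have ev: "eval_map (section_map A \<otimes>\<^bsub>PM\<^esub> union_class B) = A" if "A \<in> carrier (GY n)" "B \<in> carrier ?S" for A B
      using hom_mult [OF eval_hom sP [OF that(1)] uP [OF that(2)]] eval_section [OF GYc [OF that(1)]]
        eval_union [OF SB(2) [OF that(2)]] monoid.r_one [OF group.is_monoid [OF group_PY [OF n_pos]] GYc [OF that(1)]]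
      by simp
    have eq': "section_map A \<otimes>\<^bsub>PM\<^esub> union_class B = section_map A' \<otimes>\<^bsub>PM\<^esub> union_class B'"
      using eq by (simp add: \<Theta>_def pq)
    have AA': "A = A'"
      using ev [OF pq(3,5)] ev [OF pq(4,6)] eq' by simp
    have UU: "union_class B = union_class B'"
      using eq' sP [OF pq(3)] uP [OF pq(5)] uP [OF pq(6)] by (simp add: AA' [symmetric])
    \<comment> \<open>\<open>union_class_eq_one\<close> recognises only units, so equal unions are
      compared through their factorwise quotient.\<close>
    let ?D = "\<lambda>r. inv\<^bsub>PY (n + m r)\<^esub> B r \<otimes>\<^bsub>PY (n + m r)\<^esub> B' r"
    have g: "group (PY (n + m r))" for r
      using group_PY [of "n + m r"] n_pos by simp
    have D: "?D r \<in> carrier (PY (n + m r))" if "r \<in> R" for r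
      using SB(2) [OF pq(5) that] SB(2) [OF pq(6) that] g
      by (simp add: group.inv_closed monoid.m_closed group.is_monoid)
    have BD: "B' r = B r \<otimes>\<^bsub>PY (n + m r)\<^esub> ?D r" if "r \<in> R" for r
    proof -
      interpret PYr: group "PY (n + m r)"
        by (rule g)
      show ?thesis
        using SB(2) [OF pq(5) that] SB(2) [OF pq(6) that] by (simp add: PYr.m_assoc [symmetric])
    qed
    have "union_class B' = union_class B \<otimes>\<^bsub>PM\<^esub> union_class ?D"
      by (rule union_class_mult [OF SB(2) [OF pq(5)] D BD])
    from trans [OF this [symmetric] UU [symmetric]]
    have "union_class B \<otimes>\<^bsub>PM\<^esub> union_class ?D = union_class B" .
    moreover have "union_class ?D \<in> carrier PM"
      by (rule union_class_in_PM) (rule D)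
    ultimately have UD: "union_class ?D = \<one>\<^bsub>PM\<^esub>"
      using PM.l_cancel_one uP [OF pq(5)] by blast
    have D1: "?D r = \<one>\<^bsub>PY (n + m r)\<^esub>" if "r \<in> R" for r
      by (rule union_class_eq_one [OF D UD that])
    have "B r = B' r" if "r \<in> R" for r
      using BD [OF that] D1 [OF that] monoid.r_one [OF group.is_monoid [OF g] SB(2) [OF pq(5) that]] by simp
    then have "B = B'"
      using pq(5,6) unfolding carS by (rule_tac PiE_ext)
    then show "p = q"
      by (simp add: pq AA')
  qed
  moreover have "\<Theta> ` carrier ?H = carrier GM"
  proof (intro equalityI subsetI)
    fix C assume "C \<in> carrier GM"
    then obtain A B where AB: "A \<in> carrier (GY n)" "\<And>r. r \<in> R \<Longrightarrow> B r \<in> carrier (GY (n + m r))"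
      "C = section_map A \<otimes>\<^bsub>PM\<^esub> union_class B"
      by (rule GM_decompose) blast
    \<comment> \<open>Elements of the direct sum are extensional on \<open>R\<close>, and
      \<open>union_class\<close> does not see values elsewhere.\<close>
    have "union_class (restrict B R) = union_class B"
      by (simp add: union_class_def)
    then have "C = \<Theta> (A, restrict B R)"
      using AB(3) by (simp add: \<Theta>_def)
    moreover have "(A, restrict B R) \<in> carrier ?H"
      using AB(1,2) by (simp add: carS)
    ultimately show "C \<in> \<Theta> ` carrier ?H"
      by blast
  next
    fix C assume "C \<in> \<Theta> ` carrier ?H"
    then show "C \<in> carrier GM"
      using hom_in_carrier [OF \<open>\<Theta> \<in> hom ?H GM\<close>] by blast
  qed
  ultimately have "\<Theta> \<in> iso ?H GM"
    by (simp add: iso_def bij_betw_def)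
  then have "?H \<cong> GM"
    by (auto simp: is_iso_def)
  then show ?thesis
    by (rule H.iso_sym)
qed

end

section \<open>The wedge of spheres\<close>

lemma cube_radius_scale:
  assumes "0 < m" "0 \<le> c" "\<And>j. j < m \<Longrightarrow> \<bar>2 * x' j - 1\<bar> = c * \<bar>2 * x j - 1\<bar>"
  shows "cube_radius m x' = c * cube_radius m x"
proof (rule antisym)
  obtain j where "j < m" "cube_radius m x' = \<bar>2 * x' j - 1\<bar>"
    using cube_radius_attained [OF assms(1)] by blast
  then show "cube_radius m x' \<le> c * cube_radius m x"
    using assms(2,3) cube_radius_ge [of j m x] by (simp add: mult_left_mono)
  obtain j where "j < m" "cube_radius m x = \<bar>2 * x j - 1\<bar>"
    using cube_radius_attained [OF assms(1)] by blast
  then show "c * cube_radius m x \<le> cube_radius m x'"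
    using assms(3) cube_radius_ge [of j m x'] by simp
qed

definition cube_sqnorm :: "nat \<Rightarrow> (nat \<Rightarrow> real) \<Rightarrow> real" where
  "cube_sqnorm m x = (\<Sum>j<m. (2 * x j - 1)\<^sup>2)"

text \<open>
  With $u = 2x - 1$ and $h = 1 - \max_j |u_j|$ this is the inverse stereographic projection of $u / h$,
  multiplied out so that it extends by the pole to $h = 0$.
\<close>

definition cube_to_sphere :: "nat \<Rightarrow> (nat \<Rightarrow> real) \<Rightarrow> nat \<Rightarrow> real" where
  "cube_to_sphere m x =
     (let h = 1 - cube_radius m x; d = cube_sqnorm m x + h\<^sup>2 in
      (\<lambda>j. if j = 0 then (cube_sqnorm m x - h\<^sup>2) / d
          else if j \<le> m then 2 * h * (2 * x (j - 1) - 1) / d else 0))"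

lemma cube_sqnorm_ge:
  assumes "0 < m"
  shows "(cube_radius m x)\<^sup>2 \<le> cube_sqnorm m x"
proof -
  obtain j where j: "j < m" "cube_radius m x = \<bar>2 * x j - 1\<bar>"
    using cube_radius_attained [OF assms] by blast
  have "(2 * x j - 1)\<^sup>2 \<le> cube_sqnorm m x"
    unfolding cube_sqnorm_def by (rule member_le_sum) (use j in auto)
  then show ?thesis
    using j by simp
qed

text \<open>The two terms cannot vanish together: norm 0 forces radius 0, and then the second term
  is 1.\<close>

lemma cube_to_sphere_denom_pos:
  assumes "0 < m"
  shows "0 < cube_sqnorm m x + (1 - cube_radius m x)\<^sup>2"
proof -
  have "0 < (cube_radius m x)\<^sup>2 + (1 - cube_radius m x)\<^sup>2"
    by (cases "cube_radius m x = 0") (auto intro: add_pos_nonneg)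
  then show ?thesis
    using cube_sqnorm_ge [OF assms, of x] by linarith
qed

lemma cube_to_sphere_0:
  "cube_to_sphere m x 0 =
     (cube_sqnorm m x - (1 - cube_radius m x)\<^sup>2) / (cube_sqnorm m x + (1 - cube_radius m x)\<^sup>2)"
  by (simp add: cube_to_sphere_def Let_def)

lemma cube_to_sphere_Suc:
  "j < m \<Longrightarrow> cube_to_sphere m x (Suc j) =
     2 * (1 - cube_radius m x) * (2 * x j - 1) / (cube_sqnorm m x + (1 - cube_radius m x)\<^sup>2)"
  by (simp add: cube_to_sphere_def Let_def)

lemma cube_to_sphere_beyond: "m < j \<Longrightarrow> cube_to_sphere m x j = 0"
  by (simp add: cube_to_sphere_def Let_def)

lemma in_topspace_nsphere_iff:
  "p \<in> topspace (nsphere m) \<longleftrightarrow> (p 0)\<^sup>2 + (\<Sum>j<m. (p (Suc j))\<^sup>2) = 1 \<and> (\<forall>j>m. p j = 0)"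
  by (simp add: nsphere sum.atMost_shift)

lemma sphere_index_cases: "j = 0 \<or> (\<exists>i<m. j = Suc i) \<or> m < j"
  by (cases j) auto

lemma cube_to_sphere_in_nsphere:
  assumes m: "0 < m"
  shows "cube_to_sphere m x \<in> topspace (nsphere m)"
proof -
  define h N where "h = 1 - cube_radius m x" and "N = cube_sqnorm m x"
  have d: "N + h\<^sup>2 \<noteq> 0"
    using cube_to_sphere_denom_pos [OF m, of x] by (simp add: h_def N_def)
  have "(\<Sum>j<m. (cube_to_sphere m x (Suc j))\<^sup>2) = (\<Sum>j<m. (2 * h / (N + h\<^sup>2))\<^sup>2 * (2 * x j - 1)\<^sup>2)"
    by (rule sum.cong) (auto simp: cube_to_sphere_Suc h_def N_def power_mult_distrib power_divide)
  also have "\<dots> = (2 * h / (N + h\<^sup>2))\<^sup>2 * N"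
    by (simp add: sum_distrib_left N_def cube_sqnorm_def)
  finally have "(cube_to_sphere m x 0)\<^sup>2 + (\<Sum>j<m. (cube_to_sphere m x (Suc j))\<^sup>2) =
      ((N - h\<^sup>2) / (N + h\<^sup>2))\<^sup>2 + (2 * h / (N + h\<^sup>2))\<^sup>2 * N"
    by (simp add: cube_to_sphere_0 h_def N_def)
  also have "\<dots> = ((N - h\<^sup>2)\<^sup>2 + (2 * h)\<^sup>2 * N) / (N + h\<^sup>2)\<^sup>2"
    by (simp add: power_divide add_divide_distrib)
  also have "(N - h\<^sup>2)\<^sup>2 + (2 * h)\<^sup>2 * N = (N + h\<^sup>2)\<^sup>2"
    by (simp add: power2_eq_square algebra_simps)
  finally show ?thesis
    using d by (simp add: in_topspace_nsphere_iff cube_to_sphere_beyond)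
qed

lemma continuous_map_cube_to_sphere:
  assumes m: "0 < m"
  shows "continuous_map (cube m) (nsphere m) (cube_to_sphere m)"
proof -
  have cj: "continuous_map (cube m) euclideanreal (\<lambda>x. x j)" if "j < m" for j
    using continuous_map_cube_coord [OF continuous_map_id that] by (simp add: continuous_map_UI_iff)
  have cr: "continuous_map (cube m) euclideanreal (cube_radius m)"
    using continuous_map_cube_radius [OF continuous_map_id m] by simp
  have cN: "continuous_map (cube m) euclideanreal (cube_sqnorm m)"
    unfolding cube_sqnorm_def [abs_def] by (intro continuous_map_sum continuous_intros cj) auto
  have "continuous_map (cube m) euclideanreal (\<lambda>x. cube_to_sphere m x j)" for j
  proof -
    consider "j = 0" | i where "j = Suc i" "i < m" | "m < j"
      using sphere_index_cases [of j m] by blast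
    then show ?thesis
    proof cases
      case 1
      then show ?thesis
        unfolding 1 cube_to_sphere_0 using cube_to_sphere_denom_pos [OF m]
        by (intro continuous_map_real_divide continuous_intros cr cN) (metis less_irrefl)
    next
      case 2
      then show ?thesis
        unfolding 2(1) cube_to_sphere_Suc [OF 2(2)] using cube_to_sphere_denom_pos [OF m]
        by (intro continuous_map_real_divide continuous_intros cr cN cj) (metis less_irrefl)+
    next
      case 3
      then show ?thesis
        by (simp add: cube_to_sphere_beyond)
    qed
  qed
  then show ?thesis
    using cube_to_sphere_in_nsphere [OF m]
    by (auto simp: nsphere continuous_map_in_subtopology continuous_map_componentwise_UNIV)
qed

lemma cube_to_sphere_eq_point_iff:
  assumes m: "0 < m" and x: "x \<in> topspace (cube m)"
  shows "cube_to_sphere m x = sphere_point \<longleftrightarrow> x \<in> cube_boundary m"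
proof -
  define h N where "h = 1 - cube_radius m x" and "N = cube_sqnorm m x"
  have d: "0 < N + h\<^sup>2"
    using cube_to_sphere_denom_pos [OF m, of x] by (simp add: h_def N_def)
  have bd: "x \<in> cube_boundary m \<longleftrightarrow> h = 0"
    using cube_radius_eq_1_iff [OF m x] by (auto simp: h_def)
  have "cube_to_sphere m x = sphere_point" if h: "h = 0"
  proof
    fix j
    consider "j = 0" | i where "j = Suc i" "i < m" | "m < j"
      using sphere_index_cases [of j m] by blast
    then show "cube_to_sphere m x j = sphere_point j"
      using h d by cases (auto simp: cube_to_sphere_0 cube_to_sphere_Suc cube_to_sphere_beyond sphere_point_def h_def N_def)
  qed
  moreover have "h = 0" if "cube_to_sphere m x = sphere_point"
  proof -
    have "cube_to_sphere m x 0 = 1"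
      by (simp add: that sphere_point_def)
    then have "(N - h\<^sup>2) / (N + h\<^sup>2) = 1"
      unfolding cube_to_sphere_0 h_def N_def .
    then show ?thesis
      using d by (simp add: divide_eq_1_iff)
  qed
  ultimately show ?thesis
    using bd by blast
qed

text \<open>Projection from the pole cancels the common denominator and returns
  \<open>u / h\<close>, in the notation used for \<open>cube_to_sphere\<close>. Injectivity thereby
  becomes a statement about that quotient.\<close>

lemma cube_to_sphere_stereographic:
  assumes m: "0 < m" and h: "cube_radius m x \<noteq> 1" and j: "j < m"
  shows "cube_to_sphere m x (Suc j) / (1 - cube_to_sphere m x 0) = (2 * x j - 1) / (1 - cube_radius m x)"
proof -
  define h N where "h = 1 - cube_radius m x" and "N = cube_sqnorm m x"
  have d: "N + h\<^sup>2 \<noteq> 0" and h0: "h \<noteq> 0"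
    using cube_to_sphere_denom_pos [OF m, of x] h by (simp_all add: h_def N_def)
  have "1 - cube_to_sphere m x 0 = 2 * h\<^sup>2 / (N + h\<^sup>2)"
    using d by (simp add: cube_to_sphere_0 h_def [symmetric] N_def [symmetric] field_simps)
  then show ?thesis
    using d h0 j
    by (simp add: cube_to_sphere_Suc h_def [symmetric] N_def [symmetric] power2_eq_square)
qed

text \<open>Equal projections make \<open>2 x' - 1\<close> the multiple \<open>h' / h\<close> of
  \<open>2 x - 1\<close>. Comparing radii gives \<open>1 - h' = h' / h * (1 - h)\<close>, which
  forces \<open>h = h'\<close>.\<close>

lemma cube_to_sphere_inj:
  assumes m: "0 < m" and x: "x \<in> topspace (cube m)" and x': "x' \<in> topspace (cube m)"
    and eq: "cube_to_sphere m x = cube_to_sphere m x'" and int: "x \<notin> cube_boundary m"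
  shows "x = x'"
proof -
  have int': "x' \<notin> cube_boundary m"
    using cube_to_sphere_eq_point_iff [OF m x] cube_to_sphere_eq_point_iff [OF m x'] eq int by simp
  define h h' where "h = 1 - cube_radius m x" and "h' = 1 - cube_radius m x'"
  have h: "0 < h" "0 < h'"
    using cube_radius_eq_1_iff [OF m x] cube_radius_eq_1_iff [OF m x'] int int'
      cube_radius_le_1 [OF m x] cube_radius_le_1 [OF m x'] by (auto simp: h_def h'_def)
  have u: "(2 * x j - 1) / h = (2 * x' j - 1) / h'" if "j < m" for j
    using cube_to_sphere_stereographic [OF m _ that, of x] cube_to_sphere_stereographic [OF m _ that, of x']
      h eq by (simp add: h_def h'_def)
  have "\<bar>2 * x' j - 1\<bar> = h' / h * \<bar>2 * x j - 1\<bar>" if "j < m" for j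
  proof -
    have "2 * x' j - 1 = h' / h * (2 * x j - 1)"
      using u [OF that] h by (simp add: field_simps)
    then have "\<bar>2 * x' j - 1\<bar> = \<bar>h' / h\<bar> * \<bar>2 * x j - 1\<bar>"
      by (metis abs_mult)
    then show ?thesis
      using h by simp
  qed
  then have "cube_radius m x' = h' / h * cube_radius m x"
    using h m by (intro cube_radius_scale) auto
  then have "1 - h' = h' / h * (1 - h)"
    by (simp add: h_def h'_def)
  then have "h = h'"
    using h by (simp add: field_simps)
  then have "x j = x' j" if "j < m" for j
    using u [OF that] h by simp
  then show ?thesis
    using x x' unfolding in_topspace_cube by (intro extensionalityI [of x "{..<m}"]) auto
qed

lemma cube_to_sphere_surj:
  assumes m: "0 < m" and p: "p \<in> topspace (nsphere m)" "p \<noteq> sphere_point"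
  shows "\<exists>x\<in>topspace (cube m). cube_to_sphere m x = p"
proof -
  have sum1: "(p 0)\<^sup>2 + (\<Sum>j<m. (p (Suc j))\<^sup>2) = 1" and beyond: "\<And>j. m < j \<Longrightarrow> p j = 0"
    using p(1) by (auto simp: in_topspace_nsphere_iff)
  have "p 0 \<noteq> 1"
  proof
    assume 1: "p 0 = 1"
    then have "(\<Sum>j<m. (p (Suc j))\<^sup>2) = 0"
      using sum1 by simp
    then have "p (Suc j) = 0" if "j < m" for j
      using that by (subst (asm) sum_nonneg_eq_0_iff) auto
    then have "p j = sphere_point j" for j
      using 1 beyond [of j] sphere_index_cases [of j m] by (auto simp: sphere_point_def)
    then show False
      using p(2) by blast
  qed
  moreover have "0 \<le> (\<Sum>j<m. (p (Suc j))\<^sup>2)"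
    by (simp add: sum_nonneg)
  then have "(p 0)\<^sup>2 \<le> 1\<^sup>2"
    using sum1 by simp
  then have "p 0 \<le> 1"
    by (rule power2_le_imp_le) simp
  ultimately have c: "0 < 1 - p 0"
    by simp
  \<comment> \<open>v is the stereographic image of p, and \<open>u / (1 - |u|) = v\<close> has to
    be solved in the maximum norm. With V the norm of v the solution is
    \<open>u = v / (1 + V)\<close>, and t is its value of \<open>1 - |u|\<close>. Passing to
    \<open>(v j + 1) / 2\<close> undoes the affine change inside \<open>cube_radius\<close>.\<close>
  define v where "v = (\<lambda>j. p (Suc j) / (1 - p 0))"
  define V where "V = cube_radius m (\<lambda>j. (v j + 1) / 2)"
  define t where "t = 1 / (1 + V)"
  define x where "x = (\<lambda>j\<in>{..<m}. (t * v j + 1) / 2)"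
  have V: "0 \<le> V" "\<bar>v j\<bar> \<le> V" if "j < m" for j
  proof -
    show "0 \<le> V"
      unfolding V_def by (rule cube_radius_nonneg [OF m])
    have "2 * ((v j + 1) / 2) - 1 = v j"
      by (simp add: field_simps)
    then show "\<bar>v j\<bar> \<le> V"
      unfolding V_def using cube_radius_ge [OF that, of "\<lambda>j. (v j + 1) / 2"] by metis
  qed
  have t: "0 < t" "t * V = 1 - t"
    using V(1) [OF m] by (simp_all add: t_def field_simps)
  have xv: "2 * x j - 1 = t * v j" if "j < m" for j
    using that by (simp add: x_def field_simps)
  have x: "x \<in> topspace (cube m)"
  proof -
    have "\<bar>t * v j\<bar> \<le> 1" if "j < m" for j
    proof -
      have "\<bar>t * v j\<bar> \<le> t * V"
        using mult_left_mono [OF V(2) [OF that], of t] t(1) by (simp add: abs_mult)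
      then show ?thesis
        using t by simp
    qed
    then show ?thesis
      by (auto simp: in_topspace_cube x_def abs_le_iff) (smt (verit))+
  qed
  have "2 * ((v j + 1) / 2) - 1 = v j" for j
    by (simp add: field_simps)
  then have "cube_radius m x = t * V"
    unfolding V_def using m t(1) xv by (intro cube_radius_scale) (simp_all only: abs_mult abs_of_pos less_imp_le)
  then have h: "1 - cube_radius m x = t"
    using t by simp
  have "cube_sqnorm m x = (\<Sum>j<m. (t / (1 - p 0))\<^sup>2 * (p (Suc j))\<^sup>2)"
    unfolding cube_sqnorm_def by (rule sum.cong) (auto simp: xv v_def power_mult_distrib power_divide)
  also have "\<dots> = (t / (1 - p 0))\<^sup>2 * (\<Sum>j<m. (p (Suc j))\<^sup>2)"
    by (simp add: sum_distrib_left)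
  also have "(\<Sum>j<m. (p (Suc j))\<^sup>2) = (1 - p 0) * (1 + p 0)"
    using sum1 by (simp add: algebra_simps power2_eq_square)
  finally have N: "cube_sqnorm m x = t\<^sup>2 * (1 + p 0) / (1 - p 0)"
    using c by (simp add: power2_eq_square)
  have d: "cube_sqnorm m x + t\<^sup>2 = 2 * t\<^sup>2 / (1 - p 0)"
    using c by (simp add: N field_simps)
  have "cube_to_sphere m x j = p j" for j
  proof -
    consider "j = 0" | i where "j = Suc i" "i < m" | "m < j"
      using sphere_index_cases [of j m] by blast
    then show ?thesis
    proof cases
      case 1
      have "cube_sqnorm m x - t\<^sup>2 = 2 * t\<^sup>2 * p 0 / (1 - p 0)"
        using c by (simp add: N field_simps)
      then show ?thesis
        using c t(1) by (simp add: 1 cube_to_sphere_0 h d)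
    next
      case 2
      then show ?thesis
        unfolding 2(1) cube_to_sphere_Suc [OF 2(2)] h d xv [OF 2(2)] v_def
        using c t(1) by (simp add: power2_eq_square)
    next
      case 3
      then show ?thesis
        using beyond by (simp add: cube_to_sphere_beyond)
    qed
  qed
  then show ?thesis
    using x by blast
qed

section \<open>Separation in the wedge and its characteristic maps\<close>

lemma Hausdorff_space_separating:
  assumes "\<And>x y. x \<in> topspace X \<Longrightarrow> y \<in> topspace X \<Longrightarrow> x \<noteq> y \<Longrightarrow>
    \<exists>f (Z :: 'z topology). continuous_map X Z f \<and> Hausdorff_space Z \<and> f x \<noteq> f y"
  shows "Hausdorff_space X"
  unfolding Hausdorff_space_def
proof (intro allI impI, elim conjE)
  fix x y assume xy: "x \<in> topspace X" "y \<in> topspace X" "x \<noteq> y"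
  obtain f and Z :: "'z topology" where f: "continuous_map X Z f" "Hausdorff_space Z" "f x \<noteq> f y"
    using assms [OF xy] by blast
  then have "f x \<in> topspace Z" "f y \<in> topspace Z"
    using xy by (auto dest: continuous_map_funspace)
  with f(2,3) have "\<exists>U V. openin Z U \<and> openin Z V \<and> f x \<in> U \<and> f y \<in> V \<and> disjnt U V"
    unfolding Hausdorff_space_def by simp
  then obtain U V where UV: "openin Z U" "openin Z V" "f x \<in> U" "f y \<in> V" "disjnt U V"
    by blast
  have "openin X {z \<in> topspace X. f z \<in> U}" "openin X {z \<in> topspace X. f z \<in> V}"
    using openin_continuous_map_preimage [OF f(1)] UV(1,2) by auto
  moreover have "disjnt {z \<in> topspace X. f z \<in> U} {z \<in> topspace X. f z \<in> V}"
    using UV(5) by (auto simp: disjnt_iff)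
  ultimately show "\<exists>U V. openin X U \<and> openin X V \<and> x \<in> U \<and> y \<in> V \<and> disjnt U V"
    using xy UV(3,4) by (intro exI conjI) auto
qed

definition wedge_collapse :: "'i \<Rightarrow> 'a \<Rightarrow> ('i \<times> 'a) option \<Rightarrow> 'a" where
  "wedge_collapse r p w = (case w of None \<Rightarrow> p | Some (r', x) \<Rightarrow> if r' = r then x else p)"

lemma topspace_wedge:
  "topspace (wedge X p I) = (\<lambda>(i, x). if x = p i then None else Some (i, x)) ` Sigma I (topspace \<circ> X)"
  by (simp add: wedge_def)

lemma continuous_map_wedge_collapse:
  assumes r: "r \<in> I" and p: "p r \<in> topspace (X r)"
  shows "continuous_map (wedge X p I) (X r) (wedge_collapse r (p r))"
proof -
  let ?q = "\<lambda>(i, x). if x = p i then None else Some (i, x)"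
  have "continuous_map (sum_topology X I) (X r) (wedge_collapse r (p r) \<circ> ?q)"
    unfolding continuous_map_def
  proof (intro conjI funcsetI allI impI)
    show "(wedge_collapse r (p r) \<circ> ?q) z \<in> topspace (X r)" if "z \<in> topspace (sum_topology X I)" for z
      using that p by (auto simp: wedge_collapse_def)
    fix U assume U: "openin (X r) U"
    have *: "{x. (i, x) \<in> {z \<in> topspace (sum_topology X I). (wedge_collapse r (p r) \<circ> ?q) z \<in> U}} =
        (if i = r then U else if p r \<in> U then topspace (X i) else {})" if "i \<in> I" for i
      using that openin_subset [OF U] by (auto simp: wedge_collapse_def)
    show "openin (sum_topology X I) {z \<in> topspace (sum_topology X I). (wedge_collapse r (p r) \<circ> ?q) z \<in> U}"
      unfolding openin_sum_topology
    proof (intro conjI ballI)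
      fix i assume "i \<in> I"
      then show "openin (X i) {x. (i, x) \<in> {z \<in> topspace (sum_topology X I). (wedge_collapse r (p r) \<circ> ?q) z \<in> U}}"
        unfolding * [OF \<open>i \<in> I\<close>] using U by auto
    qed auto
  qed
  then show ?thesis
    using continuous_compose_quotient_map [OF quotient_map_quotient_topology] unfolding wedge_def by blast
qed

text \<open>The collapses onto the single summands separate points: a point off the wedge point is
  told from every other point by the collapse onto its own summand.\<close>

lemma Hausdorff_space_wedge:
  fixes X :: "'i \<Rightarrow> 'a topology"
  assumes H: "\<And>i. i \<in> I \<Longrightarrow> Hausdorff_space (X i)" and p: "\<And>i. i \<in> I \<Longrightarrow> p i \<in> topspace (X i)"
  shows "Hausdorff_space (wedge X p I)"
proof (rule Hausdorff_space_separating)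
  fix v w assume vw: "v \<in> topspace (wedge X p I)" "w \<in> topspace (wedge X p I)" "v \<noteq> w"
  have "\<exists>r\<in>I. wedge_collapse r (p r) v \<noteq> wedge_collapse r (p r) w"
    using vw by (auto simp: topspace_wedge wedge_collapse_def split: if_splits)
  then obtain r where r: "r \<in> I" "wedge_collapse r (p r) v \<noteq> wedge_collapse r (p r) w"
    by blast
  then show "\<exists>f (Z :: 'a topology). continuous_map (wedge X p I) Z f \<and> Hausdorff_space Z \<and> f v \<noteq> f w"
    using continuous_map_wedge_collapse [where X = X and p = p, OF r(1) p [OF r(1)]] H [OF r(1)]
    by (intro exI [of _ "wedge_collapse r (p r)"] exI [of _ "X r"] conjI)
qed

definition wedge_cell :: "(nat \<Rightarrow> nat) \<Rightarrow> nat \<Rightarrow> (nat \<Rightarrow> real) \<Rightarrow> (nat \<times> (nat \<Rightarrow> real)) option" where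
  "wedge_cell i r x =
     (if cube_to_sphere (i r) x = sphere_point then None else Some (r, cube_to_sphere (i r) x))"

lemma sphere_wedge_wedge_of_spheres:
  assumes k: "k \<ge> 1" and i: "\<And>r. r \<in> {1..k} \<Longrightarrow> i r \<ge> 1"
  shows "sphere_wedge (wedge_of_spheres k i) None {1..k} i (wedge_cell i)"
proof
  have ip: "0 < i r" if "r \<in> {1..k}" for r
    using i [OF that] by simp
  have "Hausdorff_space (nsphere j)" for j
    by (simp add: nsphere Hausdorff_space_subtopology Hausdorff_space_product_topology)
  then show "Hausdorff_space (wedge_of_spheres k i)"
    unfolding wedge_of_spheres_def by (intro Hausdorff_space_wedge sphere_point_in_nsphere)
  show "finite {1..k}" "{1..k} \<noteq> {}"
    using k by auto
  show "0 < i r" if "r \<in> {1..k}" for r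
    using ip [OF that] .
  show "continuous_map (cube (i r)) (wedge_of_spheres k i) (wedge_cell i r)" if r: "r \<in> {1..k}" for r
  proof -
    let ?q = "\<lambda>(i, x). if x = sphere_point then None else Some (i, x)"
    have q: "continuous_map (sum_topology (\<lambda>r. nsphere (i r)) {1..k}) (wedge_of_spheres k i) ?q"
      unfolding wedge_of_spheres_def wedge_def
      by (rule quotient_imp_continuous_map [OF quotient_map_quotient_topology])
    have j: "continuous_map (nsphere (i r)) (sum_topology (\<lambda>r. nsphere (i r)) {1..k}) (\<lambda>x. (r, x))"
      using continuous_map_component_injection [OF r, of "\<lambda>r. nsphere (i r)"] .
    from continuous_map_comp [OF q continuous_map_comp [OF j continuous_map_cube_to_sphere [OF ip [OF r]]]]
    show ?thesis
      by (simp add: wedge_cell_def [abs_def])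
  qed
  show "topspace (wedge_of_spheres k i) = (\<Union>r\<in>{1..k}. wedge_cell i r ` topspace (cube (i r)))"
  proof (intro equalityI subsetI)
    fix w assume "w \<in> topspace (wedge_of_spheres k i)"
    then obtain r p where r: "r \<in> {1..k}" "p \<in> topspace (nsphere (i r))"
      and w: "w = (if p = sphere_point then None else Some (r, p))"
      by (auto simp: wedge_of_spheres_def topspace_wedge)
    have "\<exists>x\<in>topspace (cube (i r)). cube_to_sphere (i r) x = p"
    \<comment> \<open>The pole is not covered by the stereographic argument; it is the image of the
      boundary of the cube, which is nonempty.\<close>
    proof (cases "p = sphere_point")
      case True
      then show ?thesis
        using cube_boundary_nonempty [OF ip [OF r(1)]] cube_boundary_subset
          cube_to_sphere_eq_point_iff [OF ip [OF r(1)]] by (metis subsetD)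
    next
      case False
      then show ?thesis
        using cube_to_sphere_surj [OF ip [OF r(1)] r(2)] by blast
    qed
    then show "w \<in> (\<Union>r\<in>{1..k}. wedge_cell i r ` topspace (cube (i r)))"
      using r w by (force simp: wedge_cell_def)
  next
    fix w assume "w \<in> (\<Union>r\<in>{1..k}. wedge_cell i r ` topspace (cube (i r)))"
    then obtain r x where rx: "r \<in> {1..k}" "w = wedge_cell i r x"
      by blast
    then have "(r, cube_to_sphere (i r) x) \<in> Sigma {1..k} (topspace \<circ> (\<lambda>r. nsphere (i r)))"
      using cube_to_sphere_in_nsphere [OF ip] by simp
    then show "w \<in> topspace (wedge_of_spheres k i)"
      unfolding wedge_of_spheres_def topspace_wedge using rx
      by (intro image_eqI [of _ _ "(r, cube_to_sphere (i r) x)"]) (simp_all add: wedge_cell_def)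
  qed
  show "wedge_cell i r x = None \<longleftrightarrow> x \<in> cube_boundary (i r)"
    if "r \<in> {1..k}" "x \<in> topspace (cube (i r))" for r x
    using cube_to_sphere_eq_point_iff [OF ip [OF that(1)] that(2)] by (simp add: wedge_cell_def)
  show "r = r' \<and> x = x'"
    if "r \<in> {1..k}" "r' \<in> {1..k}" "x \<in> topspace (cube (i r))" "x' \<in> topspace (cube (i r'))"
      and eq: "wedge_cell i r x = wedge_cell i r' x'" and int: "x \<notin> cube_boundary (i r)" for r r' x x'
  proof -
    have "cube_to_sphere (i r) x \<noteq> sphere_point"
      using cube_to_sphere_eq_point_iff [OF ip [OF that(1)] that(3)] int by simp
    then have "r = r'" "cube_to_sphere (i r) x = cube_to_sphere (i r') x'"
      using eq by (auto simp: wedge_cell_def split: if_splits)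
    then show ?thesis
      using cube_to_sphere_inj [OF ip [OF that(1)] that(3) _ _ int, of x'] that(4) by simp
  qed
qed

theorem mainTheorem3:
  fixes Y :: "'b topology" and y0 :: 'b and i :: "nat \<Rightarrow> nat" and k n :: nat
  assumes "k \<ge> 1" and "\<And>r. r \<in> {1..k} \<Longrightarrow> i r \<ge> 1"
    and "y0 \<in> topspace Y"
    and "path_connected_space Y"
    and "locally_compact_space Y"
    and "Hausdorff_space Y"
    and "well_pointed Y y0"
    and "n \<ge> 1"
  shows "gottlieb_group n (null_component (wedge_of_spheres k i) Y y0)
           (const_map (wedge_of_spheres k i) y0)
         \<cong> gottlieb_group n Y y0 \<times>\<times> sum_group {1..k} (\<lambda>r. gottlieb_group (n + i r) Y y0)"
proof -
  interpret wedge_mapping "wedge_of_spheres k i" None "{1..k}" i "wedge_cell i" Y y0 n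
    by (intro wedge_mapping.intro wedge_mapping_axioms.intro sphere_wedge_wedge_of_spheres)
       (use assms in auto)
  show ?thesis
    by (rule gottlieb_group_null_component_iso)
qed

end
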